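(* Let $k$ be a perfect large field and let $\Sigma \subset k$ be an infinite diophantine subset. Let $I$ be a finite index set, let $\{k_i\}_{i \in I}$ be any collection of proper subfields of $k$, and let $\{\alpha_i\}_{i\in I}$ and $\{\beta_i\}_{i \in I}$ be families of elements of $k$. Then $$\left|\Sigma \setminus \bigcup_{i \in I} (\alpha_i k_i + \beta_i)\right| = |k|.$$
   Context: A field $k$ is large if every curve $C$ defined over $k$ with at least one smooth $k$-rational point has infinitely many $k$-rational points (curve: integral one-dimensional $k$-variety). A subset $\Sigma \subset k = \mathbb{A}^1(k)$ is diophantine (in $k$) if $\Sigma = \pi(X(k))$ for some morphism $\pi : X \to \mathbb{A}^1_k$ of $k$-varieties ($k$-schemes of finite type); equivalently, $\Sigma$ is definable in $k$ by an existential first-order formula in the language of fields with parameters from $k$. For a subfield $k_i\subset k$ and $\alpha_i,\beta_i\in k$, $\alpha_i k_i + \beta_i = \{\alpha_i x + \beta_i : x \in k_i\}$. $|\cdot|$ denotes cardinality. *)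

theory Defs
  imports
    "HOL-Algebra.Algebraic_Closure_Type"
    "HOL-Library.Poly_Mapping"
    "HOL-Library.Function_Algebras"
    "HOL-Library.Extended_Nat"
    "HOL-Library.FuncSet"
    "HOL-Library.Equipollence"
begin

text \<open>Throughout, the ground field \<open>k\<close> is a type of class \<open>field\<close>; as a HOL-Algebra ring it is
  \<open>ring_of_type_algebra\<close>.\<close>

definition perfect_field :: "'a::field itself \<Rightarrow> bool" where
  "perfect_field _ \<longleftrightarrow> CHAR('a) = 0 \<or> surj (\<lambda>x::'a. x ^ CHAR('a))"


section \<open>Affine curves and large fields\<close>

text \<open>A polynomial in the variables \<open>x\<^sub>0, x\<^sub>1, \<dots>\<close> is a finitely supported map from monomials to
  coefficients; a monomial is a finitely supported map from variable indices to exponents.\<close>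

type_synonym 'a mpoly = "(nat \<Rightarrow>\<^sub>0 nat) \<Rightarrow>\<^sub>0 'a"

definition polys :: "nat \<Rightarrow> 'a::zero mpoly set" where
  "polys n = {p. \<forall>m \<in> Poly_Mapping.keys p. Poly_Mapping.keys m \<subseteq> {..<n}}"

definition mpoly_ring :: "nat \<Rightarrow> 'a::field mpoly ring" where
  "mpoly_ring n = ring_of_type_algebra\<lparr>carrier := polys n\<rparr>"

definition peval :: "(nat \<Rightarrow> 'a) \<Rightarrow> 'a::field mpoly \<Rightarrow> 'a" where
  "peval x p = (\<Sum>m \<in> Poly_Mapping.keys p. Poly_Mapping.lookup p m *
      (\<Prod>i \<in> Poly_Mapping.keys m. x i ^ Poly_Mapping.lookup m i))"

text \<open>The truncated subtraction is harmless: if \<open>x\<^sub>i\<close> does not occur in the monomial \<open>m\<close>, then the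
  coefficient below is \<open>0\<close>.\<close>

definition partial_deriv :: "nat \<Rightarrow> 'a::field mpoly \<Rightarrow> 'a mpoly" where
  "partial_deriv i p = (\<Sum>m \<in> Poly_Mapping.keys p.
      Poly_Mapping.single (m - Poly_Mapping.single i 1)
        (of_nat (Poly_Mapping.lookup m i) * Poly_Mapping.lookup p m))"

text \<open>The supremum of the lengths of chains of prime ideals (meaningful for nonzero rings).\<close>

definition krull_dim :: "('b, 'c) ring_scheme \<Rightarrow> enat" where
  "krull_dim R = Sup {enat d | d. \<exists>Q :: nat \<Rightarrow> 'b set.
      (\<forall>i\<le>d. primeideal (Q i) R) \<and> (\<forall>i<d. Q i \<subset> Q (Suc i))}"

text \<open>\<open>affine_curve n P\<close>: the closed subscheme \<open>Spec (k[x\<^sub>0,\<dots>,x\<^bsub>n-1\<^esub>]/P)\<close> of affine \<open>n\<close>-space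
  is an integral one-dimensional \<open>k\<close>-scheme. Up to isomorphism these are all the affine curves
  over \<open>k\<close>.\<close>

definition affine_curve :: "nat \<Rightarrow> 'a::field mpoly set \<Rightarrow> bool" where
  "affine_curve n P \<longleftrightarrow> ideal P (mpoly_ring n) \<and> domain (mpoly_ring n Quot P)
      \<and> krull_dim (mpoly_ring n Quot P) = 1"

definition rational_points :: "nat \<Rightarrow> 'a::field mpoly set \<Rightarrow> (nat \<Rightarrow> 'a) set" where
  "rational_points n P = {x \<in> {..<n} \<rightarrow>\<^sub>E UNIV. \<forall>f\<in>P. peval x f = 0}"

text \<open>The rank at \<open>x\<close> of the Jacobian matrix of \<open>P\<close>, as the dimension of its row space. At a point
  of \<open>rational_points n P\<close>, by the Leibniz rule, the rows of any generators of \<open>P\<close> span the rows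
  of all elements of \<open>P\<close>, so no choice of generators is needed.\<close>

definition jacobian_rank :: "nat \<Rightarrow> 'a::field mpoly set \<Rightarrow> (nat \<Rightarrow> 'a) \<Rightarrow> nat" where
  "jacobian_rank n P x = vector_space.dim (\<lambda>c v i. c * v i :: 'a)
      ((\<lambda>f i. if i < n then peval x (partial_deriv i f) else 0) ` P)"

text \<open>Jacobian criterion for smoothness of relative dimension one: the rank is \<open>n - 1\<close>.\<close>

definition smooth_rational_point :: "nat \<Rightarrow> 'a::field mpoly set \<Rightarrow> (nat \<Rightarrow> 'a) \<Rightarrow> bool" where
  "smooth_rational_point n P x \<longleftrightarrow> x \<in> rational_points n P \<and> Suc (jacobian_rank n P x) = n"

text \<open>It suffices to quantify over affine curves: a smooth rational point of a curve has an affine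
  open neighbourhood, which is again a curve, and whose rational points are rational points of the
  whole curve.\<close>

definition large_field :: "'a::field itself \<Rightarrow> bool" where
  "large_field _ \<longleftrightarrow> (\<forall>n (P :: 'a mpoly set).
      affine_curve n P \<and> (\<exists>x. smooth_rational_point n P x) \<longrightarrow> infinite (rational_points n P))"


section \<open>Diophantine sets\<close>

text \<open>Terms and quantifier-free formulas in the language of fields, with parameters from \<open>k\<close>
  (which include the constants \<open>0\<close> and \<open>1\<close>).\<close>

datatype 'a fterm =
    Var nat
  | Param 'a
  | Plus "'a fterm" "'a fterm"
  | Minus "'a fterm"
  | Times "'a fterm" "'a fterm"

datatype 'a qf_formula =
    Equal "'a fterm" "'a fterm"
  | Neg "'a qf_formula"
  | Conj "'a qf_formula" "'a qf_formula"
  | Disj "'a qf_formula" "'a qf_formula"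

primrec term_val :: "(nat \<Rightarrow> 'a) \<Rightarrow> 'a::field fterm \<Rightarrow> 'a" where
  "term_val e (Var i) = e i"
| "term_val e (Param c) = c"
| "term_val e (Plus s t) = term_val e s + term_val e t"
| "term_val e (Minus t) = - term_val e t"
| "term_val e (Times s t) = term_val e s * term_val e t"

primrec qf_holds :: "(nat \<Rightarrow> 'a) \<Rightarrow> 'a::field qf_formula \<Rightarrow> bool" where
  "qf_holds e (Equal s t) \<longleftrightarrow> term_val e s = term_val e t"
| "qf_holds e (Neg \<phi>) \<longleftrightarrow> \<not> qf_holds e \<phi>"
| "qf_holds e (Conj \<phi> \<psi>) \<longleftrightarrow> qf_holds e \<phi> \<and> qf_holds e \<psi>"
| "qf_holds e (Disj \<phi> \<psi>) \<longleftrightarrow> qf_holds e \<phi> \<or> qf_holds e \<psi>"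

text \<open>The set is defined by the existential formula with matrix \<open>\<phi>\<close>: variable \<open>0\<close> is the free
  variable, all others are existentially quantified (only the finitely many that occur in \<open>\<phi>\<close>
  matter).\<close>

definition diophantine :: "'a::field set \<Rightarrow> bool" where
  "diophantine S \<longleftrightarrow> (\<exists>\<phi>. S = {a. \<exists>y :: nat \<Rightarrow> 'a. qf_holds (case_nat a y) \<phi>})"

end

theory Submission
  imports
    Defs
    "HOL-Computational_Algebra.Formal_Power_Series"
    "HOL-Computational_Algebra.Primes"
begin

text \<open>
  Enumerate an infinite diophantine set by itself and pass to a nonprincipal ultrafilter: the
  identity function \<open>s\<close> and the witnesses of the existential formula generate a field \<open>L\<close> over
  \<open>k(s)\<close>. After adjoining a \<open>p\<close>-power root \<open>y\<close> of \<open>s\<close>, the extension is separably generated over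
  \<open>k(y)\<close>, so by Hensel's lemma almost every point of the set lifts to a smooth arc over \<open>k[[t]]\<close> on
  which \<open>y = y\<^sub>0 + a t\<close>, for every slope \<open>a\<close>. Finitely many such arcs together lie on one curve with a
  smooth rational point. As \<open>k\<close> is large, the curve has infinitely many points, which gives some
  \<open>t \<noteq> 0\<close>; thus there is \<open>s\<^sub>0\<close> such that for every finite \<open>F \<subseteq> k\<close> some \<open>\<sigma> \<noteq> 0\<close> satisfies
  \<open>s\<^sub>0 + F \<sigma> \<subseteq> \<Sigma>\<close>.

  Choose \<open>2 |I| + 2\<close> elements \<open>b\<close> such that no ratio \<open>(b - b') / (b - b'')\<close> lies in any \<open>k\<^sub>i\<close>. For
  each \<open>c \<in> k\<close> apply this to \<open>F = c + {b}\<close>: every \<open>\<alpha>\<^sub>i k\<^sub>i + \<beta>\<^sub>i\<close> contains at most two of the points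
  \<open>s\<^sub>0 + (c + b) \<sigma>\<close>, so at least two of them survive, and these two determine \<open>c\<close>. Hence \<open>k\<close> embeds
  into \<open>A \<times> A\<close> times a finite set, where \<open>A\<close> is the complement.
\<close>

section \<open>Cosets of proper subfields\<close>

text \<open>The field \<open>L\<close> is never built: functions represent its elements, and
  equality in it means equality on a set of the ultrafilter. In characteristic p the base k(s) is
  not perfect although k is, and an extension of it need not be separably generated; hence the
  detour over all p-power roots of s. Separability of finitely many witnesses involves only finitely
  many of these roots, so one level M suffices, with q = p^M and y^q = s. A line in y of slope
  a^(1/q) becomes, by additivity of the q-th power, the line s0 + a t^q in s. Arcs put on one curve
  with a common parameter t therefore all yield the same \<sigma> = t^q. Every slope must be
  available at one base point, chosen before F: in the final count two surviving points determine c
  only because s0 does not vary with c. That finitely many arcs lie on a curve rests on counting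
  dimensions: two algebraically independent series have about m^2 independent monomials of degree at
  most m, too many for an algebra of linear growth.\<close>

lemma coset_avoidance:
  fixes HS :: "'a::ab_group_add set set"
  assumes "finite HS"
    and "\<And>H x y. H \<in> HS \<Longrightarrow> x \<in> H \<Longrightarrow> y \<in> H \<Longrightarrow> x - y \<in> H"
    and "\<And>H T. H \<in> HS \<Longrightarrow> finite T \<Longrightarrow> \<exists>x. \<forall>t\<in>T. x - t \<notin> H"
    and "finite T"
  shows "\<exists>x. \<forall>H\<in>HS. \<forall>t\<in>T. x - t \<notin> H"
  using assms
proof (induction HS arbitrary: T rule: finite_induct)
  case empty
  then show ?case by simp
next
  case (insert H HS)
  obtain x0 where x0: "\<forall>t\<in>T. x0 - t \<notin> H"
    using insert.prems(2)[of H T] insert.prems(3) by auto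
  \<comment> \<open>Neumann's covering argument. If the point \<open>x\<close> found for the smaller
    family falls into \<open>t + H\<close>, the shift by \<open>x0 - t\<close> moves it into
    \<open>x0 + H\<close>, which misses every \<open>t' + H\<close>. The shifted point avoids
    \<open>t' + H'\<close> once \<open>x\<close> avoids \<open>t - x0 + t' + H'\<close>, so these
    translates are added to \<open>T\<close> beforehand.\<close>
  define T' where "T' = T \<union> (\<lambda>(t, t'). t - x0 + t') ` (T \<times> T)"
  have "finite T'"
    using insert.prems(3) by (simp add: T'_def)
  then obtain x where x: "\<forall>H\<in>HS. \<forall>t\<in>T'. x - t \<notin> H"
    using insert.IH[of T'] insert.prems by auto
  show ?case
  proof (cases "\<forall>t\<in>T. x - t \<notin> H")
    case True
    then show ?thesis using x by (auto simp: T'_def)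
  next
    case False
    then obtain t where t: "t \<in> T" "x - t \<in> H" by blast
    have "x0 + (x - t) - t' \<notin> H" if "t' \<in> T" for t'
      using insert.prems(1)[of H "x0 + (x - t) - t'" "x - t"] t x0 that
      by (auto simp: algebra_simps)
    moreover have "x0 + (x - t) - t' \<notin> H'" if "t' \<in> T" "H' \<in> HS" for t' H'
    proof -
      have "t - x0 + t' \<in> T'" using that t by (force simp: T'_def)
      then have "x - (t - x0 + t') \<notin> H'" using x that by blast
      then show ?thesis by (simp add: algebra_simps)
    qed
    ultimately show ?thesis by (intro exI[of _ "x0 + (x - t)"]) auto
  qed
qed

lemma subfield_of_type:
  fixes K :: "'a::field set"
  assumes "subfield K (ring_of_type_algebra :: 'a ring)"
  shows "0 \<in> K" "1 \<in> K" "\<And>x y. x \<in> K \<Longrightarrow> y \<in> K \<Longrightarrow> x - y \<in> K"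
    "\<And>x y. x \<in> K \<Longrightarrow> y \<in> K \<Longrightarrow> x * y \<in> K" "\<And>x. x \<in> K \<Longrightarrow> inverse x \<in> K"
proof -
  interpret R: field "ring_of_type_algebra :: 'a ring"
    by (rule field_from_type_algebra)
  interpret K: subfield K "ring_of_type_algebra :: 'a ring"
    by fact
  have K: "subring K (ring_of_type_algebra :: 'a ring)"
    using K.subring_axioms .
  show 0: "0 \<in> K" and 1: "1 \<in> K"
    using subringE(2)[OF K] subringE(3)[OF K] by (auto simp: ring_of_type_algebra_def)
  have minus: "\<ominus>\<^bsub>ring_of_type_algebra\<^esub> x = - x" for x :: 'a
    by (rule sym, rule R.sum_zero_eq_neg) (auto simp: ring_of_type_algebra_def)
  show "x - y \<in> K" if "x \<in> K" "y \<in> K" for x y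
    using subringE(5)[OF K, of y] subringE(7)[OF K, of x "- y"] that
    by (auto simp: minus) (simp add: ring_of_type_algebra_def)
  show "x * y \<in> K" if "x \<in> K" "y \<in> K" for x y
    using subringE(6)[OF K, of x y] that by (simp add: ring_of_type_algebra_def)
  show "inverse x \<in> K" if "x \<in> K" for x
  proof (cases "x = 0")
    case False
    have "x \<in> K - {\<zero>\<^bsub>ring_of_type_algebra\<^esub>}"
      using that False by (simp add: ring_of_type_algebra_def)
    then have "inv\<^bsub>ring_of_type_algebra\<^esub> x \<in> K" "x \<otimes>\<^bsub>ring_of_type_algebra\<^esub> inv\<^bsub>ring_of_type_algebra\<^esub> x = \<one>\<^bsub>ring_of_type_algebra\<^esub>"
      using R.subfield_m_inv[OF assms, of x] by auto
    then have "inv\<^bsub>ring_of_type_algebra\<^esub> x \<in> K" "x * inv\<^bsub>ring_of_type_algebra\<^esub> x = 1"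
      by (simp_all add: ring_of_type_algebra_def)
    then show ?thesis by (metis inverse_unique)
  qed (simp add: 0)
qed

locale proper_subfields =
  fixes I :: "'i set" and K :: "'i \<Rightarrow> 'a::field set"
  assumes infinite_field: "infinite (UNIV :: 'a set)"
    and finite_I: "finite I"
    and subf: "\<And>i. i \<in> I \<Longrightarrow> subfield (K i) (ring_of_type_algebra :: 'a ring)"
    and proper: "\<And>i. i \<in> I \<Longrightarrow> K i \<noteq> UNIV"
begin

lemmas K_closed = subfield_of_type[OF subf]

text \<open>For \<open>u\<close> outside an infinite \<open>K i\<close>, the elements
  \<open>a * (u * k)\<close> lie in pairwise different cosets of \<open>a * K i\<close>: two in one
  coset would make \<open>u\<close> a quotient of elements of \<open>K i\<close>. A finite
  \<open>K i\<close> is handled by counting, because the whole field is infinite.\<close>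

lemma K_infinite_index:
  assumes "i \<in> I" "a \<noteq> 0" "finite T"
  shows "\<exists>x. \<forall>t\<in>T. x - t \<notin> (\<lambda>k. a * k) ` K i"
proof (rule ccontr)
  assume "\<not> ?thesis"
  then have cover: "\<exists>t\<in>T. \<exists>k\<in>K i. x - t = a * k" for x
    by blast
  show False
  proof (cases "finite (K i)")
    case True
    have "UNIV \<subseteq> (\<lambda>(t, k). t + a * k) ` (T \<times> K i)"
    proof
      fix x
      show "x \<in> (\<lambda>(t, k). t + a * k) ` (T \<times> K i)"
        using cover[of x] by (force simp: algebra_simps)
    qed
    then show False
      using True assms infinite_field finite_subset by blast
  next
    case False
    obtain u where u: "u \<notin> K i" using proper assms by blast
    define f where "f = (\<lambda>k. SOME t. t \<in> T \<and> (\<exists>l\<in>K i. a * (u * k) - t = a * l))"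
    have f: "f k \<in> T \<and> (\<exists>l\<in>K i. a * (u * k) - f k = a * l)" for k
      unfolding f_def by (rule someI_ex) (use cover in blast)
    have "inj_on f (K i)"
    proof (rule inj_onI, rule ccontr)
      fix k k' assume k: "k \<in> K i" "k' \<in> K i" "f k = f k'" "k \<noteq> k'"
      obtain l l' where l: "l \<in> K i" "l' \<in> K i" "a * (u * k) - f k = a * l" "a * (u * k') - f k' = a * l'"
        using f by meson
      then have "a * (u * (k - k')) = a * (l - l')"
        using k by (simp add: algebra_simps)
      then have "u = (l - l') * inverse (k - k')"
        using assms(2) k(4) by (simp add: eq_divide_eq divide_inverse[symmetric])
      moreover have "(l - l') * inverse (k - k') \<in> K i"
        by (intro K_closed(3-5)[OF assms(1)] l k)
      ultimately show False using u by simp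
    qed
    moreover have "f ` K i \<subseteq> T" using f by blast
    ultimately show False
      using False assms(3) finite_subset inj_on_finite by blast
  qed
qed

text \<open>Elements are added one at a time. Whichever position the new \<open>b\<close> takes in a
  forbidden relation, solving for it puts \<open>b\<close> into a coset of some
  \<open>(x - y) * K i\<close> with \<open>x\<close>, \<open>y\<close> and the representative among
  the old elements; finitely many such cosets do not cover the field.\<close>

lemma ex_generic_set:
  "\<exists>B. finite B \<and> card B = n \<and>
    (\<forall>x\<in>B. \<forall>y\<in>B. \<forall>z\<in>B. \<forall>i\<in>I. \<forall>k\<in>K i. x \<noteq> y \<and> x \<noteq> z \<and> y \<noteq> z \<longrightarrow> x - y \<noteq> (x - z) * k)"
proof (induction n)
  case 0
  show ?case by (intro exI[of _ "{}"]) simp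
next
  case (Suc n)
  then obtain B where B: "finite B" "card B = n"
    "\<And>x y z i k. x \<in> B \<Longrightarrow> y \<in> B \<Longrightarrow> z \<in> B \<Longrightarrow> i \<in> I \<Longrightarrow> k \<in> K i \<Longrightarrow>
       x \<noteq> y \<Longrightarrow> x \<noteq> z \<Longrightarrow> y \<noteq> z \<Longrightarrow> x - y \<noteq> (x - z) * k"
    by blast
  \<comment> \<open>The trivial subgroup is included to make \<open>b\<close> different from the
    elements of \<open>B\<close>.\<close>
  define HS where "HS = insert {0} ((\<lambda>(x, y, i). (\<lambda>k. (x - y) * k) ` K i) ` {(x, y, i). x \<in> B \<and> y \<in> B \<and> i \<in> I \<and> x \<noteq> y})"
  have "{(x, y, i). x \<in> B \<and> y \<in> B \<and> i \<in> I \<and> x \<noteq> y} \<subseteq> B \<times> B \<times> I" by auto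
  from finite_subset[OF this] have fin: "finite HS"
    unfolding HS_def using finite_I B(1) by simp
  have "\<exists>b. \<forall>H\<in>HS. \<forall>t\<in>B. b - t \<notin> H"
  proof (rule coset_avoidance[OF fin _ _ B(1)])
    fix H x y assume H: "H \<in> HS" "x \<in> H" "y \<in> H"
    show "x - y \<in> H"
    proof (cases "H = {0}")
      case False
      then obtain u v i where uvi: "i \<in> I" "H = (\<lambda>k. (u - v) * k) ` K i"
        using H by (auto simp: HS_def)
      then obtain k l where "k \<in> K i" "l \<in> K i" "x = (u - v) * k" "y = (u - v) * l"
        using H by auto
      then show ?thesis
        using K_closed(3)[OF uvi(1)] unfolding uvi by (auto simp: right_diff_distrib[symmetric])
    qed (use H in simp)
  next
    fix H :: "'a set" and T :: "'a set" assume H: "H \<in> HS" "finite T"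
    show "\<exists>x. \<forall>t\<in>T. x - t \<notin> H"
    proof (cases "H = {0}")
      case True
      then show ?thesis
        using ex_new_if_finite[OF infinite_field H(2)] by auto
    next
      case False
      then obtain u v i where "u \<noteq> v" "i \<in> I" "H = (\<lambda>k. (u - v) * k) ` K i"
        using H by (auto simp: HS_def)
      then show ?thesis
        using K_infinite_index[of i "u - v" T] H by auto
    qed
  qed
  then obtain b where b: "\<And>H t. H \<in> HS \<Longrightarrow> t \<in> B \<Longrightarrow> b - t \<notin> H" by blast
  have bB: "b \<notin> B" using b[of "{0}" b] by (auto simp: HS_def)
  have bK: "b - t \<noteq> (x - y) * k" if "t \<in> B" "x \<in> B" "y \<in> B" "i \<in> I" "x \<noteq> y" "k \<in> K i" for t x y i k
    using b[of "(\<lambda>k. (x - y) * k) ` K i" t] that by (force simp: HS_def)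
  show ?case
  proof (intro exI[of _ "insert b B"] conjI ballI impI)
    show "finite (insert b B)" "card (insert b B) = Suc n" using B bB by auto
    fix x y z i k assume *: "x \<in> insert b B" "y \<in> insert b B" "z \<in> insert b B" "i \<in> I" "k \<in> K i"
      "x \<noteq> y \<and> x \<noteq> z \<and> y \<noteq> z"
    note c = K_closed(1-5)[OF *(4)]
    show "x - y \<noteq> (x - z) * k"
    proof
      assume eq: "x - y = (x - z) * k"
      consider "x = b" "y \<in> B" "z \<in> B" | "y = b" "x \<in> B" "z \<in> B" | "z = b" "x \<in> B" "y \<in> B"
        | "x \<in> B" "y \<in> B" "z \<in> B" using * by auto
      then show False
      proof cases
        case 1
        have "k \<noteq> 1" using eq * by auto
        then have "b - y = (y - z) * (k * inverse (1 - k))"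
          using eq 1 by (simp add: field_simps)
        moreover have "k * inverse (1 - k) \<in> K i" by (intro c *)
        ultimately show False using bK[of y y z i] 1 * by blast
      next
        case 2
        then have "b - x = (z - x) * k" using eq by (simp add: algebra_simps)
        then show False using bK[of x z x i k] 2 * by blast
      next
        case 3
        then have "k \<noteq> 0" using eq * by auto
        then have "b - x = (y - x) * inverse k" using eq 3 by (simp add: field_simps)
        then show False using bK[of x y x i "inverse k"] 3 * c(5)[OF *(5)] by blast
      next
        case 4
        then show False using B(3) * eq by blast
      qed
    qed
  qed
qed

lemma complement_eqpoll_UNIV:
  assumes lines: "\<And>F. finite F \<Longrightarrow> \<exists>\<sigma>. \<sigma> \<noteq> 0 \<and> (\<forall>a\<in>F. s0 + a * \<sigma> \<in> S)"
  shows "S - (\<Union>i\<in>I. (\<lambda>x. \<alpha> i * x + \<beta> i) ` K i) \<approx> (UNIV :: 'a set)"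
proof -
  define A where "A = S - (\<Union>i\<in>I. (\<lambda>x. \<alpha> i * x + \<beta> i) ` K i)"
  obtain B where B: "finite B" "card B = 2 * card I + 2"
    "\<And>x y z i k. x \<in> B \<Longrightarrow> y \<in> B \<Longrightarrow> z \<in> B \<Longrightarrow> i \<in> I \<Longrightarrow> k \<in> K i \<Longrightarrow>
       x \<noteq> y \<Longrightarrow> x \<noteq> z \<Longrightarrow> y \<noteq> z \<Longrightarrow> x - y \<noteq> (x - z) * k"
    using ex_generic_set[of "2 * card I + 2"] by blast
  have two: "\<exists>\<sigma> b b'. \<sigma> \<noteq> 0 \<and> b \<in> B \<and> b' \<in> B \<and> b \<noteq> b' \<and> s0 + (c + b) * \<sigma> \<in> A \<and> s0 + (c + b') * \<sigma> \<in> A" for c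
  proof -
    obtain \<sigma> where \<sigma>: "\<sigma> \<noteq> 0" "\<And>b. b \<in> B \<Longrightarrow> s0 + (c + b) * \<sigma> \<in> S"
      using lines[of "(\<lambda>b. c + b) ` B"] B(1) by auto
    define Bi where "Bi i = {b \<in> B. s0 + (c + b) * \<sigma> \<in> (\<lambda>x. \<alpha> i * x + \<beta> i) ` K i}" for i
    \<comment> \<open>For three points in one translate of \<open>\<alpha> i * K i\<close>, forming
      the ratio of two differences cancels \<open>\<alpha> i\<close> and \<open>\<sigma>\<close> and
      leaves an element of \<open>K i\<close>, against the choice of \<open>B\<close>.\<close>
    have card2: "card (Bi i) \<le> 2" if i: "i \<in> I" for i
    proof (rule ccontr)
      assume "\<not> card (Bi i) \<le> 2"
      then have "3 \<le> card (Bi i)" by simp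
      from obtain_subset_with_card_n[OF this] obtain C where "C \<subseteq> Bi i" "card C = 3"
        by metis
      then obtain x y z where xyz: "x \<in> Bi i" "y \<in> Bi i" "z \<in> Bi i" "x \<noteq> y" "x \<noteq> z" "y \<noteq> z"
        by (auto simp: card_3_iff)
      obtain kx ky kz where k: "kx \<in> K i" "ky \<in> K i" "kz \<in> K i"
        "s0 + (c + x) * \<sigma> = \<alpha> i * kx + \<beta> i" "s0 + (c + y) * \<sigma> = \<alpha> i * ky + \<beta> i"
        "s0 + (c + z) * \<sigma> = \<alpha> i * kz + \<beta> i"
        using xyz by (auto simp: Bi_def)
      have xy: "(x - y) * \<sigma> = \<alpha> i * (kx - ky)"
        using arg_cong2[OF k(4) k(5), of minus] by (simp add: algebra_simps)
      have xz: "(x - z) * \<sigma> = \<alpha> i * (kx - kz)"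
        using arg_cong2[OF k(4) k(6), of minus] by (simp add: algebra_simps)
      have nz: "\<alpha> i \<noteq> 0" "kx - kz \<noteq> 0" using xz \<sigma>(1) xyz by auto
      have "(x - y) * \<sigma> * (kx - kz) = (x - z) * \<sigma> * (kx - ky)"
        unfolding xy xz by simp
      then have "((x - y) * (kx - kz)) * \<sigma> = ((x - z) * (kx - ky)) * \<sigma>"
        by (simp only: mult_ac)
      then have "(x - y) * (kx - kz) = (x - z) * (kx - ky)"
        using \<sigma>(1) by simp
      then have "x - y = (x - z) * ((kx - ky) * inverse (kx - kz))"
        using nz by (simp add: eq_divide_eq divide_inverse[symmetric])
      moreover have "(kx - ky) * inverse (kx - kz) \<in> K i"
        by (intro K_closed(3-5)[OF i] k)
      ultimately show False
        using B(3)[of x y z i] xyz i by (auto simp: Bi_def)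
    qed
    have "card (\<Union>i\<in>I. Bi i) \<le> 2 * card I"
      using card_UN_le[OF finite_I, of Bi] sum_bounded_above[of I "\<lambda>i. card (Bi i)" 2] card2 by simp
    moreover have fU: "finite (\<Union>i\<in>I. Bi i)" "(\<Union>i\<in>I. Bi i) \<subseteq> B" using B(1) finite_I by (auto simp: Bi_def)
    ultimately have D: "2 \<le> card (B - (\<Union>i\<in>I. Bi i))"
      using B(2) card_Diff_subset[of "\<Union>i\<in>I. Bi i" B] by linarith
    obtain C where C: "C \<subseteq> B - (\<Union>i\<in>I. Bi i)" "card C = 2"
      using obtain_subset_with_card_n[OF D] by metis
    obtain b b' where b: "C = {b, b'}" "b \<noteq> b'"
      using C(2) by (auto simp: card_2_iff)
    have good: "s0 + (c + d) * \<sigma> \<in> A" "d \<in> B" if "d \<in> C" for d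
    proof -
      show "d \<in> B" using that C(1) by blast
      then show "s0 + (c + d) * \<sigma> \<in> A"
        using that C(1) \<sigma>(2)[of d] unfolding A_def Bi_def by blast
    qed
    show ?thesis
      using \<sigma>(1) b good[of b] good[of b'] by blast
  qed
  then obtain \<sigma> b b' where s: "\<And>c. \<sigma> c \<noteq> 0" "\<And>c. b c \<in> B" "\<And>c. b' c \<in> B" "\<And>c. b c \<noteq> b' c"
    "\<And>c. s0 + (c + b c) * \<sigma> c \<in> A" "\<And>c. s0 + (c + b' c) * \<sigma> c \<in> A"
    by metis
  \<comment> \<open>Recording \<open>b c\<close> and \<open>b' c\<close> makes \<open>h\<close>
    injective: the difference of the two points gives \<open>\<sigma> c\<close>, and then one point
    gives \<open>c\<close>.\<close>
  define h where "h c = ((s0 + (c + b c) * \<sigma> c, s0 + (c + b' c) * \<sigma> c), (b c, b' c))" for c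
  have "inj h"
  proof (rule injI)
    fix c d assume "h c = h d"
    then have e: "(c + b c) * \<sigma> c = (d + b d) * \<sigma> d" "(c + b' c) * \<sigma> c = (d + b' d) * \<sigma> d"
      "b c = b d" "b' c = b' d" by (auto simp: h_def)
    have "(b c - b' c) * \<sigma> c = (b c - b' c) * \<sigma> d"
      using arg_cong2[OF e(1) e(2), of minus] e by (simp add: algebra_simps)
    then have "\<sigma> c = \<sigma> d" using s(4)[of c] by simp
    then show "c = d" using e s(1)[of d] by auto
  qed
  moreover have "h ` UNIV \<subseteq> (A \<times> A) \<times> (B \<times> B)" using s by (auto simp: h_def)
  ultimately have le: "lepoll (UNIV :: 'a set) ((A \<times> A) \<times> (B \<times> B))"
    unfolding lepoll_def by blast
  have inf: "infinite A"
    using le infinite_field B(1) by (metis finite_SigmaI lepoll_iff finite_imageI finite_subset)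
  have sq: "A \<times> A \<approx> A"
    using card_of_Times_same_infinite[OF inf] by (simp add: eqpoll_iff_card_of_ordIso)
  have "lepoll (B \<times> B) A"
    by (rule finite_lepoll_infinite[OF inf]) (use B(1) in simp)
  with eqpoll_imp_lepoll[OF sq] have "lepoll ((A \<times> A) \<times> (B \<times> B)) (A \<times> A)"
    by (rule times_lepoll_mono)
  with le have "lepoll (UNIV :: 'a set) (A \<times> A)"
    by (rule lepoll_trans)
  then have "lepoll (UNIV :: 'a set) A"
    using sq by (rule lepoll_trans2)
  then show ?thesis
    unfolding A_def[symmetric] by (intro lepoll_antisym) (simp_all add: subset_imp_lepoll)
qed

end

section \<open>Multivariate polynomials and algebras generated by a set\<close>

lemma sum_fun_apply: "(\<Sum>i\<in>A. f i) x = (\<Sum>i\<in>A. f i x)" for f :: "'i \<Rightarrow> 'b \<Rightarrow> 'a::comm_monoid_add"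
  by (induction A rule: infinite_finite_induct) simp_all

lemma power_fun_apply: "(f ^ n) z = f z ^ n" for f :: "'z \<Rightarrow> 'a::field"
  by (induction n) simp_all

lemma prod_fun_apply: "(\<Prod>i\<in>A. f i) x = (\<Prod>i\<in>A. f i x)" for f :: "'i \<Rightarrow> 'b \<Rightarrow> 'a::comm_monoid_mult"
  by (induction A rule: infinite_finite_induct) simp_all

lemma poly_fun_apply: "poly f v z = (\<Sum>d\<le>degree f. coeff f d z * v z ^ d)"
  for f :: "('z \<Rightarrow> 'a::field) poly"
  by (simp add: poly_altdef sum_fun_apply power_fun_apply)

abbreviation mconst :: "'a::field \<Rightarrow> 'a mpoly" where
  "mconst \<equiv> Poly_Mapping.single 0"

abbreviation mvar :: "nat \<Rightarrow> 'a::field mpoly" where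
  "mvar i \<equiv> Poly_Mapping.single (Poly_Mapping.single i (Suc 0)) 1"

lemma mpoly_single_induct [case_names single add zero]:
  fixes p :: "'a::field mpoly"
  assumes single: "\<And>m c. m \<in> Poly_Mapping.keys p \<Longrightarrow> P (Poly_Mapping.single m c)"
    and add: "\<And>q r. P q \<Longrightarrow> P r \<Longrightarrow> P (q + r)" and zero: "P 0"
  shows "P p"
proof -
  have "P (\<Sum>m\<in>F. Poly_Mapping.single m (Poly_Mapping.lookup p m))"
    if "finite F" "F \<subseteq> Poly_Mapping.keys p" for F
    using that by (induction F rule: finite_induct) (auto intro: zero add single)
  moreover have "p = (\<Sum>m\<in>Poly_Mapping.keys p. Poly_Mapping.single m (Poly_Mapping.lookup p m))"
    by (rule poly_mapping_eqI)
      (auto simp: lookup_sum lookup_single when_def not_in_keys_iff_lookup_eq_zero)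
  ultimately show ?thesis by (metis finite_keys order_refl)
qed

lemma polys_const [simp]: "mconst c \<in> polys n"
  by (auto simp: polys_def)

lemma polys_var: "i < n \<Longrightarrow> mvar i \<in> polys n"
  by (auto simp: polys_def)

lemma polys_zero [simp]: "0 \<in> polys n" and polys_one [simp]: "1 \<in> polys n"
  by (auto simp: polys_def)

lemma polys_add: "p \<in> polys n \<Longrightarrow> q \<in> polys n \<Longrightarrow> p + q \<in> polys n"
  using Poly_Mapping.keys_add[of p q] by (fastforce simp: polys_def)

lemma polys_mult:
  fixes p q :: "'a::field mpoly"
  assumes "p \<in> polys n" "q \<in> polys n"
  shows "p * q \<in> polys n"
  unfolding polys_def
proof safe
  fix m i assume m: "m \<in> Poly_Mapping.keys (p * q)" and i: "i \<in> Poly_Mapping.keys m"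
  obtain a b where ab: "m = a + b" "a \<in> Poly_Mapping.keys p" "b \<in> Poly_Mapping.keys q"
    using keys_mult[of p q] m by blast
  then have "i \<in> Poly_Mapping.keys a \<or> i \<in> Poly_Mapping.keys b"
    using i Poly_Mapping.keys_add[of a b] by blast
  then show "i < n"
    using ab assms by (auto simp: polys_def)
qed

lemma polys_uminus: "p \<in> polys n \<Longrightarrow> - p \<in> polys n" for p :: "'a::field mpoly"
  by (auto simp: polys_def in_keys_iff)

lemma polys_diff: "p \<in> polys n \<Longrightarrow> q \<in> polys n \<Longrightarrow> p - q \<in> polys n" for p :: "'a::field mpoly"
  using polys_add[of p n "- q"] polys_uminus[of q n] by simp

lemma polys_power: "p \<in> polys n \<Longrightarrow> p ^ k \<in> polys n" for p :: "'a::field mpoly"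
  by (induction k) (auto intro: polys_mult)

lemma polys_sum: "(\<And>i. i \<in> A \<Longrightarrow> f i \<in> polys n) \<Longrightarrow> sum f A \<in> polys n" for f :: "'b \<Rightarrow> 'a::field mpoly"
  by (induction A rule: infinite_finite_induct) (auto intro: polys_add)

lemma polys_mono: "m \<le> n \<Longrightarrow> p \<in> polys m \<Longrightarrow> p \<in> polys n"
  by (fastforce simp: polys_def)

lemma polys_induct [consumes 1, case_names const var add mult]:
  fixes p :: "'a::field mpoly"
  assumes "p \<in> polys n"
    and const: "\<And>c. P (mconst c)"
    and var: "\<And>i. i < n \<Longrightarrow> P (mvar i)"
    and add: "\<And>q r. q \<in> polys n \<Longrightarrow> r \<in> polys n \<Longrightarrow> P q \<Longrightarrow> P r \<Longrightarrow> P (q + r)"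
    and mult: "\<And>q r. q \<in> polys n \<Longrightarrow> r \<in> polys n \<Longrightarrow> P q \<Longrightarrow> P r \<Longrightarrow> P (q * r)"
  shows "P p"
proof -
  have mono: "Poly_Mapping.keys m \<subseteq> {..<n} \<longrightarrow>
      P (Poly_Mapping.single m c) \<and> Poly_Mapping.single m c \<in> polys n" for m c
  proof (induction m rule: update_induct)
    case const
    then show ?case using assms(2) by auto
  next
    case (update m i k)
    show ?case
    proof
      assume *: "Poly_Mapping.keys (Poly_Mapping.update i k m) \<subseteq> {..<n}"
      then have i: "i < n" and m: "Poly_Mapping.keys m \<subseteq> {..<n}"
        using update by (auto simp: keys_update)
      have pow: "P (mvar i ^ j) \<and> (mvar i :: 'a mpoly) ^ j \<in> polys n" for j
      proof (induction j)
        case 0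
        then show ?case using const[of 1] by simp
      next
        case (Suc j)
        then show ?case
          using mult[of "mvar i" "mvar i ^ j"] var[OF i] polys_var[OF i, where 'a = 'a]
            polys_mult[of "mvar i :: 'a mpoly" n "mvar i ^ j"] by simp
      qed
      have pow_eq: "mvar i ^ j = Poly_Mapping.single (Poly_Mapping.single i j) (1::'a)" for j
        by (induction j) (simp_all add: mult_single single_add[symmetric])
      have "Poly_Mapping.update i k m = Poly_Mapping.single i k + m"
        using update(1) by (intro poly_mapping_eqI)
          (auto simp: lookup_update lookup_add lookup_single when_def not_in_keys_iff_lookup_eq_zero)
      then have "Poly_Mapping.single (Poly_Mapping.update i k m) c = mvar i ^ k * Poly_Mapping.single m c"
        by (simp add: pow_eq mult_single)
      then show "P (Poly_Mapping.single (Poly_Mapping.update i k m) c) \<and>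
          Poly_Mapping.single (Poly_Mapping.update i k m) c \<in> polys n"
        using mult[of "mvar i ^ k" "Poly_Mapping.single m c"] pow[of k] update(3) m
          polys_mult[of "mvar i ^ k :: 'a mpoly" n "Poly_Mapping.single m c"] by simp
    qed
  qed
  have "P p \<and> p \<in> polys n"
  proof (induction p rule: mpoly_single_induct[where P = "\<lambda>q. P q \<and> q \<in> polys n"])
    case (single m c)
    then show ?case using mono assms(1) by (simp add: polys_def)
  next
    case (add q r)
    then show ?case using assms(4) polys_add by blast
  next
    case zero
    then show ?case using const[of 0] by simp
  qed
  then show ?thesis by blast
qed

text \<open>A common frame for four kinds of evaluation: the identity gives \<open>peval\<close>,
  \<open>fps_const\<close> gives points over k[[t]], constant functions give points of the
  ultrapower before passing to the quotient, and \<open>mconst\<close> gives substitution of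
  polynomials. \<open>alg G\<close> is the k-subalgebra generated by \<open>G\<close>.\<close>

locale const_hom =
  fixes h :: "'a::field \<Rightarrow> 'b::comm_ring_1"
  assumes h_0 [simp]: "h 0 = 0" and h_1 [simp]: "h 1 = 1"
    and h_add: "h (a + b) = h a + h b" and h_mult: "h (a * b) = h a * h b"
begin

definition ev :: "(nat \<Rightarrow> 'b) \<Rightarrow> 'a mpoly \<Rightarrow> 'b" where
  "ev x p = (\<Sum>m \<in> Poly_Mapping.keys p. h (Poly_Mapping.lookup p m) *
      (\<Prod>i \<in> Poly_Mapping.keys m. x i ^ Poly_Mapping.lookup m i))"

lemma h_uminus: "h (- a) = - h a"
  using h_add[of a "- a"] by (simp add: eq_neg_iff_add_eq_0 add.commute)

lemma ev_single: "ev x (Poly_Mapping.single m c) =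
    h c * (\<Prod>i \<in> Poly_Mapping.keys m. x i ^ Poly_Mapping.lookup m i)"
  by (simp add: ev_def)

lemma ev_zero [simp]: "ev x 0 = 0"
  by (simp add: ev_def)

lemma ev_const [simp]: "ev x (mconst c) = h c"
  by (simp add: ev_single)

lemma ev_one [simp]: "ev x 1 = 1"
  using ev_const[of x 1] by simp

lemma ev_var [simp]: "ev x (mvar i) = x i"
  by (simp add: ev_single)

lemma ev_add: "ev x (p + q) = ev x p + ev x q"
  unfolding ev_def
  by (rule setsum_keys_plus_distrib) (auto simp: h_add algebra_simps)

lemma ev_mult_single: "ev x (Poly_Mapping.single m c * Poly_Mapping.single m' c') =
    ev x (Poly_Mapping.single m c) * ev x (Poly_Mapping.single m' c')"
proof -
  let ?S = "Poly_Mapping.keys m \<union> Poly_Mapping.keys m'"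
  have ext: "(\<Prod>i\<in>Poly_Mapping.keys u. x i ^ Poly_Mapping.lookup u i) = (\<Prod>i\<in>?S. x i ^ Poly_Mapping.lookup u i)"
    if "Poly_Mapping.keys u \<subseteq> ?S" for u
    using that by (intro prod.mono_neutral_left) (auto simp: not_in_keys_iff_lookup_eq_zero)
  have "ev x (Poly_Mapping.single m c * Poly_Mapping.single m' c') =
      h c * h c' * (\<Prod>i\<in>?S. x i ^ Poly_Mapping.lookup (m + m') i)"
    by (simp add: mult_single ev_single h_mult ext[OF Poly_Mapping.keys_add])
  also have "\<dots> = (h c * (\<Prod>i\<in>?S. x i ^ Poly_Mapping.lookup m i)) *
      (h c' * (\<Prod>i\<in>?S. x i ^ Poly_Mapping.lookup m' i))"
    by (simp add: lookup_add power_add prod.distrib mult_ac)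
  finally show ?thesis
    by (simp add: ev_single ext[of m] ext[of m'])
qed

lemma ev_mult: "ev x (p * q) = ev x p * ev x q"
proof (induction p rule: mpoly_single_induct)
  case (single m c)
  show ?case
  proof (induction q rule: mpoly_single_induct)
    case (single m' c')
    show ?case by (rule ev_mult_single)
  qed (simp_all add: ev_add distrib_left)
qed (simp_all add: ev_add distrib_right)

lemma ev_uminus: "ev x (- p) = - ev x p"
  using ev_add[of x p "- p"] by (simp add: eq_neg_iff_add_eq_0 add.commute)

lemma ev_diff: "ev x (p - q) = ev x p - ev x q"
  using ev_add[of x p "- q"] by (simp add: ev_uminus)

lemma ev_power: "ev x (p ^ n) = ev x p ^ n"
  by (induction n) (simp_all add: ev_mult)

lemma ev_sum: "ev x (sum f A) = (\<Sum>i\<in>A. ev x (f i))"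
  by (induction A rule: infinite_finite_induct) (simp_all add: ev_add)

lemma ev_prod: "ev x (prod f A) = (\<Prod>i\<in>A. ev x (f i))"
  by (induction A rule: infinite_finite_induct) (simp_all add: ev_mult)

lemma ev_of_nat: "ev x (of_nat n) = of_nat n"
  by (induction n) (simp_all add: ev_add)

lemma ev_cong: "p \<in> polys n \<Longrightarrow> (\<And>i. i < n \<Longrightarrow> x i = y i) \<Longrightarrow> ev x p = ev y p"
  by (induction rule: polys_induct) (simp_all add: ev_add ev_mult)

inductive_set alg :: "'b set \<Rightarrow> 'b set" for G where
  const: "h c \<in> alg G"
| gen: "g \<in> G \<Longrightarrow> g \<in> alg G"
| add: "u \<in> alg G \<Longrightarrow> v \<in> alg G \<Longrightarrow> u + v \<in> alg G"
| mult: "u \<in> alg G \<Longrightarrow> v \<in> alg G \<Longrightarrow> u * v \<in> alg G"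

lemma alg_0 [simp]: "0 \<in> alg G" and alg_1 [simp]: "1 \<in> alg G"
  using const[of 0] const[of 1] by simp_all

lemma alg_uminus: "u \<in> alg G \<Longrightarrow> - u \<in> alg G"
  using mult[OF const[of "-1" G], of u] by (simp add: h_uminus)

lemma alg_power: "u \<in> alg G \<Longrightarrow> u ^ n \<in> alg G"
  by (induction n) (auto intro: mult)

lemma alg_sum: "(\<And>i. i \<in> A \<Longrightarrow> f i \<in> alg G) \<Longrightarrow> sum f A \<in> alg G"
  by (induction A rule: infinite_finite_induct) (auto intro: add)

lemma alg_prod: "(\<And>i. i \<in> A \<Longrightarrow> f i \<in> alg G) \<Longrightarrow> prod f A \<in> alg G"
  by (induction A rule: infinite_finite_induct) (auto intro: mult)

lemma alg_mono': "u \<in> alg G \<Longrightarrow> G \<subseteq> alg G' \<Longrightarrow> u \<in> alg G'"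
  by (induction rule: alg.induct) (auto intro: const add mult)

lemma alg_mono: "G \<subseteq> G' \<Longrightarrow> alg G \<subseteq> alg G'"
  using alg_mono' gen by blast

lemma ev_in_alg: "p \<in> polys n \<Longrightarrow> (\<And>i. i < n \<Longrightarrow> x i \<in> alg G) \<Longrightarrow> ev x p \<in> alg G"
  by (induction rule: polys_induct) (auto simp: ev_add ev_mult intro: const add mult)

lemma alg_ev: "u \<in> alg (x ` {..<n}) \<Longrightarrow> \<exists>p\<in>polys n. u = ev x p"
proof (induction rule: alg.induct)
  case (const c)
  then show ?case by (intro bexI[of _ "mconst c"]) simp_all
next
  case (gen g)
  then obtain i where "i < n" "g = x i" by blast
  then show ?case by (intro bexI[of _ "mvar i"]) (simp_all add: polys_var)
next
  case (add u v)
  then obtain p q where "p \<in> polys n" "u = ev x p" "q \<in> polys n" "v = ev x q" by blast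
  then show ?case by (intro bexI[of _ "p + q"]) (simp_all add: polys_add ev_add)
next
  case (mult u v)
  then obtain p q where "p \<in> polys n" "u = ev x p" "q \<in> polys n" "v = ev x q" by blast
  then show ?case by (intro bexI[of _ "p * q"]) (simp_all add: polys_mult ev_mult)
qed

lemma alg_insert:
  assumes "u \<in> alg (insert v G)"
  shows "\<exists>f. (\<forall>i. coeff f i \<in> alg G) \<and> u = poly f v"
  using assms
proof (induction rule: alg.induct)
  case (const c)
  show ?case
    by (intro exI[of _ "[:h c:]"]) (auto simp: coeff_pCons split: nat.splits intro: alg.const)
next
  case (gen g)
  show ?case
  proof (cases "g = v")
    case True
    then show ?thesis
      by (intro exI[of _ "[:0, 1:]"]) (auto simp: coeff_pCons split: nat.splits)
  next
    case False
    then show ?thesis using gen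
      by (intro exI[of _ "[:g:]"]) (auto simp: coeff_pCons split: nat.splits intro: alg.gen)
  qed
next
  case (add a b)
  then obtain f g where "\<forall>i. coeff f i \<in> alg G" "a = poly f v" "\<forall>i. coeff g i \<in> alg G" "b = poly g v"
    by blast
  then show ?case by (intro exI[of _ "f + g"]) (auto intro: alg.add)
next
  case (mult a b)
  then obtain f g where "\<forall>i. coeff f i \<in> alg G" "a = poly f v" "\<forall>i. coeff g i \<in> alg G" "b = poly g v"
    by blast
  moreover from this have "coeff (f * g) i \<in> alg G" for i
    unfolding coeff_mult by (intro alg_sum alg.mult) simp_all
  ultimately show ?case by (intro exI[of _ "f * g"]) simp
qed

end

lemma const_hom_id: "const_hom (\<lambda>c::'a::field. c)"
  by (simp add: const_hom_def)

lemma ev_id: "const_hom.ev (\<lambda>c::'a::field. c) = peval"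
  by (rule ext, rule ext, subst const_hom.ev_def[OF const_hom_id], rule peval_def[symmetric])

lemmas peval_add = const_hom.ev_add[OF const_hom_id, unfolded ev_id]
  and peval_mult = const_hom.ev_mult[OF const_hom_id, unfolded ev_id]
  and peval_diff = const_hom.ev_diff[OF const_hom_id, unfolded ev_id]
  and peval_uminus = const_hom.ev_uminus[OF const_hom_id, unfolded ev_id]
  and peval_power = const_hom.ev_power[OF const_hom_id, unfolded ev_id]
  and peval_sum = const_hom.ev_sum[OF const_hom_id, unfolded ev_id]
  and peval_prod = const_hom.ev_prod[OF const_hom_id, unfolded ev_id]
  and peval_cong = const_hom.ev_cong[OF const_hom_id, unfolded ev_id]
  and peval_const [simp] = const_hom.ev_const[OF const_hom_id, unfolded ev_id]
  and peval_var [simp] = const_hom.ev_var[OF const_hom_id, unfolded ev_id]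
  and peval_zero [simp] = const_hom.ev_zero[OF const_hom_id, unfolded ev_id]
  and peval_one [simp] = const_hom.ev_one[OF const_hom_id, unfolded ev_id]

interpretation fps: const_hom "fps_const :: 'a::field \<Rightarrow> 'a fps"
  by unfold_locales (simp_all add: fps_const_add[symmetric] fps_const_mult[symmetric] del: fps_const_add fps_const_mult)

interpretation fn: const_hom "\<lambda>c (z::'z). c::'a::field"
  by unfold_locales (auto simp: fun_eq_iff zero_fun_def)

interpretation mp: const_hom "mconst :: 'a::field \<Rightarrow> 'a mpoly"
  by unfold_locales (auto simp: single_add mult_single)

text \<open>\<open>mp.alg_insert\<close> applied to the variables as generators gives k[x_0,...,x_n]
  = k[x_0,...,x_(n-1)][x_n]; this allows arcs to be built one coordinate at a time with univariate
  polynomials.\<close>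

lemma polys_Suc_poly:
  fixes p :: "'a::field mpoly"
  assumes "p \<in> polys (Suc n)"
  shows "\<exists>f. (\<forall>i. coeff f i \<in> polys n) \<and> p = poly f (mvar n)"
proof -
  have gen: "mp.alg (mvar ` {..<n}) \<subseteq> (polys n :: 'a mpoly set)"
  proof
    fix q :: "'a mpoly" assume "q \<in> mp.alg (mvar ` {..<n})"
    then show "q \<in> polys n"
      by (induction rule: mp.alg.induct) (auto intro: polys_var polys_add polys_mult)
  qed
  have "p \<in> mp.alg (insert (mvar n) (mvar ` {..<n}))"
    using assms
    by (induction rule: polys_induct) (auto intro: mp.alg.intros simp: less_Suc_eq)
  then show ?thesis
    using mp.alg_insert gen by blast
qed

lemma poly_mvar_in_polys:
  fixes f :: "'a::field mpoly poly"
  assumes "\<And>i. coeff f i \<in> polys n"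
  shows "poly f (mvar n) \<in> polys (Suc n)"
  using polys_mono[OF _ assms, of "Suc n"]
  by (auto simp: poly_altdef intro!: polys_sum polys_mult polys_power polys_var)

section \<open>Formal partial derivatives and the chain rule\<close>

lemma partial_deriv_single: "partial_deriv i (Poly_Mapping.single m c) =
    Poly_Mapping.single (m - Poly_Mapping.single i 1) (of_nat (Poly_Mapping.lookup m i) * c)"
  by (simp add: partial_deriv_def)

lemma partial_deriv_zero [simp]: "partial_deriv i 0 = 0"
  by (simp add: partial_deriv_def)

lemma partial_deriv_add: "partial_deriv i (p + q) = partial_deriv i p + partial_deriv i q"
  unfolding partial_deriv_def
  by (rule setsum_keys_plus_distrib) (auto simp: algebra_simps single_add)

lemma partial_deriv_mult_single:
  fixes c d :: "'a::field"
  shows "partial_deriv i (Poly_Mapping.single m c * Poly_Mapping.single m' d) =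
    partial_deriv i (Poly_Mapping.single m c) * Poly_Mapping.single m' d +
    Poly_Mapping.single m c * partial_deriv i (Poly_Mapping.single m' d)"
proof -
  have sub: "u - Poly_Mapping.single i 1 + v = u + v - Poly_Mapping.single i (1::nat)"
    if "Poly_Mapping.lookup u i \<noteq> 0" for u v
    using that by (intro poly_mapping_eqI) (auto simp: lookup_add lookup_minus lookup_single when_def)
  have 1: "partial_deriv i (Poly_Mapping.single m c) * Poly_Mapping.single m' d =
      Poly_Mapping.single (m + m' - Poly_Mapping.single i 1) (of_nat (Poly_Mapping.lookup m i) * (c * d))"
    using sub[of m m'] by (cases "Poly_Mapping.lookup m i = 0") (simp_all add: partial_deriv_single mult_single mult.assoc)
  have 2: "Poly_Mapping.single m c * partial_deriv i (Poly_Mapping.single m' d) =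
      Poly_Mapping.single (m + m' - Poly_Mapping.single i 1) (of_nat (Poly_Mapping.lookup m' i) * (c * d))"
    using sub[of m' m] by (cases "Poly_Mapping.lookup m' i = 0")
      (simp_all add: partial_deriv_single mult_single add.commute[of m] mult.left_commute[of c])
  show ?thesis
    unfolding 1 2 by (simp add: mult_single partial_deriv_single single_add[symmetric] lookup_add algebra_simps)
qed

lemma partial_deriv_mult:
  fixes p q :: "'a::field mpoly"
  shows "partial_deriv i (p * q) = partial_deriv i p * q + p * partial_deriv i q"
proof (induction p rule: mpoly_single_induct)
  case (single m c)
  show ?case
  proof (induction q rule: mpoly_single_induct)
    case (single m' c')
    show ?case by (rule partial_deriv_mult_single)
  qed (simp_all add: partial_deriv_add algebra_simps)
qed (simp_all add: partial_deriv_add algebra_simps)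

lemma partial_deriv_const [simp]: "partial_deriv i (mconst c) = 0"
  by (simp add: partial_deriv_single)

lemma partial_deriv_var: "partial_deriv i (mvar j) = (if i = j then 1 else 0)"
  by (auto simp: partial_deriv_single lookup_single when_def)

lemma partial_deriv_polys: "p \<in> polys n \<Longrightarrow> n \<le> i \<Longrightarrow> partial_deriv i p = 0"
  by (induction rule: polys_induct)
    (simp_all add: partial_deriv_add partial_deriv_mult partial_deriv_var)

text \<open>The chain rule for a derivation that kills constants. With \<open>fps_deriv\<close> for
  \<open>D\<close> it shows that the velocity of an arc is annihilated by the Jacobian.\<close>

lemma (in const_hom) derivation_ev:
  assumes D: "\<And>u v. D (u + v) = D u + D v" "\<And>u v. D (u * v) = D u * v + u * D v" "\<And>c. D (h c) = 0"
    and "p \<in> polys n"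
  shows "D (ev x p) = (\<Sum>j<n. ev x (partial_deriv j p) * D (x j))"
  using assms(4)
proof (induction rule: polys_induct)
  case (const c)
  then show ?case by (simp add: D)
next
  case (var i)
  then have "(\<Sum>j<n. ev x (partial_deriv j (mvar i)) * D (x j)) = (\<Sum>j<n. if j = i then D (x j) else 0)"
    by (intro sum.cong) (simp_all add: partial_deriv_var)
  then show ?case using var by simp
next
  case (add q r)
  then show ?case
    by (simp add: D ev_add partial_deriv_add distrib_right sum.distrib)
next
  case (mult q r)
  then show ?case
    by (simp add: D ev_mult ev_add partial_deriv_mult distrib_right sum.distrib sum_distrib_left sum_distrib_right mult_ac
        distrib_left)
qed

lemma partial_deriv_poly_mvar:
  fixes f :: "'a::field mpoly poly"
  assumes "\<And>i. coeff f i \<in> polys n"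
  shows "partial_deriv n (poly f (mvar n)) = poly (pderiv f) (mvar n)"
  using assms
proof (induction f)
  case 0
  then show ?case by simp
next
  case (pCons c f)
  have "coeff f i \<in> polys n" for i using pCons.prems[of "Suc i"] by simp
  then have "partial_deriv n (poly f (mvar n)) = poly (pderiv f) (mvar n)" using pCons.IH by blast
  moreover have "partial_deriv n c = 0" using pCons.prems[of 0] by (intro partial_deriv_polys) auto
  ultimately show ?case
    by (simp add: partial_deriv_add partial_deriv_mult partial_deriv_var pderiv_pCons)
qed

section \<open>Algebraic power series\<close>

lemma fps_X_power_dvd_iff: "fps_X ^ n dvd f \<longleftrightarrow> (\<forall>k<n. f $ k = 0)" for f :: "'a::field fps"
proof
  assume "\<forall>k<n. f $ k = 0"
  then have "f = fps_X ^ n * fps_shift n f"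
    by (intro fps_ext) (simp add: fps_X_power_mult_nth)
  then show "fps_X ^ n dvd f" by (metis dvd_triv_left)
qed (auto simp: fps_X_power_mult_nth elim!: dvdE)

lemma poly_fps_nth_0_cong:
  fixes f :: "'a::field fps poly"
  shows "y $ 0 = z $ 0 \<Longrightarrow> poly f y $ 0 = poly f z $ 0"
  by (induction f) simp_all

lemma poly_taylor2: "\<exists>r. poly f (y + h) = poly f y + h * poly (pderiv f) y + h ^ 2 * r"
  for f :: "'a::idom poly"
proof (induction f)
  case 0
  then show ?case by (intro exI[of _ 0]) simp
next
  case (pCons a f)
  then obtain r where r: "poly f (y + h) = poly f y + h * poly (pderiv f) y + h ^ 2 * r" by blast
  show ?case
    by (rule exI[of _ "poly (pderiv f) y + y * r + h * r"])
      (unfold poly_pCons pderiv_pCons poly_add poly_mult r, simp add: algebra_simps power2_eq_square)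
qed

text \<open>Newton approximation, one coefficient at a time: \<open>F n\<close> is a root modulo
  \<open>fps_X ^ Suc n\<close>, and the next approximation changes it only in degree
  \<open>Suc n\<close>.\<close>

lemma hensel_fps:
  fixes f :: "'a::field fps poly"
  assumes "poly f (fps_const y0) $ 0 = 0" "poly (pderiv f) (fps_const y0) $ 0 \<noteq> 0"
  shows "\<exists>y. y $ 0 = y0 \<and> poly f y = 0"
proof -
  define P where "P n y \<longleftrightarrow> y $ 0 = y0 \<and> fps_X ^ Suc n dvd poly f y" for n and y :: "'a fps"
  define Q where "Q n y z \<longleftrightarrow> (\<forall>k\<le>n. y $ k = z $ k)" for n and y z :: "'a fps"
  have "\<exists>F. \<forall>n. P n (F n) \<and> Q n (F n) (F (Suc n))"
  proof (rule dependent_nat_choice)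
    show "\<exists>y. P 0 y"
      unfolding P_def fps_X_power_dvd_iff by (rule exI[of _ "fps_const y0"]) (use assms in simp)
  next
    fix y n assume "P n y"
    then have y0: "y $ 0 = y0" and "fps_X ^ Suc n dvd poly f y" by (simp_all add: P_def)
    then obtain g where g: "poly f y = fps_X ^ Suc n * g" by blast
    have d: "poly (pderiv f) y $ 0 \<noteq> 0"
      using poly_fps_nth_0_cong[of y "fps_const y0" "pderiv f"] y0 assms(2) by simp
    \<comment> \<open>In \<open>poly f (y + h)\<close> the coefficient of degree
      \<open>Suc n\<close> is \<open>g $ 0\<close> plus \<open>c\<close> times the constant term of
      the derivative at \<open>y\<close>; this \<open>c\<close> cancels it, and the quadratic term
      only enters in higher degree.\<close>
    define c where "c = - g $ 0 / poly (pderiv f) y $ 0"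
    define h where "h = fps_X ^ Suc n * fps_const c"
    obtain r where r: "poly f (y + h) = poly f y + h * poly (pderiv f) y + h ^ 2 * r"
      using poly_taylor2 by blast
    have gen: "x * g + x * k * d + (x * k) ^ 2 * r = x * (g + k * d + x * k ^ 2 * r)"
      for x k d r :: "'a fps"
      by (simp add: algebra_simps power2_eq_square)
    have "poly f (y + h) = fps_X ^ Suc n * (g + fps_const c * poly (pderiv f) y
        + fps_X ^ Suc n * (fps_const c) ^ 2 * r)"
      unfolding r g unfolding h_def by (rule gen)
    moreover have "(g + fps_const c * poly (pderiv f) y + fps_X ^ Suc n * (fps_const c) ^ 2 * r) $ 0 = 0"
      using d by (simp add: c_def)
    then have "fps_X ^ 1 dvd g + fps_const c * poly (pderiv f) y + fps_X ^ Suc n * (fps_const c) ^ 2 * r"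
      unfolding fps_X_power_dvd_iff by simp
    ultimately have "fps_X ^ Suc n * fps_X ^ 1 dvd poly f (y + h)"
      by (simp add: mult_dvd_mono del: power_Suc)
    then have "fps_X ^ Suc (Suc n) dvd poly f (y + h)"
      by (simp add: mult_ac)
    then show "\<exists>z. P (Suc n) z \<and> Q n y z"
      by (intro exI[of _ "y + h"]) (auto simp: P_def Q_def h_def y0 fps_X_power_mult_nth simp del: power_Suc)
  qed
  then obtain F where F: "\<And>n. P n (F n)" "\<And>n. Q n (F n) (F (Suc n))" by blast
  \<comment> \<open>Coefficient \<open>k\<close> no longer changes after step \<open>k\<close>, so
    the diagonal agrees with \<open>F n\<close> up to degree \<open>n\<close>.\<close>
  define y where "y = Abs_fps (\<lambda>n. F n $ n)"
  have stable: "F (k + j) $ k = F k $ k" for k j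
  proof (induction j)
    case (Suc j)
    then show ?case using F(2)[of "k + j"] by (simp add: Q_def)
  qed simp
  have "poly f y $ n = 0" for n
  proof -
    have "F n $ k = y $ k" if "k \<le> n" for k
      using stable[of k "n - k"] that by (simp add: y_def)
    then have h: "fps_X ^ Suc n dvd y - F n"
      unfolding fps_X_power_dvd_iff by simp
    obtain r where "poly f (F n + (y - F n)) =
        poly f (F n) + (y - F n) * poly (pderiv f) (F n) + (y - F n) ^ 2 * r"
      using poly_taylor2 by blast
    then have "poly f y = poly f (F n) + (y - F n) * (poly (pderiv f) (F n) + (y - F n) * r)"
      by (simp add: algebra_simps power2_eq_square)
    then have "fps_X ^ Suc n dvd poly f y"
      using h F(1)[of n] by (simp add: P_def dvd_add dvd_mult2 del: power_Suc)
    then show ?thesis unfolding fps_X_power_dvd_iff by blast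
  qed
  then have "poly f y = 0" by (simp add: fps_eq_iff)
  moreover have "y $ 0 = y0" using F(1)[of 0] by (simp add: y_def P_def)
  ultimately show ?thesis by blast
qed

text \<open>A simple root even after setting t = 0: the derivative has to be a unit of k[[t]], not
  merely nonzero. This turns into a nonzero diagonal entry of the Jacobian at the constant
  terms.\<close>

definition etale :: "'a::field fps set \<Rightarrow> 'a fps \<Rightarrow> bool" where
  "etale G u \<longleftrightarrow> (\<exists>f. (\<forall>i. coeff f i \<in> fps.alg (insert fps_X G)) \<and> poly f u = 0 \<and>
     poly (pderiv f) u $ 0 \<noteq> 0)"

definition tower :: "'a::field fps list \<Rightarrow> bool" where
  "tower gs \<longleftrightarrow> (\<forall>i<length gs. etale (set (take i gs)) (gs ! i))"

lemma etale_mono: "etale G u \<Longrightarrow> G \<subseteq> G' \<Longrightarrow> etale G' u"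
  unfolding etale_def using fps.alg_mono[of "insert fps_X G" "insert fps_X G'"] by blast

lemma etale_base: "u \<in> fps.alg (insert fps_X G) \<Longrightarrow> etale G u"
  unfolding etale_def
  by (rule exI[of _ "[:- u, 1:]"])
    (auto simp: coeff_pCons pderiv_pCons split: nat.splits intro: fps.alg_uminus)

lemma tower_Nil [simp]: "tower []"
  by (simp add: tower_def)

text \<open>Every entry may use \<open>fps_X\<close>, and more predecessors do no harm to
  \<open>etale\<close>. This puts several arcs with the common parameter t into one tower, hence on
  one curve.\<close>

lemma tower_append:
  assumes "tower gs" "tower hs"
  shows "tower (gs @ hs)"
  unfolding tower_def
proof (intro allI impI)
  fix i assume i: "i < length (gs @ hs)"
  show "etale (set (take i (gs @ hs))) ((gs @ hs) ! i)"
  proof (cases "i < length gs")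
    case True
    then show ?thesis using assms(1) by (simp add: tower_def nth_append)
  next
    case False
    then have "etale (set (take (i - length gs) hs)) (hs ! (i - length gs))"
      using assms(2) i by (simp add: tower_def)
    then show ?thesis using False by (auto simp: nth_append intro: etale_mono)
  qed
qed

lemma tower_snoc: "tower (gs @ [g]) \<longleftrightarrow> tower gs \<and> etale (set gs) g"
  by (auto simp: tower_def nth_append less_Suc_eq)

lemma tower_concat: "(\<And>gs. gs \<in> set gss \<Longrightarrow> tower gs) \<Longrightarrow> tower (concat gss)"
  by (induction gss) (auto intro: tower_append)

section \<open>Growth of spaces of products, in place of transcendence degree\<close>

interpretation vs: vector_space "\<lambda>c x. fps_const c * x :: 'a::field fps"
  by unfold_locales (simp_all add: algebra_simps flip: fps_const_add fps_const_mult)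

lemma vs_span_mult:
  assumes "u \<in> vs.span A" "v \<in> vs.span B" "\<And>a b. a \<in> A \<Longrightarrow> b \<in> B \<Longrightarrow> a * b \<in> vs.span C"
  shows "u * v \<in> vs.span C"
  using assms(1)
proof (induction rule: vs.span_induct_alt)
  case base
  then show ?case by (simp add: vs.span_zero)
next
  case (step c a u)
  have "a * v \<in> vs.span C"
    using assms(2)
  proof (induction rule: vs.span_induct_alt)
    case base
    then show ?case by (simp add: vs.span_zero)
  next
    case (step d b v)
    then have "fps_const d * (a * b) + a * v \<in> vs.span C"
      using assms(3) \<open>a \<in> A\<close> by (intro vs.span_add vs.span_scale) auto
    then show ?case by (simp add: algebra_simps)
  qed
  then have "fps_const c * (a * v) + u * v \<in> vs.span C"
    using step by (intro vs.span_add vs.span_scale) auto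
  then show ?case by (simp add: algebra_simps)
qed

text \<open>The relation is among indices, so coinciding vectors have to be treated separately:
  there the coefficients 1 and -1 do.\<close>

lemma vs_nontrivial_relation:
  fixes b :: "'i \<Rightarrow> 'a::field fps"
  assumes "finite J" "finite T" "card T < card J" "\<And>j. j \<in> J \<Longrightarrow> b j \<in> vs.span T"
  shows "\<exists>a. (\<exists>j\<in>J. a j \<noteq> 0) \<and> (\<Sum>j\<in>J. fps_const (a j) * b j) = 0"
proof (cases "inj_on b J")
  case True
  then have "vs.dependent (b ` J)"
    using vs.independent_span_bound[OF assms(2), of "b ` J"] assms card_image[OF True] by auto
  then obtain a where "\<exists>v\<in>b ` J. a v \<noteq> 0" "(\<Sum>v\<in>b ` J. fps_const (a v) * v) = 0"
    using vs.dependent_finite[of "b ` J"] assms(1) by auto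
  then show ?thesis
    by (intro exI[of _ "a \<circ> b"]) (auto simp: sum.reindex[OF True])
next
  case False
  then obtain i j where ij: "i \<in> J" "j \<in> J" "i \<noteq> j" "b i = b j" by (auto simp: inj_on_def)
  have "(\<Sum>k\<in>J. fps_const (if k = i then 1 else if k = j then -1 else 0) * b k) =
     (\<Sum>k\<in>J. (if k = i then b i else 0) - (if k = j then b j else 0))"
    using ij by (intro sum.cong) (auto simp flip: fps_const_neg)
  also have "\<dots> = 0" using ij assms(1) by (simp add: sum_subtractf)
  finally show ?thesis
    using ij by (intro exI[of _ "\<lambda>k. if k = i then 1 else if k = j then -1 else 0"]) auto
qed

text \<open>Up to a common denominator, the products of \<open>m\<close> elements of \<open>S\<close> span a space of dimension
  \<open>O(m)\<close>; this bounds the transcendence degree of the algebra generated by \<open>S\<close> by one.\<close>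

definition linear_growth :: "'a::field fps set \<Rightarrow> bool" where
  "linear_growth S \<longleftrightarrow> (\<exists>c. \<forall>m. \<exists>T \<delta>. finite T \<and> card T \<le> c * (m + 1) \<and> \<delta> \<noteq> 0 \<and>
     (\<forall>xs. set xs \<subseteq> S \<and> length xs = m \<longrightarrow> \<delta> * prod_list xs \<in> vs.span T))"

text \<open>Elements of \<open>S\<close> are polynomials in t of some common degree bound d, and a
  product of m of them lies in the span of 1, t, ..., t^(m d).\<close>

lemma linear_growth_fps_X:
  fixes S :: "'a::field fps set"
  assumes "finite S" "S \<subseteq> fps.alg {fps_X}"
  shows "linear_growth S"
proof -
  have "\<exists>d. \<forall>k>d. u $ k = 0" if "u \<in> fps.alg {fps_X}" for u :: "'a fps"
    using that
  proof (induction rule: fps.alg.induct)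
    case (const c)
    then show ?case by auto
  next
    case (gen g)
    then show ?case by (intro exI[of _ 1]) auto
  next
    case (add u v)
    then obtain d e where "\<forall>k>d. u $ k = 0" "\<forall>k>e. v $ k = 0" by blast
    then show ?case by (intro exI[of _ "max d e"]) auto
  next
    case (mult u v)
    then obtain d e where de: "\<forall>k>d. u $ k = 0" "\<forall>k>e. v $ k = 0" by blast
    have "u $ i * v $ (k - i) = 0" if "k > d + e" "i \<le> k" for i k
      using de that by (cases "i > d") auto
    then show ?case by (intro exI[of _ "d + e"]) (auto simp: fps_mult_nth intro!: sum.neutral)
  qed
  then obtain dd where dd: "\<And>u k. u \<in> S \<Longrightarrow> k > dd u \<Longrightarrow> u $ k = 0"
    using assms(2) by (metis subsetD)
  define d where "d = (\<Sum>u\<in>S. dd u)"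
  have d: "u $ k = 0" if "u \<in> S" "k > d" for u k
    using dd[OF that(1)] that member_le_sum[of u S dd] assms(1) by (simp add: d_def)
  have prod: "prod_list xs $ k = 0" if "set xs \<subseteq> S" "k > length xs * d" for xs k
    using that
  proof (induction xs arbitrary: k)
    case Nil
    then show ?case by simp
  next
    case (Cons x xs)
    have "x $ i * prod_list xs $ (k - i) = 0" if "i \<le> k" for i
      using Cons d[of x i] that by (cases "i > d") auto
    then show ?case by (auto simp: fps_mult_nth intro!: sum.neutral)
  qed
  show ?thesis
    unfolding linear_growth_def
  proof (intro exI[of _ "d + 1"] allI)
    fix m
    let ?T = "(\<lambda>k. fps_X ^ k :: 'a fps) ` {..m * d}"
    have "card ?T \<le> m * d + 1" using card_image_le[of "{..m * d}" "\<lambda>k. fps_X ^ k :: 'a fps"] by simp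
    also have "\<dots> \<le> (d + 1) * (m + 1)" by (simp add: algebra_simps)
    finally have "card ?T \<le> (d + 1) * (m + 1)" .
    moreover have "1 * prod_list xs \<in> vs.span ?T" if "set xs \<subseteq> S" "length xs = m" for xs
    proof -
      have "prod_list xs = (\<Sum>k\<le>m * d. fps_const (prod_list xs $ k) * fps_X ^ k)"
        using prod[OF that(1)] that(2)
        by (intro fps_ext) (simp add: fps_sum_nth fps_X_power_nth sum.delta if_distrib not_le cong: if_cong)
      also have "\<dots> \<in> vs.span ?T"
        by (intro vs.span_sum vs.span_scale vs.span_base) auto
      finally show ?thesis by simp
    qed
    ultimately show "\<exists>T \<delta>. finite T \<and> card T \<le> (d + 1) * (m + 1) \<and> \<delta> \<noteq> 0 \<and>
        (\<forall>xs. set xs \<subseteq> S \<and> length xs = m \<longrightarrow> \<delta> * prod_list xs \<in> vs.span T)"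
      by (intro exI[of _ ?T] exI[of _ 1]) auto
  qed
qed

text \<open>With \<open>c\<close> the leading coefficient and \<open>D\<close> the degree of
  \<open>f\<close>, \<open>c ^ e * \<gamma> ^ e\<close> reduces to powers of \<open>\<gamma>\<close>
  below \<open>D\<close>, with coefficients spanned by products of \<open>e\<close> elements of a
  finite set \<open>S0\<close> in the smaller algebra. A product of \<open>m\<close> elements of
  \<open>S\<close> has degree at most \<open>m * E\<close> in \<open>\<gamma>\<close>, so the
  denominator \<open>c ^ (m * E)\<close> suffices. The dimension grows by the factor
  \<open>D\<close> and the length of products by the factor \<open>E + 1\<close>, which keeps the
  growth linear.\<close>

lemma linear_growth_algebraic:
  fixes f :: "'a::field fps poly"
  assumes IH: "\<And>S. finite S \<Longrightarrow> S \<subseteq> fps.alg G \<Longrightarrow> linear_growth S"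
    and f: "\<And>i. coeff f i \<in> fps.alg G" "f \<noteq> 0" "poly f \<gamma> = 0"
    and S: "finite S" "S \<subseteq> fps.alg (insert \<gamma> G)"
  shows "linear_growth S"
proof -
  define D where "D = degree f"
  define c where "c = lead_coeff f"
  have c0: "c \<noteq> 0" using f(2) by (simp add: c_def)
  have D1: "D > 0"
  proof (rule ccontr)
    assume "\<not> D > 0"
    then obtain a where "f = [:a:]" using degree_eq_zeroE[of f] by (auto simp: D_def)
    then show False using f by simp
  qed
  have "\<forall>s\<in>S. \<exists>g. (\<forall>i. coeff g i \<in> fps.alg G) \<and> s = poly g \<gamma>"
    using fps.alg_insert S(2) by blast
  from bchoice[OF this] obtain g where
    "\<forall>s\<in>S. (\<forall>i. coeff (g s) i \<in> fps.alg G) \<and> s = poly (g s) \<gamma>" ..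
  then have g: "\<And>s i. s \<in> S \<Longrightarrow> coeff (g s) i \<in> fps.alg G" "\<And>s. s \<in> S \<Longrightarrow> s = poly (g s) \<gamma>"
    by blast+
  define E where "E = (\<Sum>s\<in>S. degree (g s))"
  have E: "degree (g s) \<le> E" if "s \<in> S" for s
    unfolding E_def using member_le_sum[of s S "\<lambda>s. degree (g s)"] S(1) that by simp
  \<comment> \<open>Having \<open>1\<close> in \<open>S0\<close> allows shorter products to be
    padded to an exact length.\<close>
  define S0 where "S0 = {1} \<union> (\<lambda>(s, i). coeff (g s) i) ` (S \<times> {..E}) \<union> coeff f ` {..D}"
  have S0: "finite S0" "S0 \<subseteq> fps.alg G" using S(1) f(1) g(1) by (auto simp: S0_def)
  obtain C where C: "\<And>m. \<exists>T \<delta>. finite T \<and> card T \<le> C * (m + 1) \<and> \<delta> \<noteq> 0 \<and>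
     (\<forall>xs. set xs \<subseteq> S0 \<and> length xs = m \<longrightarrow> \<delta> * prod_list xs \<in> vs.span T)"
    using IH[OF S0] unfolding linear_growth_def by blast
  define B where "B m = {prod_list xs | xs. set xs \<subseteq> S0 \<and> length xs = m}" for m
  define W where "W m = vs.span (B m)" for m
  have B_mult: "a * b \<in> B (m + n)" if ab: "a \<in> B m" "b \<in> B n" for a b m n
  proof -
    obtain xs ys where "a = prod_list xs" "set xs \<subseteq> S0" "length xs = m"
      "b = prod_list ys" "set ys \<subseteq> S0" "length ys = n"
      using ab unfolding B_def by blast
    then show ?thesis unfolding B_def by (auto intro!: exI[of _ "xs @ ys"])
  qed
  have W_mult: "u * v \<in> W (m + n)" if "u \<in> W m" "v \<in> W n" for u v m n
    using that unfolding W_def by (rule vs_span_mult) (auto intro: vs.span_base B_mult)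
  have W_add: "u + v \<in> W m" if "u \<in> W m" "v \<in> W m" for u v m
    using that unfolding W_def by (rule vs.span_add)
  have W_diff: "u - v \<in> W m" if "u \<in> W m" "v \<in> W m" for u v m
    using that unfolding W_def by (rule vs.span_diff)
  have W_sum: "sum u A \<in> W m" if "\<And>i. i \<in> A \<Longrightarrow> u i \<in> W m" for u and A :: "nat set" and m
    using that unfolding W_def by (rule vs.span_sum)
  have W_0: "0 \<in> W m" for m unfolding W_def by (rule vs.span_zero)
  have W_S0: "s \<in> W 1" if "s \<in> S0" for s
    unfolding W_def B_def using that by (intro vs.span_base) (auto intro!: exI[of _ "[s]"])
  have W_1: "1 \<in> W m" for m
    unfolding W_def B_def
    by (intro vs.span_base) (auto simp: S0_def intro!: exI[of _ "replicate m 1"])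
  have W_f: "coeff f i \<in> W 1" for i
  proof (cases "i \<le> D")
    case True
    then show ?thesis by (intro W_S0) (auto simp: S0_def)
  qed (simp add: D_def coeff_eq_0 W_0)
  have W_g: "coeff (g s) i \<in> W 1" if "s \<in> S" for s i
  proof (cases "i \<le> E")
    case True
    then show ?thesis using that by (intro W_S0) (force simp: S0_def)
  qed (use E[OF that] in \<open>simp add: coeff_eq_0 W_0\<close>)
  have W_c: "c \<in> W 1" using W_f by (simp add: c_def)
  have W_c_pow: "c ^ n \<in> W n" for n
    by (induction n) (use W_1 W_mult[OF W_c] in auto)
  have lead: "c * \<gamma> ^ D = - (\<Sum>d<D. coeff f d * \<gamma> ^ d)"
    using f(3) unfolding poly_altdef D_def[symmetric] lessThan_Suc_atMost[symmetric]
    by (simp add: c_def D_def eq_neg_iff_add_eq_0 add.commute)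
  have reduce: "\<exists>w. (\<forall>d. w d \<in> W e) \<and> c ^ e * \<gamma> ^ e = (\<Sum>d<D. w d * \<gamma> ^ d)" for e
  proof (induction e)
    case 0
    have "(\<Sum>d<D. (if d = 0 then 1 else 0) * \<gamma> ^ d) = (\<Sum>d<D. if d = 0 then 1 else 0)"
      by (intro sum.cong) auto
    then have "(\<Sum>d<D. (if d = 0 then 1 else 0) * \<gamma> ^ d) = 1"
      using D1 by simp
    then show ?case
      using W_0 W_1 by (intro exI[of _ "\<lambda>d. if d = 0 then 1 else 0"]) auto
  next
    case (Suc e)
    then obtain w where w: "\<And>d. w d \<in> W e" "c ^ e * \<gamma> ^ e = (\<Sum>d<D. w d * \<gamma> ^ d)" by blast
    obtain D' where D': "D = Suc D'" using D1 gr0_implies_Suc by blast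
    define w' where "w' d = (case d of 0 \<Rightarrow> 0 | Suc d \<Rightarrow> c * w d) - w D' * coeff f d" for d
    have "w' d \<in> W (Suc e)" for d
      unfolding w'_def using W_mult[OF w(1) W_f, of D' d] W_mult[OF W_c w(1)]
      by (intro W_diff) (auto split: nat.splits simp: W_0)
    moreover have "c ^ Suc e * \<gamma> ^ Suc e = (\<Sum>d<D. w' d * \<gamma> ^ d)"
    proof -
      have "c ^ Suc e * \<gamma> ^ Suc e = c * \<gamma> * (\<Sum>d<D. w d * \<gamma> ^ d)"
        unfolding w(2)[symmetric] by (simp add: algebra_simps)
      also have "\<dots> = (\<Sum>d<D'. c * w d * \<gamma> ^ Suc d) + w D' * (c * \<gamma> ^ D)"
        by (simp add: D' sum_distrib_left algebra_simps)
      also have "(\<Sum>d<D'. c * w d * \<gamma> ^ Suc d) = (\<Sum>d<D. (case d of 0 \<Rightarrow> 0 | Suc d \<Rightarrow> c * w d) * \<gamma> ^ d)"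
        unfolding D' by (subst sum.lessThan_Suc_shift) simp
      also have "\<dots> + w D' * (c * \<gamma> ^ D) = (\<Sum>d<D. w' d * \<gamma> ^ d)"
        unfolding lead w'_def by (simp add: left_diff_distrib sum_subtractf sum_distrib_left mult.assoc)
      finally show ?thesis .
    qed
    ultimately show ?case by blast
  qed
  have expand: "\<exists>h. (\<forall>i. coeff h i \<in> W (length xs)) \<and> degree h \<le> length xs * E \<and> prod_list xs = poly h \<gamma>"
    if "set xs \<subseteq> S" for xs
    using that
  proof (induction xs)
    case Nil
    then show ?case using W_0 W_1 by (intro exI[of _ 1]) (auto simp: coeff_1)
  next
    case (Cons x xs)
    then obtain h where h: "\<And>i. coeff h i \<in> W (length xs)" "degree h \<le> length xs * E"
      "prod_list xs = poly h \<gamma>" by auto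
    have x: "x \<in> S" using Cons by simp
    have "coeff (g x * h) i \<in> W (1 + length xs)" for i
      unfolding coeff_mult by (intro W_sum W_mult W_g x h)
    moreover have "degree (g x * h) \<le> E + length xs * E"
      using degree_mult_le[of "g x" h] h(2) E[OF x] by linarith
    moreover have "x * prod_list xs = poly (g x * h) \<gamma>"
      using g(2)[OF x] h(3) by simp
    ultimately show ?case by (intro exI[of _ "g x * h"]) auto
  qed
  show ?thesis
    unfolding linear_growth_def
  proof (intro exI[of _ "D * C * (E + 1)"] allI)
    fix m
    \<comment> \<open>\<open>m\<close> factors come from a coefficient of the expanded product and
      \<open>m * E\<close> from the powers of \<open>c\<close> together with the reduction of
      \<open>\<gamma> ^ e\<close>.\<close>
    define M where "M = m + m * E"
    obtain T \<delta> where T: "finite T" "card T \<le> C * (M + 1)" "\<delta> \<noteq> 0"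
      "\<And>xs. set xs \<subseteq> S0 \<Longrightarrow> length xs = M \<Longrightarrow> \<delta> * prod_list xs \<in> vs.span T"
      using C[of M] by blast
    have \<delta>W: "\<delta> * w \<in> vs.span T" if "w \<in> W M" for w
      by (rule vs_span_mult[of \<delta> "{\<delta>}" w "B M"])
        (use that T(4) in \<open>auto simp: W_def B_def intro: vs.span_base\<close>)
    define T' where "T' = (\<lambda>(\<tau>, d). \<tau> * \<gamma> ^ d) ` (T \<times> {..<D})"
    have "card T' \<le> card T * D"
      unfolding T'_def using card_image_le[of "T \<times> {..<D}"] T(1) by (simp add: card_cartesian_product)
    also have "\<dots> \<le> (C * (M + 1)) * D" using T(2) by simp
    also have "\<dots> \<le> (C * ((E + 1) * (m + 1))) * D"
      by (intro mult_le_mono order_refl) (simp add: M_def algebra_simps)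
    finally have card: "card T' \<le> D * C * (E + 1) * (m + 1)"
      by (simp only: mult_ac)
    have "\<delta> * c ^ (m * E) * prod_list xs \<in> vs.span T'" if xs: "set xs \<subseteq> S" "length xs = m" for xs
    proof -
      obtain h where h: "\<And>i. coeff h i \<in> W m" "degree h \<le> m * E" "prod_list xs = poly h \<gamma>"
        using expand[OF xs(1)] xs(2) by auto
      have summand: "\<delta> * c ^ (m * E) * (coeff h e * \<gamma> ^ e) \<in> vs.span T'" if e: "e \<le> degree h" for e
      proof -
        obtain w where w: "\<And>d. w d \<in> W e" "c ^ e * \<gamma> ^ e = (\<Sum>d<D. w d * \<gamma> ^ d)"
          using reduce by blast
        have e': "e \<le> m * E" using e h(2) by linarith
        have "c ^ (m * E) = c ^ (m * E - e) * c ^ e" using e' by (simp flip: power_add)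
        then have "\<delta> * c ^ (m * E) * (coeff h e * \<gamma> ^ e) = \<delta> * (coeff h e * c ^ (m * E - e)) * (c ^ e * \<gamma> ^ e)"
          by (simp only: mult_ac)
        also have "\<dots> = (\<Sum>d<D. (\<delta> * (coeff h e * c ^ (m * E - e) * w d)) * \<gamma> ^ d)"
          unfolding w(2) by (simp only: sum_distrib_left mult_ac)
        also have "\<dots> \<in> vs.span T'"
        proof (rule vs.span_sum)
          fix d assume d: "d \<in> {..<D}"
          have "coeff h e * c ^ (m * E - e) * w d \<in> W (m + (m * E - e) + e)"
            by (intro W_mult h W_c_pow w)
          then have "\<delta> * (coeff h e * c ^ (m * E - e) * w d) \<in> vs.span T"
            using e' by (intro \<delta>W) (simp add: M_def)
          then show "(\<delta> * (coeff h e * c ^ (m * E - e) * w d)) * \<gamma> ^ d \<in> vs.span T'"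
            by (rule vs_span_mult[where B = "{\<gamma> ^ d}"]) (use d in \<open>auto simp: T'_def intro!: vs.span_base\<close>)
        qed
        finally show ?thesis .
      qed
      have "\<delta> * c ^ (m * E) * prod_list xs = (\<Sum>e\<le>degree h. \<delta> * c ^ (m * E) * (coeff h e * \<gamma> ^ e))"
        unfolding h(3) poly_altdef by (simp only: sum_distrib_left)
      also have "\<dots> \<in> vs.span T'"
        by (intro vs.span_sum summand) simp
      finally show ?thesis .
    qed
    moreover have "finite T'" using T(1) by (simp add: T'_def)
    ultimately show "\<exists>T \<delta>. finite T \<and> card T \<le> D * C * (E + 1) * (m + 1) \<and> \<delta> \<noteq> 0 \<and>
        (\<forall>xs. set xs \<subseteq> S \<and> length xs = m \<longrightarrow> \<delta> * prod_list xs \<in> vs.span T)"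
      using card T(3) c0 by (intro exI[of _ T'] exI[of _ "\<delta> * c ^ (m * E)"]) auto
  qed
qed

lemma tower_linear_growth:
  assumes "tower gs" "finite S" "S \<subseteq> fps.alg (insert fps_X (set gs))"
  shows "linear_growth S"
  using assms
proof (induction gs arbitrary: S rule: rev_induct)
  case Nil
  then show ?case by (simp add: linear_growth_fps_X)
next
  case (snoc g gs)
  then obtain f where f: "\<And>i. coeff f i \<in> fps.alg (insert fps_X (set gs))" "poly f g = 0"
      "poly (pderiv f) g $ 0 \<noteq> 0"
    by (auto simp: tower_snoc etale_def)
  show ?case
  proof (rule linear_growth_algebraic[of "insert fps_X (set gs)" f g])
    show "S \<subseteq> fps.alg (insert g (insert fps_X (set gs)))"
      using snoc.prems(3) by (simp add: insert_commute)
  qed (use f snoc in \<open>auto simp: tower_snoc\<close>)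
qed

text \<open>Quadratically many monomials \<open>u ^ i * v ^ j\<close> in a space of linearly growing
  dimension satisfy a relation, a sum of terms \<open>u ^ i\<close> times a polynomial
  \<open>p i\<close> in \<open>v\<close>. Cancelling the lowest power of \<open>u\<close> leaves the
  first nonzero \<open>p i\<close> in \<open>v\<close> as a multiple of \<open>u\<close>: modulo
  \<open>u\<close>, \<open>v\<close> is algebraic over k.\<close>

lemma linear_growth_relation:
  fixes u v :: "'a::field fps"
  assumes "linear_growth {1, u, v}" "u \<noteq> 0"
  shows "\<exists>f w. f \<noteq> 0 \<and> w \<in> fps.alg {u, v} \<and> poly (map_poly fps_const f) v = u * w"
proof -
  obtain c where c: "\<And>m. \<exists>T \<delta>. finite T \<and> card T \<le> c * (m + 1) \<and> \<delta> \<noteq> 0 \<and>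
     (\<forall>xs. set xs \<subseteq> {1, u, v} \<and> length xs = m \<longrightarrow> \<delta> * prod_list xs \<in> vs.span T)"
    using assms(1) unfolding linear_growth_def by blast
  \<comment> \<open>With m = 2c the number (m + 1)^2 of monomials exceeds the bound c (2m + 1) for
    products of length 2m.\<close>
  define m where "m = 2 * c"
  obtain T \<delta> where T: "finite T" "card T \<le> c * (2 * m + 1)" "\<delta> \<noteq> 0"
     "\<And>xs. set xs \<subseteq> {1, u, v} \<Longrightarrow> length xs = 2 * m \<Longrightarrow> \<delta> * prod_list xs \<in> vs.span T"
    using c[of "2 * m"] by blast
  let ?J = "{..m} \<times> {..m}"
  have "c * (2 * m + 1) < (m + 1) * (m + 1)" by (simp add: m_def algebra_simps)
  then have card: "card T < card ?J" using T(2) by (simp add: card_cartesian_product)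
  have "\<delta> * (u ^ i * v ^ j) \<in> vs.span T" if "i \<le> m" "j \<le> m" for i j
    using T(4)[of "replicate i u @ replicate j v @ replicate (2 * m - i - j) 1"] that by (auto simp: set_replicate_conv_if)
  then have "\<exists>a. (\<exists>j\<in>?J. a j \<noteq> 0) \<and> (\<Sum>j\<in>?J. fps_const (a j) * (case j of (i, j) \<Rightarrow> \<delta> * (u ^ i * v ^ j))) = 0"
    by (intro vs_nontrivial_relation[OF _ T(1) card]) auto
  then obtain a where a: "\<exists>j\<in>?J. a j \<noteq> 0"
      "(\<Sum>j\<in>?J. fps_const (a j) * (case j of (i, j) \<Rightarrow> \<delta> * (u ^ i * v ^ j))) = 0" by blast
  have "\<delta> * (\<Sum>(i, j)\<in>?J. fps_const (a (i, j)) * (u ^ i * v ^ j)) = 0"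
    unfolding a(2)[symmetric] sum_distrib_left by (intro sum.cong) (auto simp: mult_ac)
  then have rel: "(\<Sum>i\<le>m. \<Sum>j\<le>m. fps_const (a (i, j)) * (u ^ i * v ^ j)) = 0"
    using T(3) by (simp add: sum.cartesian_product)
  define p where "p i = (\<Sum>j\<le>m. monom (a (i, j)) j)" for i
  have coeff_p: "coeff (p i) j = (if j \<le> m then a (i, j) else 0)" for i j
    by (simp add: p_def coeff_sum)
  have ev_p: "poly (map_poly fps_const (p i)) v = (\<Sum>j\<le>m. fps_const (a (i, j)) * v ^ j)" for i
  proof -
    have "map_poly fps_const (p i) = (\<Sum>j\<le>m. monom (fps_const (a (i, j))) j)"
      by (intro poly_eqI) (simp add: coeff_map_poly coeff_p coeff_sum)
    then show ?thesis by (simp add: poly_sum poly_monom)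
  qed
  have rel': "(\<Sum>i\<le>m. u ^ i * poly (map_poly fps_const (p i)) v) = 0"
    unfolding ev_p rel[symmetric] by (simp add: sum_distrib_left mult_ac)
  obtain i' j' where "i' \<le> m" "j' \<le> m" "a (i', j') \<noteq> 0" using a(1) by auto
  then have ex: "i' \<le> m \<and> p i' \<noteq> 0" using coeff_p[of i' j'] by auto
  define i0 where "i0 = (LEAST i. i \<le> m \<and> p i \<noteq> 0)"
  have i0: "i0 \<le> m" "p i0 \<noteq> 0"
    using LeastI[of "\<lambda>i. i \<le> m \<and> p i \<noteq> 0", OF ex] by (auto simp: i0_def)
  have before: "p i = 0" if "i < i0" for i
    using not_less_Least[of i "\<lambda>i. i \<le> m \<and> p i \<noteq> 0"] that i0(1) by (auto simp: i0_def)
  define q where "q = (\<lambda>i. poly (map_poly fps_const (p i)) v)"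
  define w where "w = - (\<Sum>i\<in>{i0<..m}. u ^ (i - Suc i0) * q i)"
  have split: "{..m} = {..<i0} \<union> ({i0} \<union> {i0<..m})" using i0(1) by auto
  have "0 = (\<Sum>i\<in>{..<i0}. u ^ i * q i) + (u ^ i0 * q i0 + (\<Sum>i\<in>{i0<..m}. u ^ i * q i))"
    unfolding rel'[symmetric] q_def[symmetric] split
    by (subst sum.union_disjoint) (auto simp: q_def)
  also have "(\<Sum>i\<in>{..<i0}. u ^ i * q i) = 0" by (simp add: q_def before)
  also have "(\<Sum>i\<in>{i0<..m}. u ^ i * q i) = u ^ i0 * (u * - w)"
    unfolding w_def minus_minus sum_distrib_left
  proof (rule sum.cong)
    fix i assume "i \<in> {i0<..m}"
    then have "i = i0 + Suc (i - Suc i0)" by auto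
    then have "u ^ i = u ^ i0 * (u * u ^ (i - Suc i0))" by (metis power_add power_Suc)
    then show "u ^ i * q i = u ^ i0 * (u * (u ^ (i - Suc i0) * q i))" by (simp add: mult_ac)
  qed simp
  finally have "u ^ i0 * (q i0 - u * w) = 0" by (simp add: right_diff_distrib)
  then have "q i0 = u * w" using assms(2) by simp
  moreover have q_alg: "q i \<in> fps.alg {u, v}" for i
    unfolding q_def ev_p by (intro fps.alg_sum fps.alg.mult fps.alg_power fps.alg.const fps.alg.gen) simp_all
  then have "w \<in> fps.alg {u, v}"
    unfolding w_def by (intro fps.alg_uminus fps.alg_sum fps.alg.mult fps.alg_power) (auto intro: fps.alg.gen)
  ultimately show ?thesis using i0(2) by (auto simp: q_def)
qed

section \<open>Large fields and algebraic power series\<close>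

lemma mpoly_ring_simps [simp]:
  "carrier (mpoly_ring n) = polys n" "p \<oplus>\<^bsub>mpoly_ring n\<^esub> q = p + q" "p \<otimes>\<^bsub>mpoly_ring n\<^esub> q = p * q"
  "\<zero>\<^bsub>mpoly_ring n\<^esub> = 0" "\<one>\<^bsub>mpoly_ring n\<^esub> = 1"
  by (simp_all add: mpoly_ring_def ring_of_type_algebra_def)

lemma cring_mpoly_ring: "cring (mpoly_ring n :: 'a::field mpoly ring)"
proof (rule cringI)
  show "abelian_group (mpoly_ring n :: 'a mpoly ring)"
  proof (rule abelian_groupI)
    fix p :: "'a mpoly" assume "p \<in> carrier (mpoly_ring n)"
    then show "\<exists>q\<in>carrier (mpoly_ring n). q \<oplus>\<^bsub>mpoly_ring n\<^esub> p = \<zero>\<^bsub>mpoly_ring n\<^esub>"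
      by (intro bexI[of _ "- p"]) (auto intro: polys_uminus)
  qed (auto intro: polys_add simp: algebra_simps)
  show "Group.comm_monoid (mpoly_ring n :: 'a mpoly ring)"
    by (rule comm_monoidI) (auto intro: polys_mult simp: algebra_simps)
qed (simp add: algebra_simps)

lemma partial_deriv_in_polys: "p \<in> polys n \<Longrightarrow> partial_deriv i p \<in> polys n"
  by (induction rule: polys_induct)
    (auto simp: partial_deriv_add partial_deriv_mult partial_deriv_var intro: polys_add polys_mult)

lemma fps_ev_nth_0: "p \<in> polys n \<Longrightarrow> fps.ev x p $ 0 = peval (\<lambda>i. x i $ 0) p"
  by (induction rule: polys_induct) (simp_all add: fps.ev_add fps.ev_mult peval_add peval_mult)

lemma fps_ev_map_poly: "fps.ev x (poly (map_poly mconst f) p) = poly (map_poly fps_const f) (fps.ev x p)"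
  by (induction f) (simp_all add: map_poly_pCons fps.ev_add fps.ev_mult)

lemma peval_map_poly: "peval x (poly (map_poly mconst f) p) = poly f (peval x p)"
  by (induction f) (simp_all add: map_poly_pCons peval_add peval_mult)

lemma poly_map_in_polys: "p \<in> polys n \<Longrightarrow> poly (map_poly mconst f) p \<in> polys n"
  by (induction f) (auto simp: map_poly_pCons intro: polys_add polys_mult)

lemma polys_of_nat: "of_nat k \<in> (polys n :: 'a::field mpoly set)"
  by (induction k) (auto intro: polys_add)

lemma map_poly_fps_ev:
  fixes f :: "'a::field mpoly poly"
  shows "poly (map_poly (fps.ev y) f) (y n) = fps.ev y (poly f (mvar n))"
  by (induction f) (simp_all add: map_poly_pCons fps.ev_add fps.ev_mult)

lemma pderiv_map_poly_fps_ev: "pderiv (map_poly (fps.ev y) f) = map_poly (fps.ev y) (pderiv f)"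
  for f :: "'a::field mpoly poly"
  by (rule poly_eqI) (simp add: coeff_pderiv coeff_map_poly fps.ev_mult fps.ev_add fps.ev_of_nat)

interpretation fv: vector_space "\<lambda>c v i. c * v i :: 'a::field"
  by unfold_locales (simp_all add: fun_eq_iff algebra_simps)

text \<open>The curve of a tower: \<open>\<gamma>\<close> = (t, gs) is its generic point,
  \<open>P\<close> the ideal of relations of \<open>\<gamma>\<close>, so the coordinate ring is the
  algebra generated by t and the series; \<open>x0\<close> is the point at t = 0.\<close>

locale fps_tower =
  fixes gs :: "'a::field fps list"
  assumes tower: "tower gs"
begin

definition n :: nat where "n = Suc (length gs)"

definition \<gamma> :: "nat \<Rightarrow> 'a fps" where "\<gamma> i = (fps_X # gs) ! i"

abbreviation R :: "'a mpoly ring" where "R \<equiv> mpoly_ring n"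

definition P :: "'a mpoly set" where "P = {p \<in> polys n. fps.ev \<gamma> p = 0}"

definition x0 :: "nat \<Rightarrow> 'a" where "x0 i = \<gamma> i $ 0"

lemma \<gamma>_image_i: "i \<le> length gs \<Longrightarrow> \<gamma> ` {..<Suc i} = insert fps_X (set (take i gs))"
  using nth_image[of "Suc i" "fps_X # gs"] by (simp add: \<gamma>_def[abs_def] atLeast0LessThan)

lemma \<gamma>_image: "\<gamma> ` {..<n} = insert fps_X (set gs)"
  using \<gamma>_image_i[of "length gs"] by (simp add: n_def)

lemma \<gamma>_0: "\<gamma> 0 = fps_X"
  by (simp add: \<gamma>_def)

lemma ev_\<gamma>_in: "p \<in> polys n \<Longrightarrow> fps.ev \<gamma> p \<in> fps.alg (insert fps_X (set gs))"
  unfolding \<gamma>_image[symmetric] by (rule fps.ev_in_alg) (auto intro: fps.alg.gen)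

lemma ev_x0: "p \<in> polys n \<Longrightarrow> peval x0 p = fps.ev \<gamma> p $ 0"
  unfolding x0_def by (simp add: fps_ev_nth_0)

text \<open>\<open>linear_growth_relation\<close> read in the coordinate ring: modulo a nonzero
  function \<open>g\<close>, every \<open>h\<close> is algebraic over k. Both the bound on the Krull
  dimension and the finiteness of zero sets come from this.\<close>

lemma algebraic_mod:
  assumes "g \<in> polys n" "fps.ev \<gamma> g \<noteq> 0" "h \<in> polys n"
  shows "\<exists>f q. f \<noteq> 0 \<and> q \<in> polys n \<and> poly (map_poly mconst f) h - q * g \<in> P"
proof -
  let ?A = "fps.alg (insert fps_X (set gs))"
  have sub: "{1, fps.ev \<gamma> g, fps.ev \<gamma> h} \<subseteq> ?A"
    using ev_\<gamma>_in assms by simp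
  have "linear_growth {1, fps.ev \<gamma> g, fps.ev \<gamma> h}"
    by (rule tower_linear_growth[OF tower _ sub]) simp
  from linear_growth_relation[OF this assms(2)]
  obtain f w where f: "f \<noteq> 0" "w \<in> fps.alg {fps.ev \<gamma> g, fps.ev \<gamma> h}"
    "poly (map_poly fps_const f) (fps.ev \<gamma> h) = fps.ev \<gamma> g * w" by blast
  have "w \<in> ?A" using fps.alg_mono'[OF f(2)] sub by simp
  then obtain q where q: "q \<in> polys n" "w = fps.ev \<gamma> q"
    using fps.alg_ev[of w \<gamma> n] unfolding \<gamma>_image by blast
  then have "poly (map_poly mconst f) h - q * g \<in> P"
    using f(3) assms by (auto simp: P_def fps.ev_diff fps.ev_mult fps_ev_map_poly
        intro!: polys_diff polys_mult poly_map_in_polys)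
  then show ?thesis using f(1) q(1) by blast
qed

sublocale R: cring R by (rule cring_mpoly_ring)

abbreviation F :: "'a fps ring" where "F \<equiv> ring_of_type_algebra"

sublocale F: cring F by (rule cring_from_type_algebra)

lemma F_simps: "carrier F = UNIV" "p \<oplus>\<^bsub>F\<^esub> q = p + q" "p \<otimes>\<^bsub>F\<^esub> q = p * q"
  "\<zero>\<^bsub>F\<^esub> = 0" "\<one>\<^bsub>F\<^esub> = 1"
  by (simp_all add: ring_of_type_algebra_def)

lemma ev_ring_hom: "ring_hom_ring R F (fps.ev \<gamma>)"
  by (rule ring_hom_ringI2[OF R.ring_axioms F.ring_axioms], rule ring_hom_memI)
    (simp_all add: F_simps fps.ev_add fps.ev_mult)

lemma P_kernel: "P = a_kernel R F (fps.ev \<gamma>)"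
  by (simp add: P_def a_kernel_def' F_simps)

lemma ideal_P: "ideal P R"
  unfolding P_kernel by (rule ring_hom_ring.kernel_is_ideal[OF ev_ring_hom])

lemma prime_P: "primeideal P R"
proof (rule primeidealI[OF ideal_P cring_mpoly_ring])
  have "1 \<in> carrier R" "1 \<notin> P" by (simp_all add: P_def)
  then show "carrier R \<noteq> P" by metis
qed (auto simp: P_def fps.ev_mult)

lemma domain_quot: "domain (R Quot P)"
  by (rule primeideal.quotient_is_domain[OF prime_P])

lemma cring_quot: "cring (R Quot P)"
  using domain_quot domain.axioms(1) by blast

lemma quot_ring_hom: "ring_hom_ring (R Quot P) F (\<lambda>Y. the_elem (fps.ev \<gamma> ` Y))"
  unfolding P_kernel
  by (rule ring_hom_ringI2[OF _ F.ring_axioms ring_hom_ring.the_elem_hom[OF ev_ring_hom]])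
    (rule ideal.quotient_is_ring[OF ring_hom_ring.kernel_is_ideal[OF ev_ring_hom]])

lemma prime_F:
  assumes "0 \<in> J" "\<And>a b. a \<in> J \<Longrightarrow> b \<in> J \<Longrightarrow> a - b \<in> J" "\<And>a b. a \<in> J \<Longrightarrow> a * b \<in> J"
    "1 \<notin> J" "\<And>a b. a * b \<in> J \<Longrightarrow> a \<in> J \<or> b \<in> J"
  shows "primeideal J F"
proof (rule primeidealI)
  have minus: "\<ominus>\<^bsub>F\<^esub> a = - a" for a
    by (rule sym, rule F.sum_zero_eq_neg) (auto simp: F_simps)
  show "ideal J F"
  proof (rule idealI)
    show "subgroup J (add_monoid F)"
    proof (rule F.add.subgroupI)
      show "J \<noteq> {}" using assms(1) by blast
    next
      fix a assume a: "a \<in> J"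
      then show "\<ominus>\<^bsub>F\<^esub> a \<in> J" using assms(2)[of 0 a] assms(1) by (simp add: minus)
    next
      fix a b assume "a \<in> J" "b \<in> J"
      then show "a \<oplus>\<^bsub>F\<^esub> b \<in> J"
        using assms(2)[of a "0 - b"] assms(2)[of 0 b] assms(1) by (simp add: F_simps)
    qed (simp add: F_simps)
  qed (use assms(3) in \<open>simp_all add: F_simps F.ring_axioms mult.commute\<close>)
qed (use assms in \<open>auto simp: F_simps F.cring_axioms\<close>)

text \<open>For the lower bound, the zero ideal and the ideal of series without constant term pull
  back to different primes, since the first variable evaluates to t.\<close>

lemma krull_dim_quot: "krull_dim (R Quot P) = 1"
proof -
  let ?\<phi> = "\<lambda>Y. the_elem (fps.ev \<gamma> ` Y)"
  let ?ch = "\<lambda>d Q. (\<forall>i\<le>d. primeideal (Q i) (R Quot P)) \<and> (\<forall>i<d. Q i \<subset> Q (Suc i))"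
  define Q where "Q i = {Y \<in> carrier (R Quot P). ?\<phi> Y \<in> (if i = 0 then {0} else {f. f $ 0 = 0})}" for i :: nat
  have "primeideal (Q i) (R Quot P)" for i
    unfolding Q_def
    by (rule ring_hom_ring.primeideal_vimage[OF quot_ring_hom cring_quot], rule prime_F) auto
  moreover have "Q 0 \<subset> Q 1"
  proof
    show "Q 0 \<subseteq> Q 1" by (auto simp: Q_def)
    have mem: "mvar 0 \<in> carrier R" by (auto simp: n_def intro: polys_var)
    let ?Y = "P +>\<^bsub>R\<^esub> mvar 0"
    have "?\<phi> ?Y = fps_X"
      unfolding P_kernel using ring_hom_ring.the_elem_simp[OF ev_ring_hom mem] by (simp add: \<gamma>_0)
    moreover have "?Y \<in> carrier (R Quot P)"
      using mem by (auto simp: FactRing_def A_RCOSETS_def')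
    ultimately have "?Y \<in> Q 1" "?Y \<notin> Q 0" by (simp_all add: Q_def)
    then show "Q 0 \<noteq> Q 1" by blast
  qed
  ultimately have "?ch 1 Q" by simp
  then have ex: "\<exists>Q. ?ch 1 Q" by (rule exI[of _ Q])
  \<comment> \<open>From three primes take \<open>g\<close> in \<open>L 1\<close> outside
    \<open>L 0\<close> and \<open>h\<close> in \<open>L 2\<close> outside \<open>L 1\<close>. By
    \<open>algebraic_mod\<close> some nonzero \<open>f\<close> satisfies f(h) in \<open>L 1\<close>.
    But then the constant term of \<open>f\<close> lies in \<open>L 2\<close> and vanishes;
    cancelling the factor \<open>h\<close>, which is not in the prime \<open>L 1\<close>, and
    repeating gives f = 0.\<close>
  have le: "d \<le> 1" if chain: "\<exists>Q. ?ch d Q" for d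
  proof (rule ccontr)
    assume d: "\<not> d \<le> 1"
    obtain Q where Q: "\<And>i. i \<le> d \<Longrightarrow> primeideal (Q i) (R Quot P)" "\<And>i. i < d \<Longrightarrow> Q i \<subset> Q (Suc i)"
      using chain by blast
    define L where "L i = {x \<in> carrier R. P +>\<^bsub>R\<^esub> x \<in> Q i}" for i
    have hom: "ring_hom_ring R (R Quot P) ((+>\<^bsub>R\<^esub>) P)"
      by (rule ideal.rcos_ring_hom_ring[OF ideal_P])
    have L: "primeideal (L i) R" if "i \<le> d" for i
      unfolding L_def by (rule ring_hom_ring.primeideal_vimage[OF hom R.cring_axioms Q(1)[OF that]])
    have step: "\<exists>g. g \<in> polys n \<and> g \<in> L (Suc i) \<and> g \<notin> L i" if i: "i < d" for i
    proof -
      obtain Y where Y: "Y \<in> Q (Suc i)" "Y \<notin> Q i" using Q(2)[OF i] by blast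
      have "ideal (Q (Suc i)) (R Quot P)" using Q(1)[of "Suc i"] i by (auto intro: primeideal.axioms(1))
      then have "Y \<in> carrier (R Quot P)" using Y(1) ideal.Icarr by metis
      then obtain x where "x \<in> carrier R" "Y = P +>\<^bsub>R\<^esub> x"
        by (auto simp: FactRing_def A_RCOSETS_def')
      then show ?thesis using Y by (auto simp: L_def)
    qed
    have mono: "L i \<subseteq> L (Suc i)" if "i < d" for i
      using Q(2)[OF that] by (auto simp: L_def)
    have PL: "P \<subseteq> L 0"
    proof
      fix p assume p: "p \<in> P"
      then have "P +>\<^bsub>R\<^esub> p = \<zero>\<^bsub>R Quot P\<^esub>"
        using R.a_coset_join2[of p P] additive_subgroup.a_subgroup[OF ideal.axioms(1)[OF ideal_P]]
          ideal.Icarr[OF ideal_P] by (simp add: FactRing_def)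
      moreover have "ideal (Q 0) (R Quot P)" using Q(1)[of 0] by (auto intro: primeideal.axioms(1))
      ultimately have "P +>\<^bsub>R\<^esub> p \<in> Q 0"
        using additive_subgroup.zero_closed[OF ideal.axioms(1)] by metis
      then show "p \<in> L 0" using p by (simp add: L_def P_def)
    qed
    obtain g where g: "g \<in> polys n" "g \<in> L 1" "g \<notin> L 0" using step[of 0] d by auto
    obtain h where h: "h \<in> polys n" "h \<in> L 2" "h \<notin> L 1" using step[of 1] d by (auto simp: numeral_2_eq_2)
    have "fps.ev \<gamma> g \<noteq> 0" using g PL by (auto simp: P_def)
    then obtain f q where f: "f \<noteq> 0" "q \<in> polys n" "poly (map_poly mconst f) h - q * g \<in> P"
      using algebraic_mod g(1) h(1) by blast
    interpret L1: primeideal "L 1" R using L[of 1] d by simp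
    interpret L2: primeideal "L 2" R using L[of 2] d by simp
    have sub: "L 1 \<subseteq> L 2" "P \<subseteq> L 1" using mono[of 0] mono[of 1] PL d by (auto simp: numeral_2_eq_2)
    have "q * g \<in> L 1" using L1.I_l_closed[OF g(2), of q] f(2) by simp
    then have "(poly (map_poly mconst f) h - q * g) + q * g \<in> L 1"
      using L1.a_closed[of "poly (map_poly mconst f) h - q * g" "q * g"] f(3) sub(2) by auto
    then have "poly (map_poly mconst f) h \<in> L 1" by simp
    moreover have "f = 0" if "poly (map_poly mconst f) h \<in> L 1" for f
      using that
    proof (induction f)
      case (pCons a f)
      define p where "p = poly (map_poly mconst f) h"
      have p: "p \<in> polys n" unfolding p_def by (rule poly_map_in_polys[OF h(1)])
      have mem: "mconst a + h * p \<in> L 1" using pCons.prems by (simp add: map_poly_pCons p_def)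
      have "a = 0"
      proof (rule ccontr)
        assume "a \<noteq> 0"
        have "(- p) * h \<in> L 2"
          using L2.I_l_closed[OF h(2), of "- p"] p by (simp add: polys_uminus)
        then have "(mconst a + h * p) + (- p) * h \<in> L 2"
          using L2.a_closed[of "mconst a + h * p" "(- p) * h"] mem sub(1) by auto
        then have "mconst a \<in> L 2" by simp
        then have "mconst (inverse a) * mconst a \<in> L 2"
          using L2.I_l_closed[of "mconst a" "mconst (inverse a)"] by simp
        then have "1 \<in> L 2" using \<open>a \<noteq> 0\<close> by (simp add: mult_single)
        then show False using L2.I_notcarr L2.one_imp_carrier by simp
      qed
      then have "h * p \<in> L 1" using mem by simp
      then have "p \<in> L 1" using L1.I_prime[of h p] h p by simp
      then have "f = 0" using pCons.IH by (simp add: p_def)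
      then show ?case using \<open>a = 0\<close> by simp
    qed simp
    ultimately show False using f(1) by blast
  qed
  show ?thesis
    unfolding krull_dim_def one_enat_def
  proof (rule antisym)
    show "Sup {enat d | d. \<exists>Q. ?ch d Q} \<le> enat 1"
    proof (rule Sup_least)
      fix e assume "e \<in> {enat d | d. \<exists>Q. ?ch d Q}"
      then obtain d where "e = enat d" "\<exists>Q. ?ch d Q" by blast
      then show "e \<le> enat 1" using le[of d] by simp
    qed
    show "enat 1 \<le> Sup {enat d | d. \<exists>Q. ?ch d Q}"
      by (rule Sup_upper) (use ex in blast)
  qed
qed

lemma affine_curve_P: "affine_curve n P"
  using ideal_P domain_quot krull_dim_quot by (simp add: affine_curve_def)

lemma rational_points_P:
  "x \<in> rational_points n P \<longleftrightarrow> x \<in> {..<n} \<rightarrow>\<^sub>E UNIV \<and> (\<forall>p\<in>P. peval x p = 0)"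
  by (simp add: rational_points_def)

section \<open>The Jacobian at the point t = 0 of the curve\<close>

definition jac_row :: "'a mpoly \<Rightarrow> nat \<Rightarrow> 'a" where
  "jac_row p i = (if i < n then peval x0 (partial_deriv i p) else 0)"

definition tangent :: "nat \<Rightarrow> 'a" where "tangent i = fps_deriv (\<gamma> i) $ 0"

text \<open>For 1 \<le> i < n these vectors form a basis of the hyperplane orthogonal to the
  velocity \<open>tangent\<close>, whose entry 0 equals 1.\<close>

definition unit_row :: "nat \<Rightarrow> nat \<Rightarrow> 'a" where
  "unit_row i j = (if j = i then 1 else if j = 0 then - tangent i else 0)"

lemma tangent_0: "tangent 0 = 1"
  by (simp add: tangent_def \<gamma>_0)

text \<open>Differentiate the identity p(\<gamma>(t)) = 0 at t = 0.\<close>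

lemma jac_row_tangent:
  assumes "p \<in> P"
  shows "(\<Sum>i<n. jac_row p i * tangent i) = 0"
proof -
  have p: "p \<in> polys n" "fps.ev \<gamma> p = 0" using assms by (simp_all add: P_def)
  have "fps_deriv (fps.ev \<gamma> p) = (\<Sum>i<n. fps.ev \<gamma> (partial_deriv i p) * fps_deriv (\<gamma> i))"
    by (rule fps.derivation_ev) (simp_all add: p(1) algebra_simps)
  then have "(\<Sum>i<n. fps.ev \<gamma> (partial_deriv i p) * fps_deriv (\<gamma> i)) $ 0 = 0"
    using p(2) by simp
  then show ?thesis
    by (simp add: fps_sum_nth jac_row_def tangent_def ev_x0 partial_deriv_in_polys p(1))
qed

lemma jac_row_expand:
  assumes "p \<in> P"
  shows "jac_row p = (\<Sum>i\<in>{1..<n}. (\<lambda>j. jac_row p i * unit_row i j))"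
proof
  fix j
  have split: "(\<Sum>i<n. jac_row p i * tangent i) = jac_row p 0 + (\<Sum>i\<in>{1..<n}. jac_row p i * tangent i)"
  proof -
    have "{..<n} = insert 0 {1..<n}" by (auto simp: n_def)
    then show ?thesis by (simp add: tangent_0)
  qed
  show "jac_row p j = (\<Sum>i\<in>{1..<n}. (\<lambda>j. jac_row p i * unit_row i j)) j"
  proof (cases "j = 0")
    case True
    then have "(\<Sum>i\<in>{1..<n}. jac_row p i * unit_row i j) = - (\<Sum>i\<in>{1..<n}. jac_row p i * tangent i)"
      unfolding sum_negf[symmetric] by (intro sum.cong) (auto simp: unit_row_def)
    also have "\<dots> = jac_row p j"
      using True split jac_row_tangent[OF assms] by (simp only: eq_neg_iff_add_eq_0 neg_eq_iff_add_eq_0 add.commute)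
    finally show ?thesis by (simp add: sum_fun_apply)
  next
    case False
    have "(\<Sum>i\<in>{1..<n}. jac_row p i * unit_row i j) = (\<Sum>i\<in>{1..<n}. if i = j then jac_row p i else 0)"
      using False by (intro sum.cong) (auto simp: unit_row_def)
    also have "\<dots> = jac_row p j"
      using False by (simp add: jac_row_def)
    finally show ?thesis by (simp add: sum_fun_apply)
  qed
qed

text \<open>The equation witnessing \<open>etale\<close> for the \<open>i\<close>-th series contains
  only the variables up to \<open>i\<close>, and its derivative in the last one has nonzero constant
  term. So these equations have a triangular Jacobian.\<close>

lemma etale_row:
  assumes "i \<in> {1..<n}"
  shows "\<exists>p\<in>P. jac_row p i \<noteq> 0 \<and> (\<forall>j>i. jac_row p j = 0)"
proof -
  obtain i' where i: "i = Suc i'" "i' < length gs"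
    using assms by (cases i) (auto simp: n_def)
  then have "etale (set (take i' gs)) (gs ! i')"
    using tower by (simp add: tower_def)
  then obtain f where f: "\<And>d. coeff f d \<in> fps.alg (\<gamma> ` {..<i})" "poly f (\<gamma> i) = 0"
      "poly (pderiv f) (\<gamma> i) $ 0 \<noteq> 0"
    unfolding etale_def using \<gamma>_image_i[of i'] i by (auto simp: \<gamma>_def)
  have "\<forall>d. \<exists>q. q \<in> polys i \<and> coeff f d = fps.ev \<gamma> q"
    using fps.alg_ev[OF f(1)] by blast
  from choice[OF this] obtain C where C: "\<And>d. C d \<in> polys i" "\<And>d. coeff f d = fps.ev \<gamma> (C d)"
    by blast
  define g where "g = (\<Sum>d\<le>degree f. monom (C d) d)"
  have coeff_g: "coeff g d = (if d \<le> degree f then C d else 0)" for d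
    by (simp add: g_def coeff_sum)
  then have g_polys: "coeff g d \<in> polys i" for d using C(1) by simp
  have ev_g: "fps.ev \<gamma> (poly g (mvar i)) = poly f (\<gamma> i)"
    unfolding g_def poly_sum poly_monom fps.ev_sum fps.ev_mult fps.ev_power fps.ev_var C(2)[symmetric]
    by (rule poly_altdef[symmetric])
  have "map_poly (fps.ev \<gamma>) g = f"
    by (rule poly_eqI) (auto simp: coeff_map_poly coeff_g C(2)[symmetric] coeff_eq_0)
  have pderiv_ev: "fps.ev \<gamma> (poly (pderiv g) (mvar i)) = poly (pderiv f) (\<gamma> i)"
    using map_poly_fps_ev[of \<gamma> "pderiv g" i] \<open>map_poly _ g = f\<close> by (simp flip: pderiv_map_poly_fps_ev)
  let ?p = "poly g (mvar i)"
  have p: "?p \<in> polys (Suc i)" by (rule poly_mvar_in_polys[OF g_polys])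
  have pn: "?p \<in> polys n" using polys_mono[OF _ p, of n] assms by simp
  then have "?p \<in> P" using ev_g f(2) by (simp add: P_def)
  moreover have "jac_row ?p i \<noteq> 0"
    using f(3) pderiv_ev assms partial_deriv_in_polys[OF pn, of i]
    by (simp add: jac_row_def ev_x0 partial_deriv_poly_mvar[OF g_polys])
  moreover have "jac_row ?p j = 0" if "j > i" for j
    using partial_deriv_polys[OF p, of j] that by (simp add: jac_row_def)
  ultimately show ?thesis by blast
qed

text \<open>Orthogonality to \<open>tangent\<close> confines the rows to the span of the
  \<open>unit_row i\<close>. Conversely, the triangular equations produce \<open>unit_row i\<close>
  by elimination, after subtracting the multiples of those with smaller index.\<close>

lemma jacobian_rank_P: "jacobian_rank n P x0 = length gs"
proof -
  let ?W = "unit_row ` {1..<n}"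
  have rank: "jacobian_rank n P x0 = fv.dim (jac_row ` P)"
    unfolding jacobian_rank_def jac_row_def[abs_def] ..
  have inj: "inj_on unit_row {1..<n}"
  proof (rule inj_onI)
    fix i j assume "i \<in> {1..<n}" "j \<in> {1..<n}" "unit_row i = unit_row j"
    then show "i = j" using fun_cong[of "unit_row i" "unit_row j" i]
      unfolding unit_row_def[of i i] unit_row_def[of j i] by (auto split: if_splits)
  qed
  have indep: "fv.independent ?W"
  proof (rule fv.independent_if_scalars_zero)
    fix a v assume sum: "(\<Sum>v\<in>?W. (\<lambda>j. a v * v j)) = 0" and "v \<in> ?W"
    then obtain i where i: "i \<in> {1..<n}" "v = unit_row i" by blast
    have "(\<Sum>v\<in>?W. a v * v i) = 0"
      using fun_cong[OF sum, of i] by (simp add: sum_fun_apply)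
    then have "0 = (\<Sum>k\<in>{1..<n}. a (unit_row k) * unit_row k i)"
      unfolding sum.reindex[OF inj] o_def by simp
    also have "\<dots> = (\<Sum>k\<in>{1..<n}. if k = i then a (unit_row k) else 0)"
      using i(1) by (intro sum.cong) (auto simp: unit_row_def)
    also have "\<dots> = a v" using i by simp
    finally show "a v = 0" by simp
  qed simp
  have "jac_row p \<in> fv.span ?W" if "p \<in> P" for p
    by (subst jac_row_expand[OF that], intro fv.span_sum fv.span_scale fv.span_base) simp
  moreover have "unit_row i \<in> fv.span (jac_row ` P)" if "i \<in> {1..<n}" for i
    using that
  proof (induction i rule: less_induct)
    case (less i)
    obtain p where p: "p \<in> P" "jac_row p i \<noteq> 0" "\<And>j. j > i \<Longrightarrow> jac_row p j = 0"
      using etale_row[OF less.prems] by blast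
    have "jac_row p = (\<Sum>k\<in>{1..<n}. (\<lambda>j. jac_row p k * unit_row k j))"
      by (rule jac_row_expand[OF p(1)])
    also have "\<dots> = (\<Sum>k\<in>{1..<Suc i}. (\<lambda>j. jac_row p k * unit_row k j))"
      using less.prems by (intro sum.mono_neutral_right) (auto simp: p(3) fun_eq_iff)
    also have "\<dots> = (\<Sum>k\<in>{1..<i}. (\<lambda>j. jac_row p k * unit_row k j)) + (\<lambda>j. jac_row p i * unit_row i j)"
      using less.prems by (subst sum.atLeastLessThan_Suc) auto
    finally have "(\<lambda>j. jac_row p i * unit_row i j) =
        jac_row p - (\<Sum>k\<in>{1..<i}. (\<lambda>j. jac_row p k * unit_row k j))"
      by (simp add: algebra_simps)
    also have "\<dots> \<in> fv.span (jac_row ` P)"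
    proof (intro fv.span_diff fv.span_sum fv.span_scale)
      show "jac_row p \<in> fv.span (jac_row ` P)" using p(1) by (intro fv.span_base) simp
      show "unit_row k \<in> fv.span (jac_row ` P)" if "k \<in> {1..<i}" for k
        using less.IH[of k] less.prems that by auto
    qed
    finally have "(\<lambda>j. inverse (jac_row p i) * (jac_row p i * unit_row i j)) \<in> fv.span (jac_row ` P)"
      by (rule fv.span_scale)
    then show ?case using p(2) by (simp flip: mult.assoc)
  qed
  ultimately have "fv.span ?W = fv.span (jac_row ` P)"
    unfolding fv.span_eq by blast
  then have "fv.dim (jac_row ` P) = card ?W"
    by (rule fv.dim_eq_card[OF _ indep])
  then show ?thesis
    unfolding rank card_image[OF inj] by (simp add: n_def)
qed

text \<open>The restriction only serves the convention that points are extensional on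
  \<open>{..<n}\<close>; polynomials in \<open>n\<close> variables do not see it.\<close>

lemma smooth_point: "smooth_rational_point n P (restrict x0 {..<n})"
proof -
  have cong: "peval (restrict x0 {..<n}) p = peval x0 p" if "p \<in> polys n" for p
    using that by (rule peval_cong) simp
  have "jacobian_rank n P (restrict x0 {..<n}) = jacobian_rank n P x0"
    unfolding jacobian_rank_def
    by (intro arg_cong[where f = "vector_space.dim _"] image_cong)
      (auto simp: P_def cong partial_deriv_in_polys)
  moreover have "peval (restrict x0 {..<n}) p = 0" if "p \<in> P" for p
    using that by (simp add: P_def cong ev_x0)
  ultimately show ?thesis
    unfolding smooth_rational_point_def rational_points_P jacobian_rank_P by (simp add: n_def)
qed

text \<open>At a zero of \<open>g\<close>, \<open>algebraic_mod\<close> confines each coordinate to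
  the roots of a fixed nonzero polynomial in one variable, leaving finitely many points.\<close>

lemma finite_zeros:
  assumes "g \<in> polys n" "fps.ev \<gamma> g \<noteq> 0"
  shows "finite {x \<in> rational_points n P. peval x g = 0}"
proof -
  have "\<forall>i. \<exists>f. i < n \<longrightarrow> f \<noteq> 0 \<and> (\<forall>x \<in> rational_points n P. peval x g = 0 \<longrightarrow> poly f (x i) = 0)"
  proof
    fix i
    show "\<exists>f. i < n \<longrightarrow> f \<noteq> 0 \<and> (\<forall>x \<in> rational_points n P. peval x g = 0 \<longrightarrow> poly f (x i) = 0)"
    proof (cases "i < n")
      case True
      then obtain f q where f: "f \<noteq> 0" "poly (map_poly mconst f) (mvar i) - q * g \<in> P"
        using algebraic_mod[OF assms polys_var] by blast
      have "poly f (x i) = 0" if "x \<in> rational_points n P" "peval x g = 0" for x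
        using that f(2) peval_map_poly[of x f "mvar i"] unfolding rational_points_P
        by (auto simp: peval_diff peval_mult dest: bspec)
      then show ?thesis using f(1) by blast
    qed simp
  qed
  from choice[OF this] obtain f where f: "\<And>i. i < n \<Longrightarrow> f i \<noteq> 0"
    "\<And>i x. i < n \<Longrightarrow> x \<in> rational_points n P \<Longrightarrow> peval x g = 0 \<Longrightarrow> poly (f i) (x i) = 0"
    by blast
  have "{x \<in> rational_points n P. peval x g = 0} \<subseteq> (\<Pi>\<^sub>E i\<in>{..<n}. {c. poly (f i) c = 0})"
    using f(2) by (auto simp: rational_points_P PiE_iff extensional_def)
  moreover have "finite (\<Pi>\<^sub>E i\<in>{..<n}. {c. poly (f i) c = 0})"
    using f(1) by (intro finite_PiE poly_roots_finite) auto
  ultimately show ?thesis by (rule finite_subset)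
qed

text \<open>A large field provides infinitely many points, only finitely many of which are zeros of
  \<open>v\<close>; \<open>\<chi>\<close> is evaluation at one of the others.\<close>

lemma specialization:
  assumes "large_field TYPE('a)" "v \<in> fps.alg (insert fps_X (set gs))" "v \<noteq> 0"
  shows "\<exists>\<chi>. (\<forall>p\<in>polys n. \<chi> (fps.ev \<gamma> p) = peval (\<lambda>i. \<chi> (\<gamma> i)) p) \<and> \<chi> v \<noteq> (0::'a)"
proof -
  obtain g where g: "g \<in> polys n" "v = fps.ev \<gamma> g"
    using fps.alg_ev[of v \<gamma> n] assms(2) unfolding \<gamma>_image by blast
  have "infinite (rational_points n P)"
    using assms(1) affine_curve_P smooth_point unfolding large_field_def by blast
  then have "\<not> rational_points n P \<subseteq> {x \<in> rational_points n P. peval x g = 0}"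
    using finite_zeros[of g] g assms(3) finite_subset by blast
  then obtain x where x: "x \<in> rational_points n P" "peval x g \<noteq> 0" by blast
  \<comment> \<open>The choice of the polynomial is immaterial on the algebra: two polynomials with
    the same series differ by an element of \<open>P\<close>, which vanishes at
    \<open>x\<close>.\<close>
  define \<chi> where "\<chi> u = peval x (SOME p. p \<in> polys n \<and> fps.ev \<gamma> p = u)" for u
  have \<chi>: "\<chi> (fps.ev \<gamma> p) = peval x p" if "p \<in> polys n" for p
  proof -
    define q where "q = (SOME q. q \<in> polys n \<and> fps.ev \<gamma> q = fps.ev \<gamma> p)"
    have "q \<in> polys n \<and> fps.ev \<gamma> q = fps.ev \<gamma> p"
      unfolding q_def by (rule someI[of _ p]) (use that in simp)
    then have "q - p \<in> P" using that by (simp add: P_def fps.ev_diff polys_diff)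
    then have "peval x (q - p) = 0" using x(1) by (auto simp: rational_points_P)
    then show ?thesis by (simp add: \<chi>_def q_def peval_diff)
  qed
  have hom: "\<chi> (fps.ev \<gamma> p) = peval (\<lambda>i. \<chi> (\<gamma> i)) p" if "p \<in> polys n" for p
  proof -
    have "\<chi> (\<gamma> i) = x i" if "i < n" for i
      using \<chi>[OF polys_var[OF that]] by simp
    then show ?thesis using \<chi>[OF that] peval_cong[OF that, of x "\<lambda>i. \<chi> (\<gamma> i)"] by simp
  qed
  have "\<chi> v \<noteq> 0" using \<chi>[OF g(1)] g(2) x(2) by simp
  with hom show ?thesis by (intro exI[of _ \<chi>] conjI ballI)
qed

end

text \<open>Compatibility with all polynomial expressions says that \<open>\<chi>\<close> is a
  k-algebra homomorphism on the generated algebra, while it stays an arbitrary function on the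
  remaining series.\<close>

proposition large_field_specialization:
  fixes gs :: "'a::field fps list"
  assumes "large_field TYPE('a)" "tower gs" "v \<in> fps.alg (insert fps_X (set gs))" "v \<noteq> 0"
  shows "\<exists>\<chi>. (\<forall>m y p. p \<in> polys m \<longrightarrow> (\<forall>i<m. y i \<in> fps.alg (insert fps_X (set gs))) \<longrightarrow>
     \<chi> (fps.ev y p) = peval (\<lambda>i. \<chi> (y i)) p) \<and> \<chi> v \<noteq> (0::'a)"
proof -
  interpret fps_tower gs by (unfold_locales) (rule assms(2))
  obtain \<chi> where \<chi>: "\<And>p. p \<in> polys n \<Longrightarrow> \<chi> (fps.ev \<gamma> p) = peval (\<lambda>i. \<chi> (\<gamma> i)) p" "\<chi> v \<noteq> (0::'a)"
    using specialization[OF assms(1,3,4)] by blast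
  let ?A = "fps.alg (insert fps_X (set gs))"
  have ex: "\<exists>p\<in>polys n. u = fps.ev \<gamma> p" if "u \<in> ?A" for u
    using fps.alg_ev[of u \<gamma> n] that unfolding \<gamma>_image by blast
  have \<chi>_const: "\<chi> (fps_const c) = c" for c
    using \<chi>(1)[of "mconst c"] by simp
  have \<chi>_add: "\<chi> (u + v) = \<chi> u + \<chi> v" if uv: "u \<in> ?A" "v \<in> ?A" for u v
  proof -
    obtain p q where "p \<in> polys n" "u = fps.ev \<gamma> p" "q \<in> polys n" "v = fps.ev \<gamma> q"
      using ex uv by meson
    then show ?thesis
      using \<chi>(1)[of p] \<chi>(1)[of q] \<chi>(1)[of "p + q"] by (simp add: fps.ev_add peval_add polys_add)
  qed
  have \<chi>_mult: "\<chi> (u * v) = \<chi> u * \<chi> v" if uv: "u \<in> ?A" "v \<in> ?A" for u v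
  proof -
    obtain p q where "p \<in> polys n" "u = fps.ev \<gamma> p" "q \<in> polys n" "v = fps.ev \<gamma> q"
      using ex uv by meson
    then show ?thesis
      using \<chi>(1)[of p] \<chi>(1)[of q] \<chi>(1)[of "p * q"] by (simp add: fps.ev_mult peval_mult polys_mult)
  qed
  have hom: "\<chi> (fps.ev y p) = peval (\<lambda>i. \<chi> (y i)) p"
    if p: "p \<in> polys m" and y: "\<forall>i<m. y i \<in> ?A" for m y p
    using p
  proof (induction rule: polys_induct)
    case (add q r)
    then show ?case
      using fps.ev_in_alg[of q m y] fps.ev_in_alg[of r m y] y
      by (simp add: fps.ev_add peval_add \<chi>_add)
  next
    case (mult q r)
    then show ?case
      using fps.ev_in_alg[of q m y] fps.ev_in_alg[of r m y] y
      by (simp add: fps.ev_mult peval_mult \<chi>_mult)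
  qed (simp_all add: \<chi>_const)
  show ?thesis
    by (intro exI[of _ \<chi>] conjI allI impI) (rule hom, assumption+, rule \<chi>(2))
qed

section \<open>Separable generation over a perfect base\<close>

text \<open>By Zorn, take a maximal family whose finite intersections meet \<open>S\<close> in
  infinite sets. Asking for infinite instead of nonempty sets makes the ultrafilter contain
  \<open>S\<close> and avoid all finite sets.\<close>

lemma exists_ultrafilter:
  assumes "infinite (S :: 'z set)"
  shows "\<exists>U. U \<noteq> bot \<and> (\<forall>P. eventually P U \<or> eventually (\<lambda>z. \<not> P z) U) \<and>
    eventually (\<lambda>z. z \<in> S) U \<and> (\<forall>F. finite F \<longrightarrow> eventually (\<lambda>z. z \<notin> F) U)"
proof -
  define fip where "fip \<A> \<longleftrightarrow> (\<forall>\<F>. finite \<F> \<and> \<F> \<subseteq> \<A> \<longrightarrow> infinite (S \<inter> \<Inter>\<F>))" for \<A> :: "'z set set"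
  have "\<exists>M\<in>Collect fip. \<forall>N\<in>Collect fip. M \<subseteq> N \<longrightarrow> N = M"
  proof (rule subset_Zorn')
    fix \<C> assume chain: "subset.chain (Collect fip) \<C>"
    have "infinite (S \<inter> \<Inter>\<F>)" if \<F>: "finite \<F>" "\<F> \<subseteq> \<Union>\<C>" for \<F>
    proof (cases "\<C> = {}")
      case True
      then show ?thesis using that assms by simp
    next
      case False
      then obtain \<A> where "\<A> \<in> \<C>" "\<F> \<subseteq> \<A>"
        using finite_subset_Union_chain[OF \<F> False chain] by blast
      then show ?thesis
        using chain \<F>(1) unfolding subset.chain_def fip_def by blast
    qed
    then show "\<Union>\<C> \<in> Collect fip" by (simp add: fip_def)
  qed
  then obtain M where M: "fip M" "\<And>N. fip N \<Longrightarrow> M \<subseteq> N \<Longrightarrow> N = M" by blast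
  have finite_inter: "infinite (S \<inter> \<Inter>\<F>)" if "finite \<F>" "\<F> \<subseteq> M" for \<F>
    using M(1) that by (simp add: fip_def)
  have not_mem: "\<exists>\<F>. finite \<F> \<and> \<F> \<subseteq> M \<and> finite (S \<inter> A \<inter> \<Inter>\<F>)" if A: "A \<notin> M" for A
  proof -
    have "\<not> fip (insert A M)" using M(2)[of "insert A M"] A by blast
    then obtain \<F> where \<F>: "finite \<F>" "\<F> \<subseteq> insert A M" "finite (S \<inter> \<Inter>\<F>)" by (auto simp: fip_def)
    moreover have "S \<inter> A \<inter> \<Inter>(\<F> - {A}) \<subseteq> S \<inter> \<Inter>\<F>" by blast
    ultimately have "finite (S \<inter> A \<inter> \<Inter>(\<F> - {A}))" using finite_subset by metis
    then show ?thesis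
      using \<F>(1,2) by (intro exI[of _ "\<F> - {A}"]) auto
  qed
  have mem: "A \<in> M" if F: "finite \<F>" "\<F> \<subseteq> M" "finite (S \<inter> \<Inter>\<F> - A)" for A \<F>
  proof (rule ccontr)
    assume "A \<notin> M"
    then obtain \<G> where \<G>: "finite \<G>" "\<G> \<subseteq> M" "finite (S \<inter> A \<inter> \<Inter>\<G>)" using not_mem by blast
    have "S \<inter> \<Inter>(\<F> \<union> \<G>) \<subseteq> (S \<inter> \<Inter>\<F> - A) \<union> (S \<inter> A \<inter> \<Inter>\<G>)" by blast
    then have "finite (S \<inter> \<Inter>(\<F> \<union> \<G>))" using F(3) \<G>(3) by (meson finite_UnI finite_subset)
    then show False using finite_inter[of "\<F> \<union> \<G>"] F \<G> by simp
  qed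
  define U where "U = Abs_filter (\<lambda>P. Collect P \<in> M)"
  have "is_filter (\<lambda>P. Collect P \<in> M)"
  proof
    show "Collect (\<lambda>x. True) \<in> M" by (rule mem[of "{}"]) auto
  next
    fix P Q assume "Collect P \<in> M" "Collect Q \<in> M"
    then show "Collect (\<lambda>x. P x \<and> Q x) \<in> M"
      by (intro mem[of "{Collect P, Collect Q}"]) (auto intro: finite_subset[of _ "{}"])
  next
    fix P Q :: "'z \<Rightarrow> bool" assume "\<forall>x. P x \<longrightarrow> Q x" "Collect P \<in> M"
    then show "Collect Q \<in> M"
      by (intro mem[of "{Collect P}"]) (auto intro: finite_subset[of _ "{}"])
  qed
  then have ev: "eventually P U \<longleftrightarrow> Collect P \<in> M" for P
    unfolding U_def by (rule eventually_Abs_filter)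
  have "{} \<notin> M" using finite_inter[of "{{}}"] by auto
  then have "U \<noteq> bot" using ev[of "\<lambda>_. False"] by (auto simp: trivial_limit_def)
  moreover have "eventually P U \<or> eventually (\<lambda>z. \<not> P z) U" for P
  proof (rule disjCI)
    assume "\<not> eventually (\<lambda>z. \<not> P z) U"
    then have "{z. \<not> P z} \<notin> M" by (simp add: ev)
    from not_mem[OF this] obtain \<F> where \<F>: "finite \<F>" "\<F> \<subseteq> M" "finite (S \<inter> {z. \<not> P z} \<inter> \<Inter>\<F>)"
      by blast
    have "S \<inter> \<Inter>\<F> - Collect P = S \<inter> {z. \<not> P z} \<inter> \<Inter>\<F>" by blast
    then show "eventually P U" unfolding ev using \<F> by (intro mem[of \<F>]) simp_all
  qed
  moreover have "eventually (\<lambda>z. z \<in> S) U"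
    unfolding ev by (rule mem[of "{}"]) auto
  moreover have "eventually (\<lambda>z. z \<notin> F) U" if "finite F" for F
    unfolding ev by (rule mem[of "{}"]) (auto intro: finite_subset[OF _ that])
  ultimately show ?thesis by blast
qed

text \<open>The characteristic exponent: with the value 1 in characteristic 0, its powers are
  additive in every characteristic and one argument covers both cases.\<close>

definition char_exp :: "'a::field itself \<Rightarrow> nat" where
  "char_exp _ = (if CHAR('a) = 0 then 1 else CHAR('a))"

lemma sum_power_char_exp:
  "(\<Sum>i\<in>A. f i) ^ char_exp TYPE('a) = (\<Sum>i\<in>A. f i ^ char_exp TYPE('a))" for f :: "'i \<Rightarrow> 'a::field"
proof (cases "CHAR('a) = 0")
  case False
  then have "prime CHAR('a)" by (intro prime_CHAR_semidom) simp
  then show ?thesis using False freshmans_dream_sum[of "CHAR('a)" f A] by (simp add: char_exp_def)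
qed (simp add: char_exp_def)

lemma add_power_char_exp_power:
  fixes a b :: "'a::field"
  shows "(a + b) ^ (char_exp TYPE('a) ^ m) = a ^ (char_exp TYPE('a) ^ m) + b ^ (char_exp TYPE('a) ^ m)"
proof (cases "CHAR('a) = 0")
  case False
  then have "prime CHAR('a)" by (intro prime_CHAR_semidom) simp
  then show ?thesis using False freshmans_dream'[of "CHAR('a) ^ m" m a b] by (simp add: char_exp_def)
qed (simp add: char_exp_def)

locale ultra =
  fixes U :: "'z filter"
  assumes nonbot: "U \<noteq> bot" and dichotomy: "eventually P U \<or> eventually (\<lambda>z. \<not> P z) U"
begin

lemma not_eventually_iff: "\<not> eventually P U \<longleftrightarrow> eventually (\<lambda>z. \<not> P z) U"
proof
  assume "eventually (\<lambda>z. \<not> P z) U"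
  then show "\<not> eventually P U"
    using eventually_conj[of P U "\<lambda>z. \<not> P z"] nonbot by (auto simp: trivial_limit_def)
qed (use dichotomy in blast)

text \<open>\<open>v\<close> is a simple root, modulo \<open>U\<close>, of a polynomial over
  \<open>A\<close>; the second sum is the derivative at \<open>v\<close>, and its nonvanishing also
  excludes the trivial polynomial.\<close>

definition sepalg :: "('z \<Rightarrow> 'a::field) set \<Rightarrow> ('z \<Rightarrow> 'a) \<Rightarrow> bool" where
  "sepalg A v \<longleftrightarrow> (\<exists>c D. (\<forall>d. c d \<in> A) \<and> (\<forall>\<^sub>F z in U. (\<Sum>d\<le>D. c d z * v z ^ d) = 0) \<and>
     (\<forall>\<^sub>F z in U. (\<Sum>d\<le>D. of_nat d * c d z * v z ^ (d - 1)) \<noteq> 0))"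

definition free :: "('z \<Rightarrow> 'a::field) set \<Rightarrow> ('z \<Rightarrow> 'a) \<Rightarrow> bool" where
  "free A v \<longleftrightarrow> (\<forall>c D. (\<forall>d. c d \<in> A) \<longrightarrow> (\<forall>\<^sub>F z in U. (\<Sum>d\<le>D. c d z * v z ^ d) = 0) \<longrightarrow>
     (\<forall>d\<le>D. \<forall>\<^sub>F z in U. c d z = 0))"

lemma free_mono: "free A v \<Longrightarrow> A' \<subseteq> A \<Longrightarrow> free A' v"
  unfolding free_def by blast

end

text \<open>In the application \<open>B\<close> is generated over k by all p-power roots of s, and
  \<open>x\<close> lists the witnesses of the formula. \<open>B\<close> is kept a ring of functions
  and no denominators are formed; p-th roots exist in it at every point, not only modulo
  \<open>U\<close>.\<close>

locale perfect_base = ultra U for U :: "'z filter" +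
  fixes B :: "('z \<Rightarrow> 'a::field) set" and x :: "nat \<Rightarrow> 'z \<Rightarrow> 'a"
  assumes B_alg: "fn.alg B = B"
    and perfect: "b \<in> B \<Longrightarrow> \<exists>b'\<in>B. \<forall>z. b' z ^ char_exp TYPE('a) = b z"
begin

definition mon :: "nat set \<Rightarrow> (nat \<Rightarrow> nat) \<Rightarrow> 'z \<Rightarrow> 'a" where
  "mon J \<mu> z = (\<Prod>j\<in>J. x j z ^ \<mu> j)"

definition rep :: "nat set \<Rightarrow> ('z \<Rightarrow> 'a) \<Rightarrow> (nat \<Rightarrow> nat) set \<Rightarrow> ((nat \<Rightarrow> nat) \<Rightarrow> 'z \<Rightarrow> 'a) \<Rightarrow> bool" where
  "rep J u M b \<longleftrightarrow> finite M \<and> (\<forall>\<mu>\<in>M. \<forall>j. j \<notin> J \<longrightarrow> \<mu> j = 0) \<and> (\<forall>\<mu>. b \<mu> \<in> B) \<and>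
     (\<forall>z. u z = (\<Sum>\<mu>\<in>M. b \<mu> z * mon J \<mu> z))"

text \<open>The entry \<open>\<mu> i\<close> tells from which coefficient \<open>c d\<close> a term
  comes, and \<open>\<mu>(i := 0)\<close> which monomial it was there; hence the exponent sets for
  different \<open>d\<close> are disjoint.\<close>

lemma rep_combine:
  assumes "finite J" "i \<notin> J" and r: "\<And>d. d \<le> D \<Longrightarrow> rep J (c d) (N d) (b d)" "\<And>d \<mu>. b d \<mu> \<in> B"
  shows "rep (insert i J) (\<lambda>z. \<Sum>d\<le>D. c d z * x i z ^ d) (\<Union>d\<in>{..D}. (\<lambda>\<nu>. \<nu>(i := d)) ` N d)
    (\<lambda>\<mu>. b (\<mu> i) (\<mu>(i := 0)))"
  unfolding rep_def
proof (intro conjI allI)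
  show "finite (\<Union>d\<in>{..D}. (\<lambda>\<nu>. \<nu>(i := d)) ` N d)" using r by (auto simp: rep_def)
  show "\<forall>\<mu>\<in>\<Union>d\<in>{..D}. (\<lambda>\<nu>. \<nu>(i := d)) ` N d. \<forall>j. j \<notin> insert i J \<longrightarrow> \<mu> j = 0"
    using r by (auto simp: rep_def)
  show "b (\<mu> i) (\<mu>(i := 0)) \<in> B" for \<mu> using r(2) .
  fix z
  have supp: "\<nu> i = 0" if "d \<le> D" "\<nu> \<in> N d" for d \<nu> using r(1)[OF that(1)] that(2) assms(2) by (simp add: rep_def)
  have inj: "inj_on (\<lambda>\<nu>. \<nu>(i := d)) (N d)" if "d \<le> D" for d
  proof (rule inj_onI)
    fix \<nu> \<nu>' assume "\<nu> \<in> N d" "\<nu>' \<in> N d" "\<nu>(i := d) = \<nu>'(i := d)"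
    then show "\<nu> = \<nu>'"
      using supp[OF that] by (metis fun_upd_triv fun_upd_upd)
  qed
  have mon: "mon (insert i J) (\<nu>(i := d)) z = mon J \<nu> z * x i z ^ d" for \<nu> d
  proof -
    have "(\<Prod>j\<in>J. x j z ^ (\<nu>(i := d)) j) = (\<Prod>j\<in>J. x j z ^ \<nu> j)"
      using assms(2) by (intro prod.cong) auto
    then show ?thesis using assms(1,2) by (simp add: mon_def)
  qed
  have "(\<Sum>\<mu>\<in>(\<Union>d\<in>{..D}. (\<lambda>\<nu>. \<nu>(i := d)) ` N d). b (\<mu> i) (\<mu>(i := 0)) z * mon (insert i J) \<mu> z) =
     (\<Sum>d\<le>D. \<Sum>\<mu>\<in>(\<lambda>\<nu>. \<nu>(i := d)) ` N d. b (\<mu> i) (\<mu>(i := 0)) z * mon (insert i J) \<mu> z)"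
    by (rule sum.UNION_disjoint) (use r(1) in \<open>auto simp: rep_def dest: fun_cong[of _ _ i]\<close>)
  also have "\<dots> = (\<Sum>d\<le>D. \<Sum>\<nu>\<in>N d. b d \<nu> z * mon J \<nu> z * x i z ^ d)"
  proof (rule sum.cong[OF refl])
    fix d assume "d \<in> {..D}"
    then have d: "d \<le> D" by simp
    have "\<nu>(i := 0) = \<nu>" if "\<nu> \<in> N d" for \<nu> using supp[OF d that] by auto
    then show "(\<Sum>\<mu>\<in>(\<lambda>\<nu>. \<nu>(i := d)) ` N d. b (\<mu> i) (\<mu>(i := 0)) z * mon (insert i J) \<mu> z) =
        (\<Sum>\<nu>\<in>N d. b d \<nu> z * mon J \<nu> z * x i z ^ d)"
      unfolding sum.reindex[OF inj[OF d]] o_def by (intro sum.cong) (simp_all add: mon mult_ac)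
  qed
  also have "\<dots> = (\<Sum>d\<le>D. c d z * x i z ^ d)"
    using r(1) by (intro sum.cong) (simp_all add: rep_def sum_distrib_right)
  finally show "(\<Sum>d\<le>D. c d z * x i z ^ d) = (\<Sum>\<mu>\<in>(\<Union>d\<in>{..D}. (\<lambda>\<nu>. \<nu>(i := d)) ` N d).
      b (\<mu> i) (\<mu>(i := 0)) z * mon (insert i J) \<mu> z)" ..
qed

lemma alg_rep: "finite J \<Longrightarrow> u \<in> fn.alg (B \<union> x ` J) \<Longrightarrow> \<exists>M b. rep J u M b"
proof (induction J arbitrary: u rule: finite_induct)
  case empty
  then have "u \<in> B" using B_alg by simp
  then show ?case
    by (intro exI[of _ "{\<lambda>_. 0}"] exI[of _ "\<lambda>_. u"]) (simp add: rep_def mon_def)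
next
  case (insert i J)
  have "u \<in> fn.alg (insert (x i) (B \<union> x ` J))" using insert.prems by simp
  from fn.alg_insert[OF this] obtain f where f: "\<And>d. coeff f d \<in> fn.alg (B \<union> x ` J)" "u = poly f (x i)"
    by blast
  have "\<forall>d. \<exists>Nb. rep J (coeff f d) (fst Nb) (snd Nb)"
    using insert.IH[OF f(1)] by force
  from choice[OF this] obtain Nb where Nb: "\<And>d. rep J (coeff f d) (fst (Nb d)) (snd (Nb d))" by blast
  have "rep (insert i J) (\<lambda>z. \<Sum>d\<le>degree f. coeff f d z * x i z ^ d)
     (\<Union>d\<in>{..degree f}. (\<lambda>\<nu>. \<nu>(i := d)) ` fst (Nb d)) (\<lambda>\<mu>. snd (Nb (\<mu> i)) (\<mu>(i := 0)))"
    by (rule rep_combine[OF insert.hyps Nb]) (use Nb in \<open>simp add: rep_def\<close>)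
  then show ?case
    unfolding f(2) poly_fun_apply[symmetric] by blast
qed

text \<open>A relation with all coefficients nonzero; one of minimal weight is not a \<open>p\<close>-th power, so
  some variable is separable over the others (MacLane's argument).\<close>

definition relation :: "nat set \<Rightarrow> (nat \<Rightarrow> nat) set \<Rightarrow> ((nat \<Rightarrow> nat) \<Rightarrow> 'z \<Rightarrow> 'a) \<Rightarrow> bool" where
  "relation J M b \<longleftrightarrow> finite M \<and> M \<noteq> {} \<and> (\<forall>\<mu>\<in>M. \<forall>j. j \<notin> J \<longrightarrow> \<mu> j = 0) \<and> (\<forall>\<mu>. b \<mu> \<in> B) \<and>
     (\<forall>\<mu>\<in>M. \<forall>\<^sub>F z in U. b \<mu> z \<noteq> 0) \<and> (\<forall>\<^sub>F z in U. (\<Sum>\<mu>\<in>M. b \<mu> z * mon J \<mu> z) = 0)"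

definition weight :: "nat set \<Rightarrow> (nat \<Rightarrow> nat) set \<Rightarrow> nat" where
  "weight J M = (\<Sum>\<mu>\<in>M. \<Sum>j\<in>J. \<mu> j)"

text \<open>Terms whose coefficient is eventually zero are discarded; by the ultrafilter dichotomy
  the other coefficients are eventually nonzero, and at least one term remains.\<close>

lemma relation_of_rep:
  assumes "rep J u M b" "\<forall>\<^sub>F z in U. u z = 0" "\<mu> \<in> M" "\<not> (\<forall>\<^sub>F z in U. b \<mu> z = 0)"
  shows "\<exists>M'. relation J M' b"
proof -
  define M' where "M' = {\<mu>\<in>M. \<forall>\<^sub>F z in U. b \<mu> z \<noteq> 0}"
  have "\<forall>\<mu>\<in>M - M'. \<forall>\<^sub>F z in U. b \<mu> z = 0"
    using not_eventually_iff by (auto simp: M'_def)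
  then have "\<forall>\<^sub>F z in U. \<forall>\<mu>\<in>M - M'. b \<mu> z = 0"
    using assms(1) by (intro eventually_ball_finite) (auto simp: rep_def)
  with assms(2) have "\<forall>\<^sub>F z in U. (\<Sum>\<mu>\<in>M'. b \<mu> z * mon J \<mu> z) = 0"
  proof eventually_elim
    case (elim z)
    have "(\<Sum>\<mu>\<in>M'. b \<mu> z * mon J \<mu> z) = (\<Sum>\<mu>\<in>M. b \<mu> z * mon J \<mu> z)"
      using assms(1) elim(2) by (intro sum.mono_neutral_left) (auto simp: M'_def rep_def)
    also have "\<dots> = u z" using assms(1) by (simp add: rep_def)
    finally show ?case using elim(1) by simp
  qed
  moreover have "\<mu> \<in> M'" using assms(3,4) not_eventually_iff[of "\<lambda>z. b \<mu> z = 0"] by (simp add: M'_def)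
  ultimately have "relation J M' b"
    using assms(1) by (auto simp: relation_def M'_def rep_def)
  then show ?thesis ..
qed

lemma relation_weight_pos:
  assumes "relation J M b" "finite J" shows "weight J M > 0"
proof (rule ccontr)
  assume "\<not> weight J M > 0"
  then have "\<mu> = (\<lambda>_. 0)" if "\<mu> \<in> M" for \<mu>
    using assms that by (fastforce simp: weight_def relation_def)
  then have M: "M = {\<lambda>_. 0}" using assms(1) by (auto simp: relation_def)
  have "\<forall>\<^sub>F z in U. b (\<lambda>_. 0) z = 0" "\<forall>\<^sub>F z in U. b (\<lambda>_. 0) z \<noteq> 0"
    using assms(1) unfolding relation_def M by (simp_all add: mon_def)
  then show False using not_eventually_iff by blast
qed

text \<open>If p divides all exponents, additivity of Frobenius makes the sum the p-th power of one
  with smaller exponents and with coefficients in \<open>B\<close>, because \<open>B\<close> is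
  perfect. In characteristic 0, divisibility by \<open>CHAR('a)\<close> would make all exponents
  zero, which \<open>relation_weight_pos\<close> excludes.\<close>

lemma relation_root:
  assumes J: "finite J" and rel: "relation J M b" and dvd: "\<And>\<mu> j. \<mu> \<in> M \<Longrightarrow> j \<in> J \<Longrightarrow> CHAR('a) dvd \<mu> j"
  shows "\<exists>M' b'. relation J M' b' \<and> weight J M' < weight J M"
proof (cases "CHAR('a) = 0")
  case True
  then have "weight J M = 0"
    unfolding weight_def by (intro sum.neutral ballI) (use dvd in simp)
  then show ?thesis using relation_weight_pos[OF rel J] by simp
next
  case False
  define p where "p = CHAR('a)"
  have p: "prime p" "p = char_exp TYPE('a)"
    using False by (auto simp: p_def char_exp_def intro: prime_CHAR_semidom)
  have dvd': "p dvd \<mu> j" if "\<mu> \<in> M" for \<mu> j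
    using dvd[OF that] rel that by (cases "j \<in> J") (auto simp: p_def relation_def)
  define r where "r \<mu> = (\<lambda>j. \<mu> j div p)" for \<mu> :: "nat \<Rightarrow> nat"
  have r: "(\<lambda>j. p * r \<mu> j) = \<mu>" if "\<mu> \<in> M" for \<mu>
    using dvd'[OF that] by (auto simp: r_def)
  have inj: "inj_on r M" by (rule inj_on_inverseI[where g = "\<lambda>\<nu> j. p * \<nu> j"]) (rule r)
  have "\<forall>\<mu>. \<exists>b'. b' \<in> B \<and> (\<forall>z. b' z ^ p = b \<mu> z)"
    using perfect rel unfolding p(2) relation_def by blast
  from choice[OF this] obtain \<beta> where \<beta>: "\<And>\<mu>. \<beta> \<mu> \<in> B" "\<And>\<mu> z. \<beta> \<mu> z ^ p = b \<mu> z" by blast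
  define b' where "b' \<nu> = \<beta> (\<lambda>j. p * \<nu> j)" for \<nu>
  have b': "b' (r \<mu>) z ^ p = b \<mu> z" if "\<mu> \<in> M" for \<mu> z using \<beta>(2) r[OF that] by (simp add: b'_def)
  have mon: "mon J (r \<mu>) z ^ p = mon J \<mu> z" if "\<mu> \<in> M" for \<mu> z
  proof -
    have "mon J (r \<mu>) z ^ p = (\<Prod>j\<in>J. x j z ^ (p * r \<mu> j))"
      by (simp add: mon_def prod_power_distrib power_mult[symmetric] mult.commute)
    then show ?thesis using r[OF that] by (metis (no_types, lifting) mon_def prod.cong)
  qed
  have "relation J (r ` M) b'"
    unfolding relation_def
  proof (intro conjI)
    show "finite (r ` M)" "r ` M \<noteq> {}" using rel by (simp_all add: relation_def)
    show "\<forall>\<mu>\<in>r ` M. \<forall>j. j \<notin> J \<longrightarrow> \<mu> j = 0" using rel by (auto simp: relation_def r_def)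
    show "\<forall>\<mu>. b' \<mu> \<in> B" using \<beta>(1) by (simp add: b'_def)
    show "\<forall>\<mu>\<in>r ` M. \<forall>\<^sub>F z in U. b' \<mu> z \<noteq> 0"
    proof clarify
      fix \<mu> assume \<mu>: "\<mu> \<in> M"
      then have "\<forall>\<^sub>F z in U. b \<mu> z \<noteq> 0" using rel by (simp add: relation_def)
      then show "\<forall>\<^sub>F z in U. b' (r \<mu>) z \<noteq> 0"
      proof eventually_elim
        case (elim z)
        then show ?case using b'[OF \<mu>, of z] p(1) prime_gt_0_nat[of p] by (auto simp: power_0_left)
      qed
    qed
    have "\<forall>\<^sub>F z in U. (\<Sum>\<mu>\<in>M. b \<mu> z * mon J \<mu> z) = 0" using rel by (simp add: relation_def)
    then show "\<forall>\<^sub>F z in U. (\<Sum>\<mu>\<in>r ` M. b' \<mu> z * mon J \<mu> z) = 0"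
    proof eventually_elim
      case (elim z)
      have "(\<Sum>\<mu>\<in>r ` M. b' \<mu> z * mon J \<mu> z) ^ p = (\<Sum>\<mu>\<in>M. (b' (r \<mu>) z * mon J (r \<mu>) z) ^ p)"
        unfolding p(2) sum_power_char_exp by (simp add: sum.reindex[OF inj])
      also have "\<dots> = (\<Sum>\<mu>\<in>M. b \<mu> z * mon J \<mu> z)"
        by (intro sum.cong) (simp_all add: power_mult_distrib b' mon)
      finally show ?case using elim by simp
    qed
  qed
  moreover have "weight J M = p * weight J (r ` M)"
  proof -
    have "weight J (r ` M) = (\<Sum>\<mu>\<in>M. \<Sum>j\<in>J. r \<mu> j)" by (simp add: weight_def sum.reindex[OF inj])
    also have "p * \<dots> = (\<Sum>\<mu>\<in>M. \<Sum>j\<in>J. p * r \<mu> j)" by (simp add: sum_distrib_left)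
    also have "\<dots> = weight J M"
      unfolding weight_def using r by (intro sum.cong refl) metis
    finally show ?thesis ..
  qed
  then have "weight J (r ` M) < weight J M"
    using relation_weight_pos[OF rel J] n_less_m_mult_n[of "weight J (r ` M)" p] prime_gt_1_nat[OF p(1)]
    by simp
  ultimately show ?thesis by blast
qed

text \<open>A vanishing derivative in \<open>x i\<close> is again a relation, once the terms whose
  exponent of \<open>x i\<close> is divisible by the characteristic are dropped. The factor
  \<open>of_nat (\<mu> i)\<close> is nonzero on the others, and their exponents of
  \<open>x i\<close> drop by one.\<close>

lemma relation_derivative:
  assumes J: "finite J" and rel: "relation J M b" and i: "i \<in> J"
    and \<mu>0: "\<mu>0 \<in> M" "\<not> CHAR('a) dvd \<mu>0 i"
    and zero: "\<forall>\<^sub>F z in U. (\<Sum>\<mu>\<in>M. of_nat (\<mu> i) * b \<mu> z * (x i z ^ (\<mu> i - 1) * mon (J - {i}) \<mu> z)) = 0"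
  shows "\<exists>M' b'. relation J M' b' \<and> weight J M' < weight J M"
proof -
  define M1 where "M1 = {\<mu>\<in>M. \<not> CHAR('a) dvd \<mu> i}"
  define r where "r \<mu> = \<mu>(i := \<mu> i - 1)" for \<mu> :: "nat \<Rightarrow> nat"
  define b' where "b' \<nu> = (\<lambda>z. of_nat (\<nu> i + 1) * b (\<nu>(i := \<nu> i + 1)) z)" for \<nu>
  have fin: "finite M" using rel by (simp add: relation_def)
  have pos: "\<mu> i > 0" if "\<mu> \<in> M1" for \<mu> using that by (cases "\<mu> i") (auto simp: M1_def)
  have inv: "(r \<mu>)(i := r \<mu> i + 1) = \<mu>" if "\<mu> \<in> M1" for \<mu> using pos[OF that] by (auto simp: r_def)
  have inj: "inj_on r M1" by (rule inj_on_inverseI[where g = "\<lambda>\<nu>. \<nu>(i := \<nu> i + 1)"]) (rule inv)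
  have b': "b' (r \<mu>) z = of_nat (\<mu> i) * b \<mu> z" if "\<mu> \<in> M1" for \<mu> z
    using inv[OF that] pos[OF that] by (simp add: b'_def) (simp add: r_def)
  have mon: "mon J (r \<mu>) z = x i z ^ (\<mu> i - 1) * mon (J - {i}) \<mu> z" for \<mu> z
  proof -
    have "mon J (r \<mu>) z = x i z ^ r \<mu> i * (\<Prod>j\<in>J - {i}. x j z ^ r \<mu> j)"
      unfolding mon_def using J i by (rule prod.remove)
    also have "(\<Prod>j\<in>J - {i}. x j z ^ r \<mu> j) = mon (J - {i}) \<mu> z"
      unfolding mon_def by (intro prod.cong) (auto simp: r_def)
    also have "r \<mu> i = \<mu> i - 1" by (simp add: r_def)
    finally show ?thesis .
  qed
  have "relation J (r ` M1) b'"
    unfolding relation_def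
  proof (intro conjI)
    show "finite (r ` M1)" "r ` M1 \<noteq> {}" using fin \<mu>0 by (auto simp: M1_def)
    show "\<forall>\<mu>\<in>r ` M1. \<forall>j. j \<notin> J \<longrightarrow> \<mu> j = 0" using rel i by (auto simp: relation_def r_def M1_def)
    have "(\<lambda>z. of_nat k) * b \<mu> \<in> fn.alg B" for k \<mu>
      using rel fn.alg.const[of "of_nat k" B] by (intro fn.alg.mult) (auto simp: relation_def intro: fn.alg.gen)
    then show "\<forall>\<mu>. b' \<mu> \<in> B"
      unfolding B_alg b'_def times_fun_def by blast
    show "\<forall>\<mu>\<in>r ` M1. \<forall>\<^sub>F z in U. b' \<mu> z \<noteq> 0"
    proof clarify
      fix \<mu> assume \<mu>: "\<mu> \<in> M1"
      then have "\<forall>\<^sub>F z in U. b \<mu> z \<noteq> 0" using rel by (simp add: relation_def M1_def)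
      then show "\<forall>\<^sub>F z in U. b' (r \<mu>) z \<noteq> 0"
        by eventually_elim (use \<mu> in \<open>simp add: b' M1_def of_nat_eq_0_iff_char_dvd\<close>)
    qed
    from zero show "\<forall>\<^sub>F z in U. (\<Sum>\<mu>\<in>r ` M1. b' \<mu> z * mon J \<mu> z) = 0"
    proof eventually_elim
      case (elim z)
      have "(\<Sum>\<mu>\<in>r ` M1. b' \<mu> z * mon J \<mu> z) =
         (\<Sum>\<mu>\<in>M1. of_nat (\<mu> i) * b \<mu> z * (x i z ^ (\<mu> i - 1) * mon (J - {i}) \<mu> z))"
        unfolding sum.reindex[OF inj] o_def by (intro sum.cong) (simp_all add: b' mon)
      also have "\<dots> = (\<Sum>\<mu>\<in>M. of_nat (\<mu> i) * b \<mu> z * (x i z ^ (\<mu> i - 1) * mon (J - {i}) \<mu> z))"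
        by (rule sum.mono_neutral_left) (use fin in \<open>auto simp: M1_def of_nat_eq_0_iff_char_dvd\<close>)
      finally show ?case using elim by simp
    qed
  qed
  moreover have "weight J (r ` M1) < weight J M"
  proof -
    have lt: "(\<Sum>j\<in>J. r \<mu> j) < (\<Sum>j\<in>J. \<mu> j)" if "\<mu> \<in> M1" for \<mu>
      by (rule sum_strict_mono_ex1) (use J i pos[OF that] in \<open>auto simp: r_def\<close>)
    have "weight J (r ` M1) = (\<Sum>\<mu>\<in>M1. \<Sum>j\<in>J. r \<mu> j)"
      by (simp add: weight_def sum.reindex[OF inj])
    also have "\<dots> < (\<Sum>\<mu>\<in>M1. \<Sum>j\<in>J. \<mu> j)"
      by (rule sum_strict_mono) (use fin \<mu>0 lt in \<open>auto simp: M1_def\<close>)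
    also have "\<dots> \<le> weight J M"
      unfolding weight_def by (rule sum_mono2) (use fin in \<open>auto simp: M1_def\<close>)
    finally show ?thesis .
  qed
  ultimately show ?thesis by blast
qed

text \<open>Minimal weight is used twice: through \<open>relation_root\<close> it yields an exponent
  not divisible by the characteristic, and through \<open>relation_derivative\<close> a nonvanishing
  derivative in that variable. If there is no relation at all, any variable is free over the
  others.\<close>

lemma separable_or_free:
  assumes J: "finite J" "J \<noteq> {}"
  shows "\<exists>i\<in>J. sepalg (fn.alg (B \<union> x ` (J - {i}))) (x i) \<or> free (fn.alg (B \<union> x ` (J - {i}))) (x i)"
proof (cases "\<exists>M b. relation J M b")
  case True
  then obtain M0 b0 where "relation J M0 b0" by blast
  then obtain M where M: "\<exists>b. relation J M b" "\<forall>M'. (\<exists>b. relation J M' b) \<longrightarrow> weight J M \<le> weight J M'"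
    using ex_has_least_nat[of "\<lambda>M. \<exists>b. relation J M b" M0 "weight J"] by blast
  obtain b where rel: "relation J M b" using M(1) by blast
  have min: "weight J M \<le> weight J M'" if "relation J M' b'" for M' b' using M(2) that by blast
  obtain \<mu>0 i where \<mu>0: "\<mu>0 \<in> M" "i \<in> J" "\<not> CHAR('a) dvd \<mu>0 i"
    using relation_root[OF J(1) rel] min by (metis not_less)
  have fin: "finite M" using rel by (simp add: relation_def)
  define c where "c d = (\<lambda>z. \<Sum>\<mu>\<in>{\<mu>\<in>M. \<mu> i = d}. b \<mu> z * mon (J - {i}) \<mu> z)" for d
  define D where "D = (\<Sum>\<mu>\<in>M. \<mu> i)"
  have D: "\<mu> i \<le> D" if "\<mu> \<in> M" for \<mu> unfolding D_def using member_le_sum[of \<mu> M "\<lambda>\<mu>. \<mu> i"] that fin by simp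
  have group: "(\<Sum>d\<le>D. \<Sum>\<mu>\<in>{\<mu>\<in>M. \<mu> i = d}. g \<mu>) = (\<Sum>\<mu>\<in>M. g \<mu>)" for g :: "_ \<Rightarrow> 'a"
    by (rule sum.group) (use fin D in auto)
  have c_alg: "c d \<in> fn.alg (B \<union> x ` (J - {i}))" for d
  proof -
    have "c d = (\<Sum>\<mu>\<in>{\<mu>\<in>M. \<mu> i = d}. b \<mu> * (\<Prod>j\<in>J - {i}. x j ^ \<mu> j))"
      by (rule ext) (simp add: c_def mon_def sum_fun_apply prod_fun_apply power_fun_apply)
    also have "\<dots> \<in> fn.alg (B \<union> x ` (J - {i}))"
      using rel by (intro fn.alg_sum fn.alg.mult fn.alg_prod fn.alg_power fn.alg.gen) (auto simp: relation_def)
    finally show ?thesis .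
  qed
  have mon: "mon J \<mu> z = x i z ^ \<mu> i * mon (J - {i}) \<mu> z" for \<mu> z
    unfolding mon_def using J(1) \<mu>0(2) by (rule prod.remove)
  have "(\<Sum>d\<le>D. c d z * x i z ^ d) = (\<Sum>\<mu>\<in>M. b \<mu> z * mon J \<mu> z)" for z
    unfolding group[symmetric] c_def sum_distrib_right
    by (intro sum.cong refl) (auto simp: mon mult_ac)
  then have "\<forall>\<^sub>F z in U. (\<Sum>d\<le>D. c d z * x i z ^ d) = 0" using rel by (simp add: relation_def)
  moreover have "(\<Sum>d\<le>D. of_nat d * c d z * x i z ^ (d - 1)) =
      (\<Sum>\<mu>\<in>M. of_nat (\<mu> i) * b \<mu> z * (x i z ^ (\<mu> i - 1) * mon (J - {i}) \<mu> z))" for z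
    unfolding group[symmetric] c_def sum_distrib_right sum_distrib_left
    by (intro sum.cong refl) (auto simp: mult_ac)
  moreover have "\<not> (\<forall>\<^sub>F z in U. (\<Sum>\<mu>\<in>M. of_nat (\<mu> i) * b \<mu> z * (x i z ^ (\<mu> i - 1) * mon (J - {i}) \<mu> z)) = 0)"
    using relation_derivative[OF J(1) rel \<mu>0(2,1,3)] min by (metis not_less)
  ultimately have "sepalg (fn.alg (B \<union> x ` (J - {i}))) (x i)"
    unfolding sepalg_def using c_alg not_eventually_iff by (intro exI[of _ c] exI[of _ D]) auto
  then show ?thesis using \<mu>0(2) by blast
next
  case False
  obtain i where i: "i \<in> J" using J(2) by blast
  let ?J = "J - {i}"
  have "free (fn.alg (B \<union> x ` ?J)) (x i)"
    unfolding free_def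
  proof (intro allI impI)
    fix c D d assume c: "\<forall>d. c d \<in> fn.alg (B \<union> x ` ?J)" "\<forall>\<^sub>F z in U. (\<Sum>d\<le>D. c d z * x i z ^ d) = 0"
      and d: "d \<le> D"
    have "\<forall>d. \<exists>Nb. rep ?J (c d) (fst Nb) (snd Nb)"
      using alg_rep[of ?J] c(1) J(1) by force
    from choice[OF this] obtain Nb where Nb: "\<And>d. rep ?J (c d) (fst (Nb d)) (snd (Nb d))" by blast
    define N where "N = (\<Union>d\<in>{..D}. (\<lambda>\<nu>. \<nu>(i := d)) ` fst (Nb d))"
    have "rep (insert i ?J) (\<lambda>z. \<Sum>d\<le>D. c d z * x i z ^ d) N (\<lambda>\<mu>. snd (Nb (\<mu> i)) (\<mu>(i := 0)))"
      unfolding N_def by (rule rep_combine[OF _ _ Nb]) (use Nb J in \<open>simp_all add: rep_def\<close>)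
    then have rep: "rep J (\<lambda>z. \<Sum>d\<le>D. c d z * x i z ^ d) N (\<lambda>\<mu>. snd (Nb (\<mu> i)) (\<mu>(i := 0)))"
      using i by (simp add: insert_absorb)
    have "\<forall>\<^sub>F z in U. snd (Nb d) \<nu> z = 0" if \<nu>: "\<nu> \<in> fst (Nb d)" for \<nu>
    proof (rule ccontr)
      assume *: "\<not> ?thesis"
      have \<nu>i: "(\<nu>(i := d))(i := 0) = \<nu>" using Nb[of d] \<nu> by (auto simp: rep_def)
      have "\<exists>M'. relation J M' (\<lambda>\<mu>. snd (Nb (\<mu> i)) (\<mu>(i := 0)))"
        by (rule relation_of_rep[OF rep c(2), of "\<nu>(i := d)"])
          (use \<nu> d * \<nu>i in \<open>auto simp: N_def\<close>)
      then show False using False by blast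
    qed
    then have "\<forall>\<^sub>F z in U. \<forall>\<nu>\<in>fst (Nb d). snd (Nb d) \<nu> z = 0"
      using Nb[of d] by (intro eventually_ball_finite) (auto simp: rep_def)
    then show "\<forall>\<^sub>F z in U. c d z = 0"
      by eventually_elim (use Nb[of d] in \<open>simp add: rep_def\<close>)
  qed
  then show ?thesis using i by blast
qed

text \<open>The element found by \<open>separable_or_free\<close> is placed last, and the others are
  ordered recursively; the free entries take the place of a separating transcendence basis.\<close>

lemma separating_order:
  "finite J \<Longrightarrow> \<exists>js. distinct js \<and> set js = J \<and>
     (\<forall>k<length js. sepalg (fn.alg (B \<union> x ` set (take k js))) (x (js ! k)) \<or>
        free (fn.alg (B \<union> x ` set (take k js))) (x (js ! k)))"
proof (induction "card J" arbitrary: J)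
  case 0
  then show ?case by (intro exI[of _ "[]"]) simp
next
  case (Suc n)
  then obtain i where i: "i \<in> J" "sepalg (fn.alg (B \<union> x ` (J - {i}))) (x i) \<or> free (fn.alg (B \<union> x ` (J - {i}))) (x i)"
    using separable_or_free[of J] by fastforce
  have "n = card (J - {i})" "finite (J - {i})" using Suc i(1) by auto
  from Suc.hyps(1)[OF this] obtain js where js: "distinct js" "set js = J - {i}"
     "\<And>k. k < length js \<Longrightarrow> sepalg (fn.alg (B \<union> x ` set (take k js))) (x (js ! k)) \<or>
        free (fn.alg (B \<union> x ` set (take k js))) (x (js ! k))" by blast
  show ?case
  proof (intro exI[of _ "js @ [i]"] conjI allI impI)
    show "distinct (js @ [i])" "set (js @ [i]) = J" using js(1,2) i(1) by auto
    fix k assume "k < length (js @ [i])"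
    then consider "k < length js" | "k = length js" by (auto simp: less_Suc_eq)
    then show "sepalg (fn.alg (B \<union> x ` set (take k (js @ [i])))) (x ((js @ [i]) ! k)) \<or>
        free (fn.alg (B \<union> x ` set (take k (js @ [i])))) (x ((js @ [i]) ! k))"
    proof cases
      case 1
      then show ?thesis using js(3)[of k] by (simp add: nth_append)
    next
      case 2
      then show ?thesis using i(2) js(2) by simp
    qed
  qed
qed

end

section \<open>Smooth arcs in a diophantine set\<close>

lemma fn_ev_apply: "fn.ev y p z = peval (\<lambda>i. y i z) p"
  by (simp add: fn.ev_def peval_def sum_fun_apply prod_fun_apply power_fun_apply)

lemma (in const_hom) ev_poly_mvar:
  "ev y (poly f (mvar n)) = (\<Sum>d\<le>degree f. ev y (coeff f d) * y n ^ d)"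
  by (simp add: poly_altdef ev_sum ev_mult ev_power)

lemmas peval_poly_mvar = const_hom.ev_poly_mvar[OF const_hom_id, unfolded ev_id]

text \<open>Leading coefficients are polynomials and cannot be inverted, so each step multiplies by
  the leading coefficient of \<open>g\<close>. The set \<open>A\<close> stands for
  \<open>polys n\<close>, in which quotient and remainder must stay.\<close>

lemma pseudo_division:
  fixes f g :: "'r::comm_ring_1 poly"
  assumes A: "0 \<in> A" "\<And>a b. a \<in> A \<Longrightarrow> b \<in> A \<Longrightarrow> a + b \<in> A" "\<And>a b. a \<in> A \<Longrightarrow> b \<in> A \<Longrightarrow> a * b \<in> A"
      "\<And>a. a \<in> A \<Longrightarrow> - a \<in> A" "1 \<in> A"
    and g: "\<And>i. coeff g i \<in> A" "degree g > 0"
    and f: "\<And>i. coeff f i \<in> A"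
  shows "\<exists>N q r. (\<forall>i. coeff q i \<in> A) \<and> (\<forall>i. coeff r i \<in> A) \<and>
     smult (lead_coeff g ^ N) f = q * g + r \<and> degree r < degree g"
  using f
proof (induction "degree f" arbitrary: f rule: less_induct)
  case less
  show ?case
  proof (cases "degree f < degree g")
    case True
    then show ?thesis
      using less.prems A(1) by (intro exI[of _ 0] exI[of _ 0] exI[of _ f]) simp
  next
    case False
    define m where "m = monom (lead_coeff f) (degree f - degree g)"
    define f1 where "f1 = smult (lead_coeff g) f - m * g"
    have sum: "sum h S \<in> A" if "\<And>i. i \<in> S \<Longrightarrow> h i \<in> A" for h and S :: "nat set"
      using that by (induction S rule: infinite_finite_induct) (auto intro: A)
    have pow: "lead_coeff g ^ N \<in> A" for N
      by (induction N) (auto intro: A g)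
    have mult: "coeff (p * p') i \<in> A" if "\<And>i. coeff p i \<in> A" "\<And>i. coeff p' i \<in> A" for p p' i
      unfolding coeff_mult by (intro sum A(3) that)
    have mA: "coeff m i \<in> A" for i using less.prems A(1) by (simp add: m_def)
    have "coeff f1 i \<in> A" for i
      using A(2)[OF A(3)[OF g(1) less.prems] A(4)[OF mult[OF mA g(1)]]] by (simp add: f1_def)
    moreover have "degree f1 < degree f"
    proof -
      have "degree (m * g) \<le> degree f"
        using degree_mult_le[of m g] degree_monom_le[of "lead_coeff f" "degree f - degree g"] False
        by (simp add: m_def)
      then have le: "degree f1 \<le> degree f"
        unfolding f1_def by (intro degree_diff_le) (auto intro: order.trans[OF degree_smult_le])
      have "coeff f1 (degree f) = 0"
        using False by (simp add: f1_def m_def coeff_monom_mult)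
      then show ?thesis
        using le g(2) False leading_coeff_0_iff[of f1] by (cases "degree f1 = degree f") auto
    qed
    ultimately obtain N q r where r: "\<And>i. coeff q i \<in> A" "\<And>i. coeff r i \<in> A"
      "smult (lead_coeff g ^ N) f1 = q * g + r" "degree r < degree g"
      using less.hyps by blast
    have "smult (lead_coeff g ^ Suc N) f = (q + smult (lead_coeff g ^ N) m) * g + r"
      using r(3) by (simp add: f1_def smult_diff_right algebra_simps)
    moreover have "coeff (q + smult (lead_coeff g ^ N) m) i \<in> A" for i
      using A(2)[OF r(1) A(3)[OF pow mA]] by simp
    ultimately show ?thesis using r(2,4) by blast
  qed
qed

context ultra
begin

text \<open>A k[[t]]-point through \<open>ys\<close> at \<open>z\<close>, on the variety of all
  relations that hold among \<open>ys\<close> modulo \<open>U\<close>. Being a tower makes it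
  algebraic, and the first coordinate is a prescribed line in t.\<close>

definition arc :: "('z \<Rightarrow> 'a::field) list \<Rightarrow> 'z \<Rightarrow> 'a \<Rightarrow> 'a fps list \<Rightarrow> bool" where
  "arc ys z a gs \<longleftrightarrow> length gs = length ys \<and> tower gs \<and> (\<forall>i<length ys. gs ! i $ 0 = (ys ! i) z) \<and>
     (\<forall>p\<in>polys (length ys). (\<forall>\<^sub>F w in U. peval (\<lambda>i. (ys ! i) w) p = 0) \<longrightarrow> fps.ev ((!) gs) p = 0) \<and>
     (ys \<noteq> [] \<longrightarrow> gs ! 0 = fps_const ((ys ! 0) z) + fps_const a * fps_X)"

lemma in_fn_alg_peval:
  assumes "p \<in> polys (length ys)"
  shows "(\<lambda>w. peval (\<lambda>i. (ys ! i) w) p) \<in> fn.alg (set ys)"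
proof -
  have "(\<lambda>w. peval (\<lambda>i. (ys ! i) w) p) = fn.ev ((!) ys) p" by (rule ext) (simp add: fn_ev_apply)
  also have "\<dots> \<in> fn.alg (set ys)" by (rule fn.ev_in_alg[OF assms]) (simp add: fn.alg.gen)
  finally show ?thesis .
qed

lemma peval_snoc:
  assumes "\<And>i. coeff f i \<in> polys (length ys)"
  shows "peval (\<lambda>i. ((ys @ [y]) ! i) w) (poly f (mvar (length ys))) =
    (\<Sum>d\<le>degree f. peval (\<lambda>i. (ys ! i) w) (coeff f d) * y w ^ d)"
  unfolding peval_poly_mvar
  by (intro sum.cong refl arg_cong2[of _ _ _ _ "(*)"] peval_cong[OF assms]) (simp_all add: nth_append)

lemma fps_ev_snoc:
  assumes "\<And>i. coeff f i \<in> polys (length gs)"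
  shows "fps.ev ((!) (gs @ [u])) (poly f (mvar (length gs))) =
    (\<Sum>d\<le>degree f. fps.ev ((!) gs) (coeff f d) * u ^ d)"
  unfolding fps.ev_poly_mvar
  by (intro sum.cong refl arg_cong2[of _ _ _ _ "(*)"] fps.ev_cong[OF assms]) (simp_all add: nth_append)

lemma arc_snoc:
  assumes "arc ys z a gs" "etale (set gs) u" "u $ 0 = y z"
    and "\<And>f. (\<And>i. coeff f i \<in> polys (length ys)) \<Longrightarrow>
       \<forall>\<^sub>F w in U. peval (\<lambda>i. ((ys @ [y]) ! i) w) (poly f (mvar (length ys))) = 0 \<Longrightarrow>
       fps.ev ((!) (gs @ [u])) (poly f (mvar (length ys))) = 0"
    and "ys = [] \<Longrightarrow> u = fps_const (y z) + fps_const a * fps_X"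
  shows "arc (ys @ [y]) z a (gs @ [u])"
  unfolding arc_def
proof (intro conjI ballI impI allI)
  have len: "length gs = length ys" using assms(1) by (simp add: arc_def)
  show "length (gs @ [u]) = length (ys @ [y])" using len by simp
  show "tower (gs @ [u])" using assms(1,2) by (simp add: tower_snoc arc_def)
  show "(gs @ [u]) ! i $ 0 = ((ys @ [y]) ! i) z" if "i < length (ys @ [y])" for i
    using that assms(1,3) len by (cases "i < length ys") (auto simp: nth_append arc_def less_Suc_eq)
  show "(gs @ [u]) ! 0 = fps_const (((ys @ [y]) ! 0) z) + fps_const a * fps_X"
    using assms(1,5) len by (cases "ys = []") (auto simp: nth_append arc_def)
  fix p assume p: "p \<in> polys (length (ys @ [y]))" "\<forall>\<^sub>F w in U. peval (\<lambda>i. ((ys @ [y]) ! i) w) p = 0"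
  then obtain f where "\<forall>i. coeff f i \<in> polys (length ys)" "p = poly f (mvar (length ys))"
    using polys_Suc_poly[of p "length ys"] by auto
  then show "fps.ev ((!) (gs @ [u])) p = 0" using assms(4)[of f] p(2) by simp
qed

text \<open>A relation for a free \<open>y\<close> has coefficients that are relations among
  \<open>ys\<close>, and the arc already satisfies these; so the new coordinate is unconstrained
  beyond its constant term. A line is a polynomial in t, hence etale.\<close>

lemma arc_free:
  assumes "arc ys z a gs" "free (fn.alg (set ys)) y"
  shows "arc (ys @ [y]) z a (gs @ [fps_const (y z) + fps_const a * fps_X])"
proof (rule arc_snoc[OF assms(1)])
  have len: "length gs = length ys" using assms(1) by (simp add: arc_def)
  show "etale (set gs) (fps_const (y z) + fps_const a * fps_X)"
    by (intro etale_base fps.alg.add fps.alg.mult fps.alg.const) (simp add: fps.alg.gen)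
  fix f assume f: "\<And>i. coeff f i \<in> polys (length ys)"
    and zero: "\<forall>\<^sub>F w in U. peval (\<lambda>i. ((ys @ [y]) ! i) w) (poly f (mvar (length ys))) = 0"
  have "\<forall>d. (\<lambda>w. peval (\<lambda>i. (ys ! i) w) (coeff f d)) \<in> fn.alg (set ys)"
    using in_fn_alg_peval f by blast
  then have "\<forall>d\<le>degree f. \<forall>\<^sub>F w in U. peval (\<lambda>i. (ys ! i) w) (coeff f d) = 0"
    using assms(2)[unfolded free_def, rule_format, of "\<lambda>d w. peval (\<lambda>i. (ys ! i) w) (coeff f d)" "degree f"]
      zero unfolding peval_snoc[OF f] by blast
  then have "fps.ev ((!) gs) (coeff f d) = 0" if "d \<le> degree f" for d
    using assms(1) f that by (simp add: arc_def)
  then show "fps.ev ((!) (gs @ [fps_const (y z) + fps_const a * fps_X])) (poly f (mvar (length ys))) = 0"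
    using fps_ev_snoc[of f gs] f len by simp
qed simp_all

text \<open>Let \<open>F\<close> be a relation for \<open>y\<close> of least degree. By
  pseudo-division every other relation follows from \<open>F\<close> and relations among
  \<open>ys\<close>, once the leading coefficient is inverted, so it is enough to solve
  \<open>F\<close> by Hensel's lemma. The conditions on \<open>z\<close> mention neither
  \<open>a\<close> nor \<open>gs\<close>: one base point serves all slopes.\<close>

lemma arc_sepalg:
  assumes sep: "sepalg (fn.alg (set ys)) (y :: 'z \<Rightarrow> 'a::field)"
  shows "\<forall>\<^sub>F z in U. \<forall>a gs. ys \<noteq> [] \<longrightarrow> arc ys z a gs \<longrightarrow> (\<exists>u. arc (ys @ [y]) z a (gs @ [u]))"
proof -
  let ?n = "length ys"
  define E where "E f w = peval (\<lambda>i. ((ys @ [y]) ! i) w) (poly f (mvar ?n))" for f :: "'a mpoly poly" and w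
  define C where "C p w = peval (\<lambda>i. ((ys @ [y]) ! i) w) p" for p :: "'a mpoly" and w
  define Pn where "Pn f \<longleftrightarrow> (\<forall>i. coeff f i \<in> polys ?n)" for f :: "'a mpoly poly"
  have E_simps: "E (f + g) w = E f w + E g w" "E (f * g) w = E f w * E g w" "E (smult p f) w = C p w * E f w"
    for f g p w by (simp_all add: E_def C_def peval_add peval_mult)
  have E_sum: "E f w = (\<Sum>d\<le>degree f. C (coeff f d) w * y w ^ d)" for f w
    by (simp add: E_def C_def peval_poly_mvar)
  have C_pow: "C (p ^ N) w = C p w ^ N" for p N w by (simp add: C_def peval_power)
  have C_prefix: "C p w = peval (\<lambda>i. (ys ! i) w) p" if "p \<in> polys ?n" for p w
    unfolding C_def by (rule peval_cong[OF that]) (simp add: nth_append)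
  obtain c D where c: "\<And>d. c d \<in> fn.alg (set ys)" "\<forall>\<^sub>F z in U. (\<Sum>d\<le>D. c d z * y z ^ d) = 0"
     "\<forall>\<^sub>F z in U. (\<Sum>d\<le>D. of_nat d * c d z * y z ^ (d - 1)) \<noteq> 0"
    using sep unfolding sepalg_def by blast
  have img: "(!) ys ` {..<?n} = set ys" using nth_image[of ?n ys] by (simp add: atLeast0LessThan)
  have "\<forall>d. \<exists>p. p \<in> polys ?n \<and> c d = fn.ev ((!) ys) p"
    using fn.alg_ev[of _ "(!) ys" ?n] c(1) unfolding img by blast
  from choice[OF this] obtain Cd where Cd: "\<And>d. Cd d \<in> polys ?n" "\<And>d. c d = fn.ev ((!) ys) (Cd d)" by blast
  have c_eq: "c d w = C (Cd d) w" for d w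
    using C_prefix[OF Cd(1)] by (simp add: Cd(2) fn_ev_apply)
  define H where "H = (\<Sum>d\<le>D. monom (Cd d) d)"
  have H_polys: "Pn H" using Cd(1) by (auto simp: Pn_def H_def coeff_sum)
  have EH: "E H w = (\<Sum>d\<le>D. c d w * y w ^ d)" for w
    by (simp add: E_def H_def poly_sum poly_monom peval_sum peval_mult peval_power c_eq C_def)
  have EH': "E (pderiv H) w = (\<Sum>d\<le>D. of_nat d * c d w * y w ^ (d - 1))" for w
  proof -
    have of_nat: "peval v (of_nat k) = of_nat k" for v k
      by (induction k) (simp_all add: peval_add)
    have "pderiv H = (\<Sum>d\<le>D. monom (of_nat d * Cd d) (d - 1))"
      unfolding H_def by (induction D) (simp_all add: pderiv_monom pderiv_add)
    then show ?thesis
      by (simp add: E_def poly_sum poly_monom peval_sum peval_mult peval_power c_eq C_def of_nat)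
  qed
  have coeffs_zero: "\<forall>\<^sub>F w in U. E f w = 0" if "\<And>d. \<forall>\<^sub>F w in U. C (coeff f d) w = 0" for f
  proof -
    have "\<forall>\<^sub>F w in U. \<forall>d\<in>{..degree f}. C (coeff f d) w = 0"
      using that by (intro eventually_ball_finite) auto
    then show ?thesis by eventually_elim (simp add: E_sum)
  qed
  have pderiv_zero: "\<forall>\<^sub>F w in U. E (pderiv f) w = 0" if f: "\<And>d. \<forall>\<^sub>F w in U. C (coeff f d) w = 0" for f
  proof (rule coeffs_zero)
    fix d show "\<forall>\<^sub>F w in U. C (coeff (pderiv f) d) w = 0"
      using f[of "Suc d"] by eventually_elim (simp only: coeff_pderiv C_def peval_mult mult_zero_right)
  qed
  \<comment> \<open>Nontriviality is meant modulo \<open>U\<close>, whereas the degree is the formal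
    one; minimality then shows in \<open>lead\<close> that the leading coefficient of
    \<open>F\<close> does not vanish modulo \<open>U\<close>.\<close>
  define Rel where "Rel f \<longleftrightarrow> Pn f \<and> (\<forall>\<^sub>F w in U. E f w = 0) \<and> (\<exists>d. \<not> (\<forall>\<^sub>F w in U. C (coeff f d) w = 0))" for f
  have "Rel H"
    using H_polys c(2,3) pderiv_zero[of H] not_eventually_iff unfolding Rel_def EH EH' by blast
  then obtain F where F: "Rel F" and min: "\<And>f. Rel f \<Longrightarrow> degree F \<le> degree f"
    using ex_has_least_nat[of Rel H degree] by blast
  let ?c = "lead_coeff F"
  have cn: "?c \<in> polys ?n" using F by (simp add: Rel_def Pn_def)
  have lead: "\<not> (\<forall>\<^sub>F w in U. C ?c w = 0)"
  proof
    assume zero: "\<forall>\<^sub>F w in U. C ?c w = 0"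
    define G where "G = F - monom ?c (degree F)"
    have coeff_G: "coeff G d = (if d = degree F then 0 else coeff F d)" for d by (simp add: G_def)
    have "\<forall>\<^sub>F w in U. E F w = 0" using F by (simp add: Rel_def)
    with zero have "\<forall>\<^sub>F w in U. E G w = 0"
    proof eventually_elim
      case (elim w)
      have "E F w = E G w + C ?c w * y w ^ degree F"
        by (simp add: G_def E_def C_def poly_monom peval_diff peval_mult peval_power)
      then show ?case using elim by simp
    qed
    moreover obtain d where d: "\<not> (\<forall>\<^sub>F w in U. C (coeff F d) w = 0)" using F by (auto simp: Rel_def)
    then have d': "d \<noteq> degree F" using zero by auto
    ultimately have "Rel G"
      using F d coeff_G unfolding Rel_def Pn_def by (auto intro!: exI[of _ d])
    then have "degree F \<le> degree G" by (rule min)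
    moreover have "degree G \<le> degree F" by (rule degree_le) (simp add: coeff_G coeff_eq_0)
    ultimately have "lead_coeff G = 0" using coeff_G[of "degree G"] by simp
    then have "G = 0" by simp
    then have "coeff F d = 0" using coeff_G[of d] d' by simp
    then show False using d by (simp add: C_def)
  qed
  have deg: "degree F > 0"
  proof (rule ccontr)
    assume "\<not> degree F > 0"
    then have "E F w = C ?c w" for w by (simp add: E_sum)
    then show False using F lead by (simp add: Rel_def)
  qed
  have reduce: "\<exists>N q r. Pn q \<and> Pn r \<and> smult (?c ^ N) f = q * F + r \<and> (\<forall>d. \<forall>\<^sub>F w in U. C (coeff r d) w = 0)"
    if f: "Pn f" "\<forall>\<^sub>F w in U. E f w = 0" for f
  proof -
    have "\<And>i. coeff F i \<in> polys ?n" "\<And>i. coeff f i \<in> polys ?n"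
      using F f(1) by (simp_all add: Rel_def Pn_def)
    from pseudo_division[OF polys_zero polys_add polys_mult polys_uminus polys_one this(1) deg this(2)]
    obtain N q r where r: "Pn q" "Pn r" "smult (?c ^ N) f = q * F + r" "degree r < degree F"
      unfolding Pn_def by blast
    have "\<forall>\<^sub>F w in U. E F w = 0" using F by (simp add: Rel_def)
    with f(2) have "\<forall>\<^sub>F w in U. E r w = 0"
    proof eventually_elim
      case (elim w)
      then show ?case using arg_cong[OF r(3), of "\<lambda>f. E f w"] by (simp add: E_simps)
    qed
    then have "\<forall>d. \<forall>\<^sub>F w in U. C (coeff r d) w = 0"
      using min[of r] r(2,4) unfolding Rel_def by auto
    then show ?thesis using r by blast
  qed
  \<comment> \<open>Separability passes from \<open>H\<close> to \<open>F\<close>: if the derivative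
    of \<open>F\<close> vanished at \<open>y\<close>, differentiating the pseudo-division of
    \<open>H\<close> by \<open>F\<close> would make the derivative of \<open>H\<close> vanish there,
    as the remainder has zero coefficients modulo \<open>U\<close>.\<close>
  have deriv: "\<forall>\<^sub>F w in U. E (pderiv F) w \<noteq> 0"
  proof (rule ccontr)
    assume "\<not> ?thesis"
    then have zero: "\<forall>\<^sub>F w in U. E (pderiv F) w = 0" using not_eventually_iff by blast
    obtain N q r where r: "smult (?c ^ N) H = q * F + r" "\<And>d. \<forall>\<^sub>F w in U. C (coeff r d) w = 0"
      using reduce[OF H_polys] c(2) unfolding EH by blast
    have eq: "smult (?c ^ N) (pderiv H) = q * pderiv F + F * pderiv q + pderiv r"
      using arg_cong[OF r(1), of pderiv] by (simp add: pderiv_smult pderiv_add pderiv_mult)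
    have eqw: "C ?c w ^ N * E (pderiv H) w = E q w * E (pderiv F) w + E F w * E (pderiv q) w + E (pderiv r) w" for w
      using arg_cong[OF eq, of "\<lambda>f. E f w"] unfolding E_simps C_pow .
    have "\<forall>\<^sub>F w in U. E (pderiv r) w = 0" using r(2) by (rule pderiv_zero)
    moreover have "\<forall>\<^sub>F w in U. E F w = 0" using F by (simp add: Rel_def)
    moreover have "\<forall>\<^sub>F w in U. C ?c w \<noteq> 0" using lead not_eventually_iff by blast
    ultimately have "\<forall>\<^sub>F w in U. E (pderiv H) w = 0"
      using zero
    proof eventually_elim
      case (elim w)
      then show ?case using eqw[of w] by simp
    qed
    then show False using c(3) not_eventually_iff unfolding EH' by blast
  qed
  have "\<forall>\<^sub>F w in U. C ?c w \<noteq> 0" using lead not_eventually_iff by blast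
  moreover have "\<forall>\<^sub>F w in U. E F w = 0" using F by (simp add: Rel_def)
  ultimately show ?thesis using deriv
  proof eventually_elim
    case (elim z)
    show ?case
    proof (intro allI impI)
      fix a gs assume ys: "ys \<noteq> []" and arc: "arc ys z a gs"
      have len: "length gs = ?n" using arc by (simp add: arc_def)
      have FP: "coeff F i \<in> polys ?n" for i using F by (simp add: Rel_def Pn_def)
      have nth0: "(gs @ [u]) ! i $ 0 = ((ys @ [y]) ! i) z" if "u $ 0 = y z" "i < Suc ?n" for u i
        using that arc len by (cases "i < ?n") (auto simp: nth_append arc_def less_Suc_eq)
      have ev0: "fps.ev ((!) (gs @ [u])) p $ 0 = C p z" if "p \<in> polys (Suc ?n)" "u $ 0 = y z" for p u
        unfolding fps_ev_nth_0[OF that(1)] C_def by (rule peval_cong[OF that(1)]) (rule nth0[OF that(2)])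
      have map_ev: "poly (map_poly (fps.ev ((!) gs)) h) u = fps.ev ((!) (gs @ [u])) (poly h (mvar ?n))"
        if h: "\<And>i. coeff h i \<in> polys ?n" for h u
      proof -
        have "map_poly (fps.ev ((!) gs)) h = map_poly (fps.ev ((!) (gs @ [u]))) h"
          by (intro poly_eqI) (simp add: coeff_map_poly, rule fps.ev_cong[OF h], simp add: nth_append len)
        then show ?thesis using map_poly_fps_ev[of "(!) (gs @ [u])" h ?n] len by (simp add: nth_append)
      qed
      define f where "f = map_poly (fps.ev ((!) gs)) F"
      have F'P: "coeff (pderiv F) i \<in> polys ?n" for i
        unfolding coeff_pderiv by (intro polys_mult polys_of_nat FP)
      have f0: "poly f u $ 0 = 0" and f'0: "poly (pderiv f) u $ 0 \<noteq> 0" if "u $ 0 = y z" for u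
        using elim(2,3) ev0[OF poly_mvar_in_polys[OF FP] that] ev0[OF poly_mvar_in_polys[OF F'P] that]
        unfolding f_def pderiv_map_poly_fps_ev map_ev[OF FP] map_ev[OF F'P] E_def C_def by simp_all
      obtain u where u: "u $ 0 = y z" "poly f u = 0"
        using hensel_fps[of f "y z"] f0 f'0 by auto
      have "coeff f i \<in> fps.alg (insert fps_X (set gs))" for i
        unfolding f_def using FP
        by (auto simp: coeff_map_poly len intro!: fps.ev_in_alg intro: fps.alg.gen)
      then have "etale (set gs) u" unfolding etale_def using u(2) f'0[OF u(1)] by blast
      moreover have "fps.ev ((!) (gs @ [u])) (poly k (mvar ?n)) = 0"
        if k: "\<And>i. coeff k i \<in> polys ?n" "\<forall>\<^sub>F w in U. peval (\<lambda>i. ((ys @ [y]) ! i) w) (poly k (mvar ?n)) = 0" for k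
      proof -
        obtain N q r where r: "Pn q" "Pn r" "smult (?c ^ N) k = q * F + r" "\<And>d. \<forall>\<^sub>F w in U. C (coeff r d) w = 0"
          using reduce[of k] k unfolding Pn_def E_def by blast
        have "fps.ev ((!) gs) (coeff r d) = 0" for d
          using arc r(4)[of d] r(2) C_prefix[of "coeff r d"] unfolding arc_def Pn_def by simp
        then have "fps.ev ((!) (gs @ [u])) (poly r (mvar ?n)) = 0"
          using fps_ev_snoc[of r gs u] r(2) len by (simp add: Pn_def)
        moreover have "fps.ev ((!) (gs @ [u])) (poly F (mvar ?n)) = 0"
          using map_ev[OF FP, of u] u(2) by (simp add: f_def)
        moreover have "fps.ev ((!) (gs @ [u])) ?c ^ N * fps.ev ((!) (gs @ [u])) (poly k (mvar ?n)) =
            fps.ev ((!) (gs @ [u])) (poly q (mvar ?n)) * fps.ev ((!) (gs @ [u])) (poly F (mvar ?n)) +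
            fps.ev ((!) (gs @ [u])) (poly r (mvar ?n))"
          using arg_cong[OF r(3), of "\<lambda>h. fps.ev ((!) (gs @ [u])) (poly h (mvar ?n))"]
          by (simp add: fps.ev_mult fps.ev_add fps.ev_power)
        \<comment> \<open>On the arc the leading coefficient has a constant term equal to its
          nonzero value at \<open>z\<close>, so its power can be cancelled in the domain of power
          series.\<close>
        moreover have "fps.ev ((!) (gs @ [u])) ?c \<noteq> 0"
          using ev0[OF polys_mono[OF _ cn] u(1)] elim(1) by auto
        ultimately show ?thesis by simp
      qed
      ultimately have "arc (ys @ [y]) z a (gs @ [u])"
        using ys arc_snoc[where u = u and y = y, OF arc _ u(1)] by auto
      then show "\<exists>u. arc (ys @ [y]) z a (gs @ [u])" ..
    qed
  qed
qed

lemma polys_0: "p \<in> polys 0 \<Longrightarrow> \<exists>c. p = mconst c" for p :: "'a::field mpoly"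
proof (induction rule: polys_induct)
  case (add q r)
  then show ?case by (metis single_add)
next
  case (mult q r)
  then show ?case by (metis mult_single add_0)
qed auto

text \<open>The first entry must be free over the constants to admit a line of arbitrary slope; each
  later entry excludes a set of \<open>z\<close> outside the ultrafilter, or none.\<close>

lemma arc_exists:
  fixes ys :: "('z \<Rightarrow> 'a::field) list"
  assumes "\<And>k. k < length ys \<Longrightarrow> sepalg (fn.alg (set (take k ys))) (ys ! k) \<or> free (fn.alg (set (take k ys))) (ys ! k)"
    and "ys \<noteq> [] \<Longrightarrow> free (fn.alg {}) (ys ! 0)"
  shows "\<forall>\<^sub>F z in U. \<forall>a. \<exists>gs. arc ys z a gs"
  using assms
proof (induction ys rule: rev_induct)
  case Nil
  have "fps.ev y p = 0" if "p \<in> polys 0" "\<forall>\<^sub>F w in U. peval (\<lambda>i. ([] ! i) w) p = 0"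
    for p :: "'a mpoly" and y
    using polys_0[OF that(1)] that(2) nonbot by (auto simp: eventually_const)
  then have arc: "arc [] z a []" for z and a :: 'a by (simp add: arc_def)
  show ?case by (intro always_eventually allI exI) (rule arc)
next
  case (snoc y ys)
  have "\<forall>\<^sub>F z in U. \<forall>a. \<exists>gs. arc ys z a gs"
  proof (rule snoc.IH)
    fix k assume "k < length ys"
    then show "sepalg (fn.alg (set (take k ys))) (ys ! k) \<or> free (fn.alg (set (take k ys))) (ys ! k)"
      using snoc.prems(1)[of k] by (simp add: nth_append)
  next
    assume "ys \<noteq> []" then show "free (fn.alg {}) (ys ! 0)"
      using snoc.prems(2) by (simp add: nth_append)
  qed
  moreover have "(ys \<noteq> [] \<and> sepalg (fn.alg (set ys)) y) \<or> free (fn.alg (set ys)) y"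
    using snoc.prems(1)[of "length ys"] snoc.prems(2) by (cases "ys = []") auto
  then have "\<forall>\<^sub>F z in U. \<forall>a gs. arc ys z a gs \<longrightarrow> (\<exists>u. arc (ys @ [y]) z a (gs @ [u]))"
  proof
    assume "ys \<noteq> [] \<and> sepalg (fn.alg (set ys)) y"
    then show ?thesis using arc_sepalg[of ys y] by (auto elim: eventually_mono)
  next
    assume "free (fn.alg (set ys)) y"
    then show ?thesis using arc_free by (intro always_eventually) blast
  qed
  ultimately show ?case by eventually_elim blast
qed

end

text \<open>Power series form a domain, so it is enough to keep the product of the given series
  nonzero.\<close>

lemma specialization_nonzero:
  fixes gs vs :: "'a::field fps list"
  assumes "large_field TYPE('a)" "tower gs" "set vs \<subseteq> fps.alg (insert fps_X (set gs))" "0 \<notin> set vs"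
  shows "\<exists>\<chi>. (\<forall>m y p. p \<in> polys m \<longrightarrow> (\<forall>i<m. y i \<in> fps.alg (insert fps_X (set gs))) \<longrightarrow>
     \<chi> (fps.ev y p) = peval (\<lambda>i. \<chi> (y i)) p) \<and> (\<forall>v\<in>set vs. \<chi> v \<noteq> (0::'a))"
proof -
  let ?A = "fps.alg (insert fps_X (set gs))"
  define p :: "'a mpoly" where "p = (\<Prod>i<length vs. mvar i)"
  have p: "p \<in> polys (length vs)"
  proof -
    have "(\<Prod>i\<in>S. mvar i) \<in> (polys (length vs) :: 'a mpoly set)" if "S \<subseteq> {..<length vs}" for S
      using finite_subset[OF that finite_lessThan] that
      by (induction S rule: finite_induct) (auto intro: polys_mult polys_var)
    then show ?thesis by (simp add: p_def)
  qed
  have ev: "fps.ev ((!) vs) p = (\<Prod>i<length vs. vs ! i)" by (simp add: p_def fps.ev_prod)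
  have in_A: "vs ! i \<in> ?A" if "i < length vs" for i using that assms(3) by auto
  have "fps.ev ((!) vs) p \<in> ?A" by (rule fps.ev_in_alg[OF p in_A])
  moreover have "fps.ev ((!) vs) p \<noteq> 0"
    unfolding ev using assms(4) by (auto simp: prod_zero_iff in_set_conv_nth)
  ultimately obtain \<chi> where \<chi>: "\<forall>m y p. p \<in> polys m \<longrightarrow> (\<forall>i<m. y i \<in> ?A) \<longrightarrow>
      \<chi> (fps.ev y p) = peval (\<lambda>i. \<chi> (y i)) p" "\<chi> (fps.ev ((!) vs) p) \<noteq> (0::'a)"
    using large_field_specialization[OF assms(1,2)] by metis
  then have "peval (\<lambda>i. \<chi> (vs ! i)) p \<noteq> 0" using p in_A by metis
  then have "(\<Prod>i<length vs. \<chi> (vs ! i)) \<noteq> 0" by (simp add: p_def peval_prod)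
  then have "\<forall>v\<in>set vs. \<chi> v \<noteq> 0" by (auto simp: in_set_conv_nth)
  then show ?thesis using \<chi>(1) by blast
qed

section \<open>Formulas as polynomial conditions, and descent to a finite level of roots\<close>

primrec term_vars :: "'a fterm \<Rightarrow> nat set" where
  "term_vars (Var i) = {i}"
| "term_vars (Param c) = {}"
| "term_vars (Plus s t) = term_vars s \<union> term_vars t"
| "term_vars (Minus t) = term_vars t"
| "term_vars (Times s t) = term_vars s \<union> term_vars t"

text \<open>Negation is ignored on purpose: a point keeps the truth of the formula if it keeps the
  truth value of every atom, equation or inequation.\<close>

primrec atoms :: "'a qf_formula \<Rightarrow> ('a fterm \<times> 'a fterm) list" where
  "atoms (Equal s t) = [(s, t)]"
| "atoms (Neg \<phi>) = atoms \<phi>"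
| "atoms (Conj \<phi> \<psi>) = atoms \<phi> @ atoms \<psi>"
| "atoms (Disj \<phi> \<psi>) = atoms \<phi> @ atoms \<psi>"

primrec term_poly :: "(nat \<Rightarrow> 'a mpoly) \<Rightarrow> 'a::field fterm \<Rightarrow> 'a mpoly" where
  "term_poly v (Var i) = v i"
| "term_poly v (Param c) = mconst c"
| "term_poly v (Plus s t) = term_poly v s + term_poly v t"
| "term_poly v (Minus t) = - term_poly v t"
| "term_poly v (Times s t) = term_poly v s * term_poly v t"

lemma finite_term_vars: "finite (term_vars t)"
  by (induction t) auto

lemma peval_term_poly: "peval w (term_poly v t) = term_val (\<lambda>i. peval w (v i)) t"
  by (induction t) (simp_all add: peval_add peval_mult peval_uminus)

lemma term_poly_in_polys: "(\<And>i. v i \<in> polys n) \<Longrightarrow> term_poly v t \<in> polys n"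
  by (induction t) (auto intro: polys_add polys_mult polys_uminus)

lemma term_val_cong: "(\<And>i. i \<in> term_vars t \<Longrightarrow> e i = e' i) \<Longrightarrow> term_val e t = term_val e' t"
  by (induction t) auto

lemma qf_holds_atoms:
  "(\<And>s t. (s, t) \<in> set (atoms \<phi>) \<Longrightarrow> term_val e s = term_val e t \<longleftrightarrow> term_val e' s = term_val e' t) \<Longrightarrow>
    qf_holds e \<phi> \<longleftrightarrow> qf_holds e' \<phi>"
  by (induction \<phi>) auto

text \<open>An element of the algebra involves finitely many of the \<open>s m\<close>, and each of
  these is a polynomial expression in any later \<open>s M\<close>.\<close>

lemma fn_alg_union_chain:
  assumes chain: "\<And>m. s m \<in> fn.alg {s (Suc m)}" and u: "u \<in> fn.alg (fn.alg (range s) \<union> G)"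
  shows "\<exists>M0. \<forall>M\<ge>M0. u \<in> fn.alg (insert (s M) G)"
proof -
  have "u \<in> fn.alg (range s \<union> G)"
    by (rule fn.alg_mono'[OF u]) (use fn.alg_mono[of "range s" "range s \<union> G"] in \<open>auto intro: fn.alg.gen\<close>)
  then show ?thesis
  proof (induction rule: fn.alg.induct)
    case (const c)
    then show ?case using fn.alg.const by blast
  next
    case (gen g)
    show ?case
    proof (cases "g \<in> G")
      case True
      then show ?thesis by (auto intro: fn.alg.gen)
    next
      case False
      then obtain m where m: "g = s m" using gen by blast
      have "s m \<in> fn.alg {s (m + k)}" for k
      proof (induction k)
        case (Suc k)
        then show ?case using fn.alg_mono'[OF Suc, of "{s (m + Suc k)}"] chain[of "m + k"] by simp
      qed (auto intro: fn.alg.gen)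
      then have "g \<in> fn.alg {s M}" if "M \<ge> m" for M using that m by (metis le_add_diff_inverse)
      then show ?thesis using fn.alg_mono[of "{s _}" "insert (s _) G"] by blast
    qed
  next
    case (add u v)
    then obtain M0 M1 where "\<forall>M\<ge>M0. u \<in> fn.alg (insert (s M) G)" "\<forall>M\<ge>M1. v \<in> fn.alg (insert (s M) G)"
      by blast
    then show ?case by (intro exI[of _ "max M0 M1"] allI impI fn.alg.add) simp_all
  next
    case (mult u v)
    then obtain M0 M1 where "\<forall>M\<ge>M0. u \<in> fn.alg (insert (s M) G)" "\<forall>M\<ge>M1. v \<in> fn.alg (insert (s M) G)"
      by blast
    then show ?case by (intro exI[of _ "max M0 M1"] allI impI fn.alg.mult) simp_all
  qed
qed

text \<open>A separable equation has finitely many coefficients, all of them available from some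
  level on. The counterpart for \<open>free\<close> is \<open>free_mono\<close>, valid at every
  level.\<close>

lemma (in ultra) sepalg_chain:
  assumes chain: "\<And>m. s m \<in> fn.alg {s (Suc m)}" and sep: "sepalg (fn.alg (fn.alg (range s) \<union> G)) v"
  shows "\<exists>M0. \<forall>M\<ge>M0. sepalg (fn.alg (insert (s M) G)) v"
proof -
  obtain c D where c: "\<And>d. c d \<in> fn.alg (fn.alg (range s) \<union> G)" "\<forall>\<^sub>F z in U. (\<Sum>d\<le>D. c d z * v z ^ d) = 0"
     "\<forall>\<^sub>F z in U. (\<Sum>d\<le>D. of_nat d * c d z * v z ^ (d - 1)) \<noteq> 0"
    using sep unfolding sepalg_def by blast
  have "\<forall>d. \<exists>M0. \<forall>M\<ge>M0. c d \<in> fn.alg (insert (s M) G)"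
    using fn_alg_union_chain[OF chain c(1)] by blast
  from choice[OF this] obtain M0 where M0: "\<And>d M. M \<ge> M0 d \<Longrightarrow> c d \<in> fn.alg (insert (s M) G)" by blast
  have "sepalg (fn.alg (insert (s M) G)) v" if M: "M \<ge> (\<Sum>d\<le>D. M0 d)" for M
  proof -
    have "M0 d \<le> M" if "d \<le> D" for d
      using member_le_sum[of d "{..D}" M0] that M by simp
    then have "\<forall>d. (if d \<le> D then c d else 0) \<in> fn.alg (insert (s M) G)" using M0 by simp
    then show ?thesis
      unfolding sepalg_def using c(2,3)
      by (intro exI[of _ "\<lambda>d. if d \<le> D then c d else 0"] exI[of _ D]) simp
  qed
  then show ?thesis by blast
qed

text \<open>Elements of \<open>fn.alg {}\<close> are constants, so a relation is a polynomial over k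
  in \<open>v z\<close>. If it were nonzero, injectivity of \<open>v\<close> would leave it finitely
  many zeros, a set that \<open>U\<close> avoids.\<close>

lemma (in ultra) free_injective:
  fixes v :: "'z \<Rightarrow> 'a::field"
  assumes "inj v" "\<And>F. finite F \<Longrightarrow> \<forall>\<^sub>F z in U. z \<notin> F"
  shows "free (fn.alg {}) v"
  unfolding free_def
proof (intro allI impI)
  fix c D d assume c: "\<forall>d. c d \<in> fn.alg {}" "\<forall>\<^sub>F z in U. (\<Sum>d\<le>D. c d z * v z ^ d) = 0" and d: "d \<le> D"
  have const: "\<exists>a. u = (\<lambda>_. a)" if "u \<in> fn.alg {}" for u :: "'z \<Rightarrow> 'a"
    using that by (induction rule: fn.alg.induct) auto
  then have "\<forall>d. \<exists>a. c d = (\<lambda>_. a)" using c(1) by blast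
  from choice[OF this] obtain a where a: "\<And>d. c d = (\<lambda>_. a d)" by blast
  define p where "p = (\<Sum>d\<le>D. monom (a d) d)"
  have p: "poly p (v z) = (\<Sum>d\<le>D. c d z * v z ^ d)" for z
    by (simp add: p_def a poly_sum poly_monom)
  have "p = 0"
  proof (rule ccontr)
    assume "p \<noteq> 0"
    then have "finite (v -` {t. poly p t = 0})"
      using assms(1) poly_roots_finite by (intro finite_vimageI) auto
    from assms(2)[OF this] c(2) have "\<forall>\<^sub>F z in U. False"
      by eventually_elim (simp add: p)
    then show False using nonbot by (simp add: eventually_False)
  qed
  then have "a d = 0" using d by (auto simp: p_def coeff_sum dest!: arg_cong[of _ _ "\<lambda>p. coeff p d"])
  then show "\<forall>\<^sub>F z in U. c d z = 0" by (simp add: a)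
qed

proposition lines_in_diophantine_set:
  fixes S :: "'a::field set"
  assumes "perfect_field TYPE('a)" "large_field TYPE('a)" "diophantine S" "infinite S"
  shows "\<exists>s0. \<forall>F. finite F \<longrightarrow> (\<exists>\<sigma>. \<sigma> \<noteq> 0 \<and> (\<forall>a\<in>F. s0 + a * \<sigma> \<in> S))"
proof -
  let ?e = "char_exp TYPE('a)"
  obtain \<phi> where S: "S = {a. \<exists>y. qf_holds (case_nat a y) \<phi>}"
    using assms(3) unfolding diophantine_def by blast
  obtain U :: "'a filter" where U: "U \<noteq> bot" "\<And>P. eventually P U \<or> eventually (\<lambda>z. \<not> P z) U"
      "\<forall>\<^sub>F z in U. z \<in> S" "\<And>F. finite F \<Longrightarrow> \<forall>\<^sub>F z in U. z \<notin> F"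
    using exists_ultrafilter[OF assms(4)] by blast
  interpret ultra U by unfold_locales (use U in auto)
  define Y where "Y z = (SOME y. qf_holds (case_nat z y) \<phi>)" for z
  have Y: "qf_holds (case_nat z (Y z)) \<phi>" if zS: "z \<in> S" for z
  proof -
    obtain y where "qf_holds (case_nat z y) \<phi>" using zS unfolding S by blast
    then show ?thesis unfolding Y_def by (rule someI[where P = "\<lambda>y. qf_holds (case_nat z y) \<phi>"])
  qed
  have "\<forall>x::'a. \<exists>y. y ^ ?e = x"
    using assms(1) unfolding perfect_field_def char_exp_def by (auto simp: surj_def) metis
  from choice[OF this] obtain \<rho> :: "'a \<Rightarrow> 'a" where \<rho>: "\<And>x. \<rho> x ^ ?e = x" by blast
  have \<rho>_pow: "((\<rho> ^^ M) x) ^ (?e ^ M) = x" for M x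
  proof (induction M)
    case (Suc M)
    have "((\<rho> ^^ Suc M) x) ^ (?e ^ Suc M) = (\<rho> ((\<rho> ^^ M) x) ^ ?e) ^ (?e ^ M)"
      by (simp add: power_mult)
    then show ?case using Suc by (simp add: \<rho>)
  qed simp
  \<comment> \<open>\<open>s m\<close> is the p^m-th root of the identity function, which is the
    tautological point of the set; in characteristic 0 every \<open>s m\<close> is the
    identity.\<close>
  define s where "s m z = (\<rho> ^^ m) z" for m z
  have s_Suc: "s (Suc m) z ^ ?e = s m z" for m z by (simp add: s_def \<rho>)
  have chain: "s m \<in> fn.alg {s (Suc m)}" for m
  proof -
    have "s m = s (Suc m) ^ ?e" by (rule ext) (simp only: power_fun_apply s_Suc)
    also have "\<dots> \<in> fn.alg {s (Suc m)}" by (intro fn.alg_power fn.alg.gen) simp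
    finally show ?thesis .
  qed
  \<comment> \<open>This base is perfect: constants have roots because k is perfect,
    \<open>s m\<close> has the root \<open>s (Suc m)\<close>, and Frobenius respects sums and
    products.\<close>
  define B where "B = fn.alg (range s)"
  define J where "J = (\<Union>(t, t')\<in>set (atoms \<phi>). {i. Suc i \<in> term_vars t \<union> term_vars t'})"
  have "finite {i. Suc i \<in> term_vars t \<union> term_vars t'}" for t t' :: "'a fterm"
    using finite_term_vars[of t] finite_term_vars[of t'] finite_vimageI[of "term_vars t \<union> term_vars t'" Suc] by (simp add: vimage_def)
  then have "finite J" unfolding J_def by auto
  define x where "x i z = Y z i" for i z
  interpret perfect_base U B x
  proof
    have "fn.alg B \<subseteq> B" unfolding B_def using fn.alg_mono' by blast
    then show "fn.alg B = B" by (auto intro: fn.alg.gen)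
    fix b assume "b \<in> B"
    then show "\<exists>b'\<in>B. \<forall>z. b' z ^ ?e = b z"
      unfolding B_def
    proof (induction rule: fn.alg.induct)
      case (const c)
      then show ?case using fn.alg.const[of "\<rho> c"] \<rho> by (intro bexI[of _ "\<lambda>_. \<rho> c"]) auto
    next
      case (gen g)
      then obtain m where "g = s m" by blast
      then show ?case using s_Suc fn.alg.gen[of "s (Suc m)" "range s"] by (intro bexI[of _ "s (Suc m)"]) auto
    next
      case (add u v)
      then obtain u' v' where "u' \<in> fn.alg (range s)" "\<forall>z. u' z ^ ?e = u z"
        "v' \<in> fn.alg (range s)" "\<forall>z. v' z ^ ?e = v z" by blast
      then show ?case using add_power_char_exp_power[of "u' _" "v' _" 1]
        by (intro bexI[of _ "u' + v'"] fn.alg.add) simp_all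
    next
      case (mult u v)
      then obtain u' v' where "u' \<in> fn.alg (range s)" "\<forall>z. u' z ^ ?e = u z"
        "v' \<in> fn.alg (range s)" "\<forall>z. v' z ^ ?e = v z" by blast
      then show ?case
        by (intro bexI[of _ "u' * v'"] fn.alg.mult) (simp_all add: power_mult_distrib)
    qed
  qed
  obtain js where js: "distinct js" "set js = J"
     "\<And>k. k < length js \<Longrightarrow> sepalg (fn.alg (B \<union> x ` set (take k js))) (x (js ! k)) \<or>
        free (fn.alg (B \<union> x ` set (take k js))) (x (js ! k))"
    using separating_order[OF \<open>finite J\<close>] by blast
  have "\<forall>k. \<exists>M0. \<forall>M\<ge>M0. k < length js \<longrightarrow>
      sepalg (fn.alg (insert (s M) (x ` set (take k js)))) (x (js ! k)) \<or>
      free (fn.alg (insert (s M) (x ` set (take k js)))) (x (js ! k))"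
  proof
    fix k
    let ?G = "x ` set (take k js)"
    have sub: "fn.alg (insert (s M) ?G) \<subseteq> fn.alg (B \<union> ?G)" for M
      by (rule fn.alg_mono) (auto simp: B_def intro: fn.alg.gen)
    show "\<exists>M0. \<forall>M\<ge>M0. k < length js \<longrightarrow> sepalg (fn.alg (insert (s M) ?G)) (x (js ! k)) \<or>
        free (fn.alg (insert (s M) ?G)) (x (js ! k))"
      using js(3)[of k] free_mono[OF _ sub] sepalg_chain[of s ?G "x (js ! k)", OF chain]
      unfolding B_def by blast
  qed
  from choice[OF this] obtain M0 where M0: "\<And>k M. M \<ge> M0 k \<Longrightarrow> k < length js \<Longrightarrow>
      sepalg (fn.alg (insert (s M) (x ` set (take k js)))) (x (js ! k)) \<or>
      free (fn.alg (insert (s M) (x ` set (take k js)))) (x (js ! k))" by blast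
  define M where "M = (\<Sum>k<length js. M0 k)"
  have M: "M0 k \<le> M" if "k < length js" for k
    unfolding M_def using member_le_sum[of k "{..<length js}" M0] that by simp
  let ?q = "?e ^ M"
  have q_pow: "s M z ^ ?q = z" for z by (simp add: s_def \<rho>_pow)
  have free0: "free (fn.alg {}) (s M)"
    by (rule free_injective[OF _ U(4)]) (metis injI q_pow)
  define ys where "ys = s M # map x js"
  let ?n = "length ys"
  have arcs: "\<forall>\<^sub>F z in U. \<forall>a. \<exists>gs. arc ys z a gs"
  proof (rule arc_exists)
    fix k assume k: "k < length ys"
    show "sepalg (fn.alg (set (take k ys))) (ys ! k) \<or> free (fn.alg (set (take k ys))) (ys ! k)"
    proof (cases k)
      case 0
      then show ?thesis using free0 by (simp add: ys_def)
    next
      case (Suc k')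
      then show ?thesis using M0[OF M, of k'] k by (simp add: ys_def take_map)
    qed
  qed (simp add: ys_def free0)
  define idx where "idx i = (SOME k. k < length js \<and> js ! k = i)" for i
  have idx: "idx i < length js" "js ! idx i = i" if "i \<in> J" for i
  proof -
    have "\<exists>k. k < length js \<and> js ! k = i" using that js(2) by (metis in_set_conv_nth)
    from someI_ex[OF this] show "idx i < length js" "js ! idx i = i" by (simp_all add: idx_def)
  qed
  \<comment> \<open>The arcs start with the root \<open>s M\<close>, so the free variable of the
    formula is the \<open>?q\<close>-th power of coordinate 0. Variables that do not occur in the
    formula get the default 0, which no atom sees.\<close>
  define v :: "nat \<Rightarrow> 'a mpoly" where
    "v i = (case i of 0 \<Rightarrow> mvar 0 ^ ?q | Suc i \<Rightarrow> if i \<in> J then mvar (Suc (idx i)) else 0)" for i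
  have v: "v i \<in> polys ?n" for i
    using idx by (auto simp: v_def ys_def split: nat.split intro!: polys_power polys_var)
  define dif where "dif = (\<lambda>(t, t'). term_poly v t - term_poly v t')"
  have dif: "dif tt \<in> polys ?n" for tt
    unfolding dif_def by (auto split: prod.split intro!: polys_diff term_poly_in_polys v)
  have dif_zero: "peval w (dif (t, t')) = 0 \<longleftrightarrow>
      term_val (\<lambda>i. peval w (v i)) t = term_val (\<lambda>i. peval w (v i)) t'" for w t t'
    by (simp add: dif_def peval_diff peval_term_poly)
  define pt where "pt z i = (ys ! i) z" for z i
  have holds: "qf_holds (\<lambda>i. peval (pt z) (v i)) \<phi>" if z: "z \<in> S" for z
  proof -
    have "peval (pt z) (v i) = case_nat z (Y z) i"
      if "i \<in> term_vars t \<union> term_vars t'" "(t, t') \<in> set (atoms \<phi>)" for i t t'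
    proof (cases i)
      case 0
      then show ?thesis by (simp add: v_def peval_power pt_def ys_def q_pow)
    next
      case (Suc j)
      then have "j \<in> J" using that by (force simp: J_def)
      then show ?thesis using Suc idx[of j] by (simp add: v_def pt_def ys_def x_def)
    qed
    then have "term_val (\<lambda>i. peval (pt z) (v i)) t = term_val (case_nat z (Y z)) t \<and>
        term_val (\<lambda>i. peval (pt z) (v i)) t' = term_val (case_nat z (Y z)) t'"
      if "(t, t') \<in> set (atoms \<phi>)" for t t'
      using that by (intro conjI term_val_cong) blast+
    then show ?thesis using qf_holds_atoms[of \<phi>] Y[OF z] by metis
  qed
  \<comment> \<open>The base point is taken generic: each of the finitely many atoms has at
    \<open>z\<close> the truth value that it has modulo \<open>U\<close>.\<close>
  have "\<forall>\<^sub>F z in U. \<forall>tt\<in>set (atoms \<phi>). peval (pt z) (dif tt) = 0 \<longleftrightarrow>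
      (\<forall>\<^sub>F w in U. peval (pt w) (dif tt) = 0)"
  proof (intro eventually_ball_finite ballI)
    fix tt
    show "\<forall>\<^sub>F z in U. peval (pt z) (dif tt) = 0 \<longleftrightarrow> (\<forall>\<^sub>F w in U. peval (pt w) (dif tt) = 0)"
      using not_eventually_iff[of "\<lambda>z. peval (pt z) (dif tt) = 0"]
      by (cases "\<forall>\<^sub>F w in U. peval (pt w) (dif tt) = 0") (auto elim: eventually_mono)
  qed simp
  with arcs U(3) have "\<forall>\<^sub>F z in U. (\<forall>a. \<exists>gs. arc ys z a gs) \<and> z \<in> S \<and>
      (\<forall>tt\<in>set (atoms \<phi>). peval (pt z) (dif tt) = 0 \<longleftrightarrow> (\<forall>\<^sub>F w in U. peval (pt w) (dif tt) = 0))"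
    by eventually_elim blast
  then obtain z where z: "\<And>a. \<exists>gs. arc ys z a gs" "z \<in> S"
      "\<And>tt. tt \<in> set (atoms \<phi>) \<Longrightarrow> peval (pt z) (dif tt) = 0 \<longleftrightarrow> (\<forall>\<^sub>F w in U. peval (pt w) (dif tt) = 0)"
    using U(1) eventually_happens[of _ U] by blast
  have "\<forall>a. \<exists>gs. arc ys z ((\<rho> ^^ M) a) gs" using z(1) by blast
  from choice[OF this] obtain G where G: "\<And>a. arc ys z ((\<rho> ^^ M) a) (G a)" by blast
  have "\<exists>\<sigma>. \<sigma> \<noteq> 0 \<and> (\<forall>a\<in>F. z + a * \<sigma> \<in> S)" if F: "finite F" for F
  proof -
    obtain as where as: "set as = F" using finite_list[OF F] by blast
    define gs where "gs = concat (map G as)"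
    \<comment> \<open>Atoms true modulo \<open>U\<close> hold along every arc. The false ones must
      not become true: their series have nonzero constant terms, so they are added to the list that
      \<open>\<chi>\<close> keeps nonzero, next to \<open>fps_X\<close>, which ensures \<sigma>
      \<noteq> 0.\<close>
    define bad where "bad = filter (\<lambda>tt. \<not> (\<forall>\<^sub>F w in U. peval (pt w) (dif tt) = 0)) (atoms \<phi>)"
    define vs where "vs = fps_X # concat (map (\<lambda>a. map (\<lambda>tt. fps.ev ((!) (G a)) (dif tt)) bad) as)"
    let ?A = "fps.alg (insert fps_X (set gs))"
    have tower: "tower gs" unfolding gs_def using G by (intro tower_concat) (auto simp: arc_def)
    have G_in: "G a ! i \<in> ?A" if "a \<in> F" "i < ?n" for a i
      using that as G[of a] by (auto simp: gs_def arc_def intro!: fps.alg.gen)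
    have ev0: "fps.ev ((!) (G a)) p $ 0 = peval (pt z) p" if "p \<in> polys ?n" for a p
      unfolding fps_ev_nth_0[OF that] using G[of a]
      by (intro peval_cong[OF that]) (simp add: arc_def pt_def)
    have sub: "set vs \<subseteq> ?A"
      using G_in as by (auto simp: vs_def intro: fps.alg.gen intro!: fps.ev_in_alg[OF dif])
    have nz: "0 \<notin> set vs"
    proof
      assume "0 \<in> set vs"
      then obtain a tt where tt: "tt \<in> set bad" "fps.ev ((!) (G a)) (dif tt) = 0"
        by (auto simp: vs_def)
      then have "peval (pt z) (dif tt) = 0" using ev0[OF dif, of a tt] by simp
      then show False using z(3)[of tt] tt(1) by (auto simp: bad_def)
    qed
    from specialization_nonzero[OF assms(2) tower sub nz] obtain \<chi> where
      *: "(\<forall>m y p. p \<in> polys m \<longrightarrow> (\<forall>i<m. y i \<in> ?A) \<longrightarrow>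
        \<chi> (fps.ev y p) = peval (\<lambda>i. \<chi> (y i)) p) \<and> (\<forall>v\<in>set vs. \<chi> v \<noteq> (0::'a))" ..
    have \<chi>: "\<chi> (fps.ev y p) = peval (\<lambda>i. \<chi> (y i)) p" if "p \<in> polys m" "\<And>i. i < m \<Longrightarrow> y i \<in> ?A" for m y p
      by (rule *[THEN conjunct1, rule_format, OF that])
    have \<chi>_nz: "\<chi> v \<noteq> 0" if "v \<in> set vs" for v
      by (rule *[THEN conjunct2, rule_format, OF that])
    have "z + a * \<chi> fps_X ^ ?q \<in> S" if a: "a \<in> F" for a
    proof -
      let ?w = "\<lambda>i. \<chi> (G a ! i)"
      have w: "peval ?w p = \<chi> (fps.ev ((!) (G a)) p)" if "p \<in> polys ?n" for p
        using \<chi>[OF that, of "(!) (G a)"] G_in[OF a] by simp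
      have "peval ?w (dif tt) = 0 \<longleftrightarrow> peval (pt z) (dif tt) = 0" if tt: "tt \<in> set (atoms \<phi>)" for tt
      proof (cases "\<forall>\<^sub>F w in U. peval (pt w) (dif tt) = 0")
        case True
        then have "fps.ev ((!) (G a)) (dif tt) = 0"
          using G[of a] dif unfolding arc_def pt_def by blast
        moreover have "\<chi> 0 = 0" using \<chi>[of 0 0 "\<lambda>_. 0"] by simp
        ultimately show ?thesis using w[OF dif] z(3)[OF tt] True by simp
      next
        case False
        then have "fps.ev ((!) (G a)) (dif tt) \<in> set vs"
          using tt a as by (auto simp: vs_def bad_def)
        then show ?thesis using \<chi>_nz w[OF dif] z(3)[OF tt] False by simp
      qed
      then have "term_val (\<lambda>i. peval ?w (v i)) t = term_val (\<lambda>i. peval ?w (v i)) t' \<longleftrightarrow>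
          term_val (\<lambda>i. peval (pt z) (v i)) t = term_val (\<lambda>i. peval (pt z) (v i)) t'"
        if "(t, t') \<in> set (atoms \<phi>)" for t t'
        using that unfolding dif_zero[symmetric] by blast
      then have "qf_holds (\<lambda>i. peval ?w (v i)) \<phi>"
        using qf_holds_atoms[of \<phi>] holds[OF z(2)] by blast
      moreover have "(\<lambda>i. peval ?w (v i)) = case_nat (peval ?w (v 0)) (\<lambda>i. peval ?w (v (Suc i)))"
        by (auto split: nat.split)
      ultimately have "peval ?w (v 0) \<in> S" unfolding S by auto
      moreover have "peval ?w (v 0) = \<chi> (G a ! 0) ^ ?q" by (simp add: v_def peval_power)
      moreover have "\<chi> (G a ! 0) = s M z + (\<rho> ^^ M) a * \<chi> fps_X"
      proof -
        \<comment> \<open>\<open>\<chi>\<close> is controlled only through polynomial expressions,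
          so the line is written as the value of a polynomial at t.\<close>
        have "G a ! 0 = fps.ev (\<lambda>_. fps_X) (mconst (s M z) + mconst ((\<rho> ^^ M) a) * mvar 0)"
          using G[of a] by (simp add: arc_def ys_def fps.ev_add fps.ev_mult)
        moreover have "(mconst (s M z) + mconst ((\<rho> ^^ M) a) * mvar 0 :: 'a mpoly) \<in> polys 1"
          by (intro polys_add polys_mult polys_var) simp_all
        ultimately show ?thesis
          using \<chi>[of _ 1 "\<lambda>_. fps_X"] by (simp add: fps.alg.gen peval_add peval_mult)
      qed
      ultimately have "(s M z + (\<rho> ^^ M) a * \<chi> fps_X) ^ ?q \<in> S" by simp
      \<comment> \<open>The slope was chosen as a \<open>?q\<close>-th root of \<open>a\<close>;
        raising to the power \<open>?q\<close> thus leaves \<open>z\<close> plus \<open>a\<close>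
        times a factor common to all \<open>a\<close>.\<close>
      then show ?thesis
        unfolding add_power_char_exp_power power_mult_distrib q_pow \<rho>_pow .
    qed
    moreover have "\<chi> fps_X ^ ?q \<noteq> 0" using \<chi>_nz[of fps_X] by (simp add: vs_def)
    ultimately show ?thesis by blast
  qed
  then show ?thesis by blast
qed

theorem theorem1p1:
  fixes \<Sigma> :: "'a::field set" and I :: "'i set"
    and K :: "'i \<Rightarrow> 'a set" and \<alpha> \<beta> :: "'i \<Rightarrow> 'a"
  assumes "perfect_field TYPE('a)"
    and "large_field TYPE('a)"
    and "diophantine \<Sigma>" and "infinite \<Sigma>"
    and "finite I"
    and "\<And>i. i \<in> I \<Longrightarrow> subfield (K i) (ring_of_type_algebra :: 'a ring)"
    and "\<And>i. i \<in> I \<Longrightarrow> K i \<noteq> UNIV"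
  shows "\<Sigma> - (\<Union>i\<in>I. (\<lambda>x. \<alpha> i * x + \<beta> i) ` K i) \<approx> (UNIV :: 'a set)"
proof -
  obtain s0 where lines: "\<And>F. finite F \<Longrightarrow> \<exists>\<sigma>. \<sigma> \<noteq> 0 \<and> (\<forall>a\<in>F. s0 + a * \<sigma> \<in> \<Sigma>)"
    using lines_in_diophantine_set[OF assms(1-4)] by blast
  have "infinite (UNIV :: 'a set)"
    using assms(4) finite_subset[OF subset_UNIV] by blast
  then interpret proper_subfields I K
    using assms(5-7) by (rule proper_subfields.intro)
  show ?thesis by (rule complement_eqpoll_UNIV[OF lines])
qed

end
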